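(* Let $\alpha\in(0,1)$ and $\beta>0$ satisfy $3/4<\alpha^2\beta^2/(2\log2)<1$. Let $G_n$ be the $n$-dimensional hypercube with vertex set $\mathcal V_n=\{-1,1\}^n$ and edges between configurations differing in exactly one coordinate. Let $(E_x)_{x\in\mathcal V_n}$ be i.i.d. with $\mathbb P[-E_x/\sqrt n\ge u]=e^{-u^2/2}$, $u\ge0$, and $\tau_x=\exp(-\beta E_x)$. Let $X_n$ be the continuous-time Markov chain on $\mathcal V_n$ with $X_n(0)=(1,\dots,1)$ and jump rates $w_{xy}=n^{-1}\tau_x^{-1}$ for neighbours $x,y$ (i.e., the Bouchaud trap model with $a=0$, $\nu=1/n$). Put $t_w(n)=\exp(\alpha\beta^2n)$. Then for every $\theta>0$ and a.e. $\boldsymbol\tau$, \[\lim_{n\to\infty}\mathbb P[X_n(t_w(n))=X_n((1+\theta)t_w(n))\mid\boldsymbol\tau]=\mathrm{Asl}_\alpha\Big(\frac1{1+\theta}\Big).\]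
   Context: $\mathrm{Asl}_\alpha(u)=\frac{\sin\alpha\pi}{\pi}\int_0^u s^{\alpha-1}(1-s)^{-\alpha}ds$ is the generalised arcsine distribution function. *)

theory Defs
  imports "HOL-Probability.Probability"
begin

definition hcube :: "nat \<Rightarrow> (nat \<Rightarrow> int) set" where
  "hcube n = {0..<n} \<rightarrow>\<^sub>E {-1, 1}"

definition hcube_one :: "nat \<Rightarrow> nat \<Rightarrow> int" where
  "hcube_one n = restrict (\<lambda>_. 1) {0..<n}"

definition hc_adj :: "nat \<Rightarrow> (nat \<Rightarrow> int) \<Rightarrow> (nat \<Rightarrow> int) \<Rightarrow> bool" where
  "hc_adj n x y \<longleftrightarrow> x \<in> hcube n \<and> y \<in> hcube n \<and> card {i \<in> {0..<n}. x i \<noteq> y i} = 1"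

definition ctmc_gen :: "'a set \<Rightarrow> ('a \<Rightarrow> 'a \<Rightarrow> real) \<Rightarrow> 'a \<Rightarrow> 'a \<Rightarrow> real" where
  "ctmc_gen S w x y = (if x = y then - (\<Sum>z\<in>S - {x}. w x z) else w x y)"

fun mat_pow :: "'a set \<Rightarrow> ('a \<Rightarrow> 'a \<Rightarrow> real) \<Rightarrow> nat \<Rightarrow> 'a \<Rightarrow> 'a \<Rightarrow> real" where
  "mat_pow S Q 0 x y = (if x = y then 1 else 0)"
| "mat_pow S Q (Suc k) x y = (\<Sum>z\<in>S. mat_pow S Q k x z * Q z y)"

definition ctmc_trans :: "'a set \<Rightarrow> ('a \<Rightarrow> 'a \<Rightarrow> real) \<Rightarrow> real \<Rightarrow> 'a \<Rightarrow> 'a \<Rightarrow> real" where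
  "ctmc_trans S w t x y = (\<Sum>k. t ^ k / fact k * mat_pow S (ctmc_gen S w) k x y)"

text \<open>Probability that X(t) = X(s) (0 \<le> t \<le> s) for the chain started at x0.\<close>
definition ctmc_same_prob :: "'a set \<Rightarrow> ('a \<Rightarrow> 'a \<Rightarrow> real) \<Rightarrow> 'a \<Rightarrow> real \<Rightarrow> real \<Rightarrow> real" where
  "ctmc_same_prob S w x0 t s = (\<Sum>y\<in>S. ctmc_trans S w t x0 y * ctmc_trans S w (s - t) y y)"

text \<open>Bouchaud trap model with a = 0, nu = 1/n: traps tau_x = exp(-beta E_x),
  rates w_xy = n^{-1} tau_x^{-1} for neighbours.\<close>
definition trap :: "real \<Rightarrow> ((nat \<Rightarrow> int) \<Rightarrow> real) \<Rightarrow> (nat \<Rightarrow> int) \<Rightarrow> real" where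
  "trap \<beta> E x = exp (- \<beta> * E x)"

definition btm_rate :: "nat \<Rightarrow> real \<Rightarrow> ((nat \<Rightarrow> int) \<Rightarrow> real) \<Rightarrow> (nat \<Rightarrow> int) \<Rightarrow> (nat \<Rightarrow> int) \<Rightarrow> real" where
  "btm_rate n \<beta> E x y = (if hc_adj n x y then (1 / real n) * (1 / trap \<beta> E x) else 0)"

definition Asl :: "real \<Rightarrow> real \<Rightarrow> real" where
  "Asl \<alpha> u = sin (\<alpha> * pi) / pi * integral {0..u} (\<lambda>s. s powr (\<alpha> - 1) * (1 - s) powr (- \<alpha>))"

end

theory Submission
  imports Defs "HOL-Real_Asymp.Real_Asymp"
begin

text \<open>
  In units of the time scale the chain leaves \<open>x\<close> at rate \<open>W\<^sub>x\<close>, the time scale divided by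
  \<open>\<tau>\<^sub>x\<close>, and then moves as the simple random walk \<open>A\<close> on the cube. Let \<open>\<Pi>\<^sub>n(t, t + s)\<close> be the
  probability of no jump during \<open>[t, t + s]\<close>. Its Laplace transform
  \<open>u = l \<integral> e\<^sup>-\<^sup>l\<^sup>t \<Pi>\<^sub>n(t, t + s) dt\<close>, as a function of the starting point, solves
  \<open>u = k f + (1 - k) A u\<close> with \<open>k = l / (l + W)\<close> and \<open>f = e\<^sup>-\<^sup>s\<^sup>W\<close>.

  The Green kernel \<open>H\<close> of the cube, which inverts \<open>1 - A\<close> off the constants, is uniformly within
  \<open>O(1/n)\<close> of the identity. The \<open>k\<^sub>x\<close> are independent, at most 1 and have exponentially small mean, so
  by a Chernoff bound \<open>\<Sum>\<^sub>y |H(x,y) - \<delta>\<^sub>x\<^sub>y| k\<^sub>y\<close> is almost surely small uniformly in \<open>x\<close>. With \<open>c\<close> the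
  ratio of the means of \<open>k f\<close> and \<open>k\<close> over the cube, \<open>c + H (k f - c k)\<close> almost solves the equation of
  \<open>u\<close>, and the maximum principle gives \<open>u = c + o(1)\<close>. By the law of large numbers and the tail
  \<open>P (W \<le> w) \<approx> e\<^sup>-\<^sup>b\<^sup>n w\<^sup>\<alpha>\<close>, \<open>b = \<alpha>\<^sup>2 \<beta>\<^sup>2 / 2 < log 2\<close>, the constant \<open>c\<close> converges to the Laplace transform of
  \<open>Asl (t / (t + s))\<close>, which is inverted with the Weierstrass theorem and the monotonicity of \<open>\<Pi>\<^sub>n\<close>
  in both endpoints.

  A supersolution built from \<open>H\<close> shows that no site is likely to be reached from another one on this
  time scale, so \<open>\<Pi>\<^sub>n\<close> and the probability of being at the same site at both times have the same limit.
\<close>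

subsection \<open>Exponentials of finite matrices\<close>

text \<open>No path of the chain is ever constructed: it enters through its transition matrix alone,
  so statements on staying, hitting and returning become differential inequalities or linear
  equations on the cube, and the only randomness left is the environment. The O(1/n) bound on the
  kernel makes uniformity over 2^n sites possible. It admits an exponential moment of parameter of
  order n^2 whose product with the largest weight is only b n / 2. Means of order e^(-bn) absorb
  that, while the gain of order n^2 in the exponent beats the union over all sites. The condition b
  < ln 2 says that the expected number of sites with W of order one, about 2^n e^(-bn), grows
  exponentially. The law of large numbers and the smallness of the hitting probabilities both rest
  on it. The arcsine law appears because k f is a mixture of the exponentials e^(-(x+s)W) with
  weight l e^(-lx); against a distribution function w^a with a = \<open>\<alpha>\<close> this gives
  a multiple of the integral of e^(-lx) (x+s)^(-a). Now Asl(t/(t+s)) is a multiple of the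
  convolution of r^(a-1) with (r+s)^(-a), so its transform contains the same integral.\<close>

definition mexp :: "'a set \<Rightarrow> ('a \<Rightarrow> 'a \<Rightarrow> real) \<Rightarrow> real \<Rightarrow> 'a \<Rightarrow> 'a \<Rightarrow> real" where
  "mexp S Q t x y = (\<Sum>k. t ^ k / fact k * mat_pow S Q k x y)"

lemma ctmc_trans_eq_mexp: "ctmc_trans S w t x y = mexp S (ctmc_gen S w) t x y"
  by (simp add: ctmc_trans_def mexp_def)

text \<open>The recursion of \<open>mat_pow\<close> multiplies on the right, which suits the forward
  equation; the backward equation needs the factor on the left.\<close>

lemma mat_pow_Suc_left:
  assumes "finite S" "x \<in> S" "y \<in> S"
  shows "mat_pow S Q (Suc k) x y = (\<Sum>z\<in>S. Q x z * mat_pow S Q k z y)"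
  using assms(3)
proof (induction k arbitrary: y)
  case 0
  have "mat_pow S Q (Suc 0) x y = (\<Sum>z\<in>S. if x = z then Q z y else 0)"
    by (auto intro!: sum.cong)
  also have "\<dots> = Q x y"
    using assms by simp
  also have "\<dots> = (\<Sum>z\<in>S. if z = y then Q x z else 0)"
    using assms 0 by simp
  also have "\<dots> = (\<Sum>z\<in>S. Q x z * mat_pow S Q 0 z y)"
    by (auto intro!: sum.cong)
  finally show ?case .
next
  case (Suc k)
  have "mat_pow S Q (Suc (Suc k)) x y = (\<Sum>v\<in>S. mat_pow S Q (Suc k) x v * Q v y)"
    by simp
  also have "\<dots> = (\<Sum>v\<in>S. (\<Sum>z\<in>S. Q x z * mat_pow S Q k z v) * Q v y)"
    using Suc.IH by (intro sum.cong) auto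
  also have "\<dots> = (\<Sum>v\<in>S. \<Sum>z\<in>S. Q x z * (mat_pow S Q k z v * Q v y))"
    by (simp add: sum_distrib_right mult.assoc)
  also have "\<dots> = (\<Sum>z\<in>S. Q x z * mat_pow S Q (Suc k) z y)"
    by (subst sum.swap) (simp add: sum_distrib_left)
  finally show ?case .
qed

lemma abs_mat_pow_le:
  assumes "finite S" "y \<in> S"
  shows "\<bar>mat_pow S Q k x y\<bar> \<le> (\<Sum>u\<in>S. \<Sum>v\<in>S. \<bar>Q u v\<bar>) ^ k"
  using assms(2)
proof (induction k arbitrary: y)
  case 0
  then show ?case by simp
next
  case (Suc k)
  define C where "C = (\<Sum>u\<in>S. \<Sum>v\<in>S. \<bar>Q u v\<bar>)"
  have C0: "C \<ge> 0"
    by (auto simp: C_def intro!: sum_nonneg)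
  have "\<bar>mat_pow S Q (Suc k) x y\<bar> \<le> (\<Sum>z\<in>S. \<bar>mat_pow S Q k x z\<bar> * \<bar>Q z y\<bar>)"
    by (simp add: abs_mult[symmetric] sum_abs)
  also have "\<dots> \<le> (\<Sum>z\<in>S. C ^ k * \<bar>Q z y\<bar>)"
    using Suc.IH by (intro sum_mono mult_right_mono) (auto simp: C_def)
  also have "\<dots> \<le> (\<Sum>z\<in>S. C ^ k * (\<Sum>v\<in>S. \<bar>Q z v\<bar>))"
    using Suc.prems assms(1) C0 by (intro sum_mono mult_left_mono member_le_sum) auto
  also have "\<dots> = C ^ Suc k"
    by (simp add: C_def sum_distrib_left[symmetric])
  finally show ?case by (simp add: C_def)
qed

lemma summable_mexp:
  assumes "finite S" "y \<in> S"
  shows "summable (\<lambda>k. t ^ k / fact k * mat_pow S Q k x y)"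
proof (rule summable_comparison_test')
  define C where "C = (\<Sum>u\<in>S. \<Sum>v\<in>S. \<bar>Q u v\<bar>)"
  show "summable (\<lambda>k. inverse (fact k) * (\<bar>t\<bar> * C) ^ k)"
    by (rule summable_exp)
  show "norm (t ^ k / fact k * mat_pow S Q k x y) \<le> inverse (fact k) * (\<bar>t\<bar> * C) ^ k" for k
    using mult_left_mono[OF abs_mat_pow_le[OF assms, of Q k x], of "\<bar>t\<bar> ^ k / fact k"]
    by (simp add: abs_mult power_abs power_mult_distrib C_def field_simps)
qed

lemma mexp_0 [simp]: "mexp S Q 0 x y = (if x = y then 1 else 0)"
proof -
  have "(\<lambda>k. 0 ^ k / fact k * mat_pow S Q k x y) sums (\<Sum>k\<in>{0}. 0 ^ k / fact k * mat_pow S Q k x y)"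
    by (rule sums_finite) auto
  then show ?thesis
    by (auto simp: mexp_def sums_iff)
qed

lemma mexp_has_derivative_aux:
  assumes "finite S" "y \<in> S"
  shows "((\<lambda>t. mexp S Q t x y) has_real_derivative
           (\<Sum>k. t ^ k / fact k * mat_pow S Q (Suc k) x y)) (at t)"
proof -
  define c where "c k = mat_pow S Q k x y / fact k" for k
  have eq: "mexp S Q t x y = (\<Sum>k. c k * t ^ k)" for t
    by (simp add: mexp_def c_def mult_ac)
  have "((\<lambda>t. \<Sum>k. c k * t ^ k) has_real_derivative (\<Sum>k. diffs c k * t ^ k)) (at t)"
    using summable_mexp[OF assms]
    by (intro termdiffs_strong_converges_everywhere) (simp add: c_def mult_ac)
  moreover have "diffs c k * t ^ k = t ^ k / fact k * mat_pow S Q (Suc k) x y" for k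
    by (simp add: diffs_def c_def field_simps del: mat_pow.simps of_nat_Suc)
  ultimately show ?thesis
    by (simp add: eq)
qed

lemma mexp_forward:
  assumes "finite S" "y \<in> S"
  shows "((\<lambda>t. mexp S Q t x y) has_real_derivative (\<Sum>z\<in>S. mexp S Q t x z * Q z y)) (at t)"
proof -
  have "(\<Sum>k. t ^ k / fact k * mat_pow S Q (Suc k) x y)
      = (\<Sum>k. \<Sum>z\<in>S. t ^ k / fact k * mat_pow S Q k x z * Q z y)"
    by (simp add: sum_distrib_left mult_ac)
  also have "\<dots> = (\<Sum>z\<in>S. \<Sum>k. t ^ k / fact k * mat_pow S Q k x z * Q z y)"
    using assms by (intro suminf_sum summable_mult2 summable_mexp)
  also have "\<dots> = (\<Sum>z\<in>S. mexp S Q t x z * Q z y)"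
    unfolding mexp_def using assms
    by (intro sum.cong refl suminf_mult2[symmetric] summable_mexp) auto
  finally show ?thesis
    using mexp_has_derivative_aux[OF assms, of Q x t] by simp
qed

lemma mexp_backward:
  assumes "finite S" "x \<in> S" "y \<in> S"
  shows "((\<lambda>t. mexp S Q t x y) has_real_derivative (\<Sum>z\<in>S. Q x z * mexp S Q t z y)) (at t)"
proof -
  have "(\<Sum>k. t ^ k / fact k * mat_pow S Q (Suc k) x y)
      = (\<Sum>k. \<Sum>z\<in>S. Q x z * (t ^ k / fact k * mat_pow S Q k z y))"
    by (simp add: mat_pow_Suc_left[OF assms] sum_distrib_left mult_ac del: mat_pow.simps)
  also have "\<dots> = (\<Sum>z\<in>S. \<Sum>k. Q x z * (t ^ k / fact k * mat_pow S Q k z y))"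
    using assms by (intro suminf_sum summable_mult summable_mexp)
  also have "\<dots> = (\<Sum>z\<in>S. Q x z * mexp S Q t z y)"
    unfolding mexp_def using assms
    by (intro sum.cong refl suminf_mult summable_mexp) auto
  finally show ?thesis
    using mexp_has_derivative_aux[OF assms(1,3), of Q x t] by simp
qed

lemma mat_pow_scale: "mat_pow S (\<lambda>x y. c * Q x y) k x y = c ^ k * mat_pow S Q k x y"
  by (induction k arbitrary: y) (auto simp: sum_distrib_left mult_ac intro!: sum.cong)

lemma mexp_scale: "mexp S (\<lambda>x y. c * Q x y) t x y = mexp S Q (c * t) x y"
  by (simp add: mexp_def mat_pow_scale power_mult_distrib mult_ac)

text \<open>Adding \<open>\<epsilon> e\<^sup>C\<^sup>t\<close> makes the differential inequality strict, so at the first time a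
  component vanishes its derivative would have to be positive.\<close>

lemma ode_comparison:
  fixes v v' :: "real \<Rightarrow> 'a \<Rightarrow> real" and Q :: "'a \<Rightarrow> 'a \<Rightarrow> real"
  assumes fin: "finite S"
    and off: "\<And>x y. x \<in> S \<Longrightarrow> y \<in> S \<Longrightarrow> x \<noteq> y \<Longrightarrow> Q x y \<ge> 0"
    and der: "\<And>t x. t \<ge> 0 \<Longrightarrow> x \<in> S \<Longrightarrow> ((\<lambda>t. v t x) has_real_derivative v' t x) (at t)"
    and super: "\<And>t x. t \<ge> 0 \<Longrightarrow> x \<in> S \<Longrightarrow> v' t x \<ge> (\<Sum>z\<in>S. Q x z * v t z)"
    and init: "\<And>x. x \<in> S \<Longrightarrow> v 0 x \<ge> 0"
    and "t \<ge> 0" "x \<in> S"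
  shows "v t x \<ge> 0"
proof -
  \<comment> \<open>\<open>C\<close> exceeds every row sum of \<open>Q\<close>, so the derivative of
    \<open>e * exp (C * t)\<close> strictly beats what \<open>Q\<close> makes of this
    correction.\<close>
  define C where "C = (\<Sum>u\<in>S. \<Sum>z\<in>S. \<bar>Q u z\<bar>) + 1"
  have rowC: "(\<Sum>z\<in>S. Q u z) < C" if "u \<in> S" for u
  proof -
    have "(\<Sum>z\<in>S. Q u z) \<le> (\<Sum>z\<in>S. \<bar>Q u z\<bar>)"
      by (intro sum_mono) auto
    also have "\<dots> \<le> (\<Sum>u\<in>S. \<Sum>z\<in>S. \<bar>Q u z\<bar>)"
      using that fin by (intro member_le_sum[where f = "\<lambda>u. \<Sum>z\<in>S. \<bar>Q u z\<bar>"]) (auto intro: sum_nonneg)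
    finally show ?thesis by (simp add: C_def)
  qed
  have pos: "v s x + e * exp (C * s) > 0" if e: "e > 0" and s: "s \<ge> 0" and x: "x \<in> S" for e s x
  proof (rule ccontr)
    define g where "g t x = v t x + e * exp (C * t)" for t x
    assume neg: "\<not> v s x + e * exp (C * s) > 0"
    define T where "T = (\<Union>x\<in>S. {0..s} \<inter> (\<lambda>t. g t x) -` {..0})"
    have dg: "((\<lambda>t. g t x) has_real_derivative v' t x + e * C * exp (C * t)) (at t)"
      if "t \<ge> 0" "x \<in> S" for t x
      unfolding g_def by (auto intro!: derivative_eq_intros der that)
    have contg: "continuous_on {0..s} (\<lambda>t. g t x)" if "x \<in> S" for x s
      using dg that by (intro DERIV_continuous_on[where D = "\<lambda>t. v' t x + e * C * exp (C * t)"])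
        (auto intro: DERIV_subset)
    have "closed T"
      unfolding T_def using fin contg by (intro closed_UN ballI continuous_closed_preimage) auto
    moreover have "s \<in> T"
      using neg x s by (auto simp: T_def g_def intro!: bexI[of _ x])
    moreover have bdd: "bdd_below T"
      by (auto simp: T_def intro!: bdd_belowI[of _ 0])
    ultimately have InfT: "Inf T \<in> T"
      using closed_contains_Inf[of T] by auto
    define t0 where "t0 = Inf T"
    obtain x1 where x1: "x1 \<in> S" "g t0 x1 \<le> 0" and t0: "0 \<le> t0" "t0 \<le> s"
      using InfT by (auto simp: T_def t0_def)
    have g0: "g 0 u > 0" if "u \<in> S" for u
      using init[OF that] e by (simp add: g_def)
    have "t0 \<noteq> 0"
      using g0[OF x1(1)] x1(2) by auto
    with t0 have t0pos: "t0 > 0" by simp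
    have before: "g r u > 0" if "0 \<le> r" "r < t0" "u \<in> S" for r u
    proof (rule ccontr)
      assume "\<not> g r u > 0"
      then have "r \<in> T" using that t0 by (auto simp: T_def intro!: bexI[of _ u])
      then have "t0 \<le> r" unfolding t0_def using bdd by (intro cInf_lower)
      with that show False by simp
    qed
    have at_t0: "g t0 u \<ge> 0" if u: "u \<in> S" for u
    proof (rule ccontr)
      assume neg: "\<not> g t0 u \<ge> 0"
      obtain r where "0 \<le> r" "r \<le> t0" "g r u = 0"
        using IVT2'[of "\<lambda>t. g t u" t0 0 0] neg g0[OF u] t0 contg[OF u, of t0] by auto
      then show False
        using before[of r u] u neg by (cases "r = t0") auto
    qed
    have g_x1: "g t0 x1 = 0"
      using x1 at_t0[of x1] by simp
    define D where "D = v' t0 x1 + e * C * exp (C * t0)"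
    have "0 \<le> (\<Sum>z\<in>S. Q x1 z * g t0 z)"
    proof (rule sum_nonneg)
      fix z assume "z \<in> S"
      then show "Q x1 z * g t0 z \<ge> 0"
        using off[of x1 z] at_t0[of z] x1 g_x1 by (cases "z = x1") auto
    qed
    also have "\<dots> = (\<Sum>z\<in>S. Q x1 z * v t0 z) + e * exp (C * t0) * (\<Sum>z\<in>S. Q x1 z)"
      by (simp add: g_def distrib_left sum.distrib sum_distrib_left sum_distrib_right mult_ac)
    also have "\<dots> < (\<Sum>z\<in>S. Q x1 z * v t0 z) + e * exp (C * t0) * C"
      using rowC[OF x1(1)] e by simp
    also have "\<dots> \<le> D"
      using super[OF t0(1) x1(1)] by (simp add: D_def mult_ac)
    finally have "D > 0" .
    then obtain d where d: "d > 0" "\<And>h. 0 < h \<Longrightarrow> h < d \<Longrightarrow> g (t0 - h) x1 < g t0 x1"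
      using DERIV_pos_inc_left[OF dg[OF t0(1) x1(1)]] unfolding D_def by auto
    have "g (t0 - min (d / 2) t0) x1 < 0"
      using d(2)[of "min (d / 2) t0"] d(1) t0pos g_x1 by auto
    moreover have "g (t0 - min (d / 2) t0) x1 > 0"
      using d(1) t0pos x1 by (intro before) auto
    ultimately show False by simp
  qed
  show ?thesis
  proof (rule ccontr)
    assume "\<not> v t x \<ge> 0"
    \<comment> \<open>With this value as the size of the correction, the corrected component is
      exactly 0 and strict positivity fails, so no limit of vanishing corrections has to be
      taken.\<close>
    then have "- v t x / exp (C * t) > 0" by (auto simp: field_simps)
    from pos[OF this assms(6,7)] show False by simp
  qed
qed

subsection \<open>Finite continuous-time Markov chains\<close>

locale finite_generator =
  fixes S :: "'a set" and Q :: "'a \<Rightarrow> 'a \<Rightarrow> real"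
  assumes fin: "finite S"
    and off_diag: "\<And>x y. x \<in> S \<Longrightarrow> y \<in> S \<Longrightarrow> x \<noteq> y \<Longrightarrow> Q x y \<ge> 0"
    and row_sum: "\<And>x. x \<in> S \<Longrightarrow> (\<Sum>y\<in>S. Q x y) = 0"
begin

lemma diag_eq: "x \<in> S \<Longrightarrow> Q x x = - (\<Sum>y\<in>S - {x}. Q x y)"
  using row_sum[of x] sum.remove[OF fin, of x "Q x"] by simp

lemma diag_nonpos: "x \<in> S \<Longrightarrow> Q x x \<le> 0"
  using diag_eq[of x] off_diag[of x] by (auto intro!: sum_nonneg)

lemma mexp_nonneg: "t \<ge> 0 \<Longrightarrow> x \<in> S \<Longrightarrow> y \<in> S \<Longrightarrow> mexp S Q t x y \<ge> 0"
  by (rule ode_comparison[of S Q "\<lambda>t x. mexp S Q t x y"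
        "\<lambda>t x. \<Sum>z\<in>S. Q x z * mexp S Q t z y"])
     (auto intro: mexp_backward fin off_diag)

lemma mexp_row_sum:
  assumes "x \<in> S"
  shows "(\<Sum>y\<in>S. mexp S Q t x y) = 1"
proof -
  have "((\<lambda>t. \<Sum>y\<in>S. mexp S Q t x y) has_real_derivative 0) (at t)" for t
  proof -
    have "((\<lambda>t. \<Sum>y\<in>S. mexp S Q t x y) has_real_derivative
             (\<Sum>y\<in>S. \<Sum>z\<in>S. mexp S Q t x z * Q z y)) (at t)"
      by (intro DERIV_sum mexp_forward fin)
    also have "(\<Sum>y\<in>S. \<Sum>z\<in>S. mexp S Q t x z * Q z y) = 0"
      by (subst sum.swap) (simp add: sum_distrib_left[symmetric] row_sum)
    finally show ?thesis .
  qed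
  then have "(\<Sum>y\<in>S. mexp S Q t x y) = (\<Sum>y\<in>S. mexp S Q 0 x y)"
    by (intro DERIV_isconst_all) auto
  also have "\<dots> = 1"
    using assms fin by simp
  finally show ?thesis .
qed

text \<open>In terms of paths, e^(-lt) U(X_t) is a supermartingale. Here the difference of the two
  sides, as a function of \<open>x\<close>, satisfies the comparison inequality, and at time 0 it is
  \<open>U x\<close> or 0.\<close>

lemma mexp_le_supersolution:
  assumes U: "\<And>x. x \<in> S \<Longrightarrow> U x \<ge> 0"
    and super: "\<And>x. x \<in> S \<Longrightarrow> (\<Sum>z\<in>S. Q x z * U z) \<le> l * U x"
    and "t \<ge> 0" "x \<in> S" "y \<in> S"
  shows "U y * mexp S Q t x y \<le> exp (l * t) * U x"
proof -
  have "exp (l * t) * U x - U y * mexp S Q t x y \<ge> 0"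
  proof (rule ode_comparison[of S Q "\<lambda>t x. exp (l * t) * U x - U y * mexp S Q t x y"
        "\<lambda>t x. l * exp (l * t) * U x - U y * (\<Sum>z\<in>S. Q x z * mexp S Q t z y)"])
    fix t :: real and x assume tx: "0 \<le> t" "x \<in> S"
    show "((\<lambda>t. exp (l * t) * U x - U y * mexp S Q t x y) has_real_derivative
           l * exp (l * t) * U x - U y * (\<Sum>z\<in>S. Q x z * mexp S Q t z y)) (at t)"
      using tx assms by (auto intro!: derivative_eq_intros mexp_backward fin)
    have "(\<Sum>z\<in>S. Q x z * (exp (l * t) * U z - U y * mexp S Q t z y))
       = exp (l * t) * (\<Sum>z\<in>S. Q x z * U z) - U y * (\<Sum>z\<in>S. Q x z * mexp S Q t z y)"
      by (simp add: algebra_simps sum_subtractf sum_distrib_left)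
    then show "(\<Sum>z\<in>S. Q x z * (exp (l * t) * U z - U y * mexp S Q t z y))
       \<le> l * exp (l * t) * U x - U y * (\<Sum>z\<in>S. Q x z * mexp S Q t z y)"
      using mult_left_mono[OF super[OF tx(2)], of "exp (l * t)"] by (simp add: mult_ac)
  qed (use assms fin off_diag in auto)
  then show ?thesis by simp
qed

text \<open>Not jumping at all is one way of being at \<open>y\<close>. After multiplication by the
  integrating factor, the derivative is the inflow from the other sites.\<close>

lemma mexp_diag_ge:
  assumes "t \<ge> 0" "y \<in> S"
  shows "exp (Q y y * t) \<le> mexp S Q t y y"
proof -
  define g where "g t = mexp S Q t y y * exp (- Q y y * t)" for t
  have "g 0 \<le> g t"
  proof (rule DERIV_nonneg_imp_nondecreasing[OF assms(1)])
    fix r assume r: "0 \<le> r" "r \<le> t"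
    have eq: "(\<Sum>z\<in>S. Q y z * mexp S Q r z y) - Q y y * mexp S Q r y y
        = (\<Sum>z\<in>S - {y}. Q y z * mexp S Q r z y)"
      by (simp add: sum.remove[OF fin assms(2)])
    have "(g has_real_derivative
        ((\<Sum>z\<in>S. Q y z * mexp S Q r z y) - Q y y * mexp S Q r y y) * exp (- Q y y * r)) (at r)"
      unfolding g_def using assms
      by (auto intro!: derivative_eq_intros mexp_backward fin simp: algebra_simps)
    moreover have "((\<Sum>z\<in>S. Q y z * mexp S Q r z y) - Q y y * mexp S Q r y y) * exp (- Q y y * r) \<ge> 0"
      unfolding eq using r assms by (intro mult_nonneg_nonneg sum_nonneg) (auto intro: off_diag mexp_nonneg)
    ultimately show "\<exists>D. (g has_real_derivative D) (at r) \<and> D \<ge> 0"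
      by blast
  qed
  then show ?thesis
    by (simp add: g_def exp_minus field_simps)
qed

text \<open>A return after a jump is a passage to \<open>y\<close> from another site, which costs at
  most \<open>M\<close>. Since the rows of \<open>Q\<close> sum to 0, the constant \<open>M\<close>
  can be subtracted before the integrating factor is applied.\<close>

lemma mexp_diag_le:
  assumes "t \<ge> 0" "y \<in> S" "M \<ge> 0"
    and M: "\<And>r z. 0 \<le> r \<Longrightarrow> r \<le> t \<Longrightarrow> z \<in> S \<Longrightarrow> z \<noteq> y \<Longrightarrow> mexp S Q r z y \<le> M"
  shows "mexp S Q t y y \<le> exp (Q y y * t) + M"
proof -
  define g where "g t = (mexp S Q t y y - M) * exp (- Q y y * t)" for t
  have "g 0 \<ge> g t"
  proof (rule DERIV_nonpos_imp_nonincreasing[OF assms(1)])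
    fix r assume r: "0 \<le> r" "r \<le> t"
    define D where "D = (\<Sum>z\<in>S. Q y z * mexp S Q r z y) - Q y y * (mexp S Q r y y - M)"
    have "D = (\<Sum>z\<in>S - {y}. Q y z * mexp S Q r z y) + Q y y * M"
      by (simp add: sum.remove[OF fin assms(2)] D_def algebra_simps)
    also have "\<dots> \<le> (\<Sum>z\<in>S - {y}. Q y z * M) + Q y y * M"
      using M r assms by (intro add_right_mono sum_mono mult_left_mono) (auto intro: off_diag)
    also have "\<dots> = 0"
      using diag_eq[OF assms(2)] by (simp add: sum_distrib_right[symmetric])
    finally have "D \<le> 0" .
    moreover have "(g has_real_derivative D * exp (- Q y y * r)) (at r)"
      unfolding g_def D_def using assms
      by (auto intro!: derivative_eq_intros mexp_backward fin simp: algebra_simps)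
    ultimately show "\<exists>D. (g has_real_derivative D) (at r) \<and> D \<le> 0"
      by (intro exI[of _ "D * exp (- Q y y * r)"]) (auto simp: mult_nonpos_nonneg)
  qed
  then have "mexp S Q t y y - M \<le> (1 - M) * exp (Q y y * t)"
    by (simp add: g_def exp_minus field_simps)
  also have "\<dots> \<le> 1 * exp (Q y y * t)"
    using assms by (intro mult_right_mono) auto
  finally show ?thesis by simp
qed

text \<open>The probability that the chain started at \<open>x\<close> makes no jump during \<open>[t, t + s]\<close>.\<close>

definition stay :: "'a \<Rightarrow> real \<Rightarrow> real \<Rightarrow> real" where
  "stay x t s = (\<Sum>y\<in>S. mexp S Q t x y * exp (Q y y * s))"

lemma stay_nonneg: "t \<ge> 0 \<Longrightarrow> x \<in> S \<Longrightarrow> stay x t s \<ge> 0"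
  by (auto simp: stay_def intro!: sum_nonneg mult_nonneg_nonneg mexp_nonneg)

lemma stay_antimono: "t \<ge> 0 \<Longrightarrow> x \<in> S \<Longrightarrow> s' \<le> s \<Longrightarrow> stay x t s \<le> stay x t s'"
  unfolding stay_def
  by (intro sum_mono mult_left_mono mexp_nonneg) (auto intro!: mult_left_mono_neg diag_nonpos)

lemma stay_le_1:
  assumes "t \<ge> 0" "s \<ge> 0" "x \<in> S"
  shows "stay x t s \<le> 1"
proof -
  have "stay x t s \<le> stay x t 0"
    using assms by (intro stay_antimono)
  also have "\<dots> = 1"
    using assms by (simp add: stay_def mexp_row_sum)
  finally show ?thesis .
qed

lemma continuous_on_stay: "continuous_on A (\<lambda>t. stay x t s)"
proof -
  have "continuous_on A (\<lambda>t. mexp S Q t x y)" if "y \<in> S" for y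
    using mexp_forward[OF fin that, of Q x]
    by (intro DERIV_continuous_on) (auto intro: DERIV_subset)
  then show ?thesis
    unfolding stay_def by (intro continuous_intros)
qed

text \<open>A window inside another one is more likely to be free of jumps. Moving the left end with
  the right end fixed changes the value by the inflow into each site; lowering the right end is
  \<open>stay_antimono\<close>.\<close>

lemma stay_mono:
  assumes "0 \<le> t" "t \<le> t'" "t' + s' \<le> t + s" "x \<in> S"
  shows "stay x t s \<le> stay x t' s'"
proof -
  define g where "g r = stay x r (t + s - r)" for r
  have "g t \<le> g t'"
  proof (rule DERIV_nonneg_imp_nondecreasing[OF assms(2)])
    fix r assume r: "t \<le> r" "r \<le> t'"
    define e where "e y = exp (Q y y * (t + s - r))" for y
    define D where "D y = (\<Sum>z\<in>S. mexp S Q r x z * Q z y) * e y - mexp S Q r x y * (Q y y * e y)" for y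
    have "(g has_real_derivative (\<Sum>y\<in>S. D y)) (at r)"
      unfolding g_def stay_def D_def e_def
      by (auto intro!: derivative_eq_intros mexp_forward fin simp: algebra_simps)
    moreover have "D y \<ge> 0" if y: "y \<in> S" for y
    proof -
      have "D y = e y * (\<Sum>z\<in>S - {y}. mexp S Q r x z * Q z y)"
        by (simp add: D_def sum.remove[OF fin y] algebra_simps)
      also have "\<dots> \<ge> 0"
        using y r assms unfolding e_def
        by (intro mult_nonneg_nonneg sum_nonneg mexp_nonneg off_diag) auto
      finally show ?thesis .
    qed
    ultimately show "\<exists>D. (g has_real_derivative D) (at r) \<and> D \<ge> 0"
      by (intro exI[of _ "\<Sum>y\<in>S. D y"] conjI sum_nonneg)
  qed
  also have "g t' \<le> stay x t' s'"
    unfolding g_def using assms by (intro stay_antimono) auto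
  finally show ?thesis by (simp add: g_def)
qed

text \<open>With the factor \<open>l\<close> this is the no-jump probability of a window of length
  \<open>s\<close> that begins at an independent exponential time of rate \<open>l\<close>.\<close>

definition laplace_stay :: "real \<Rightarrow> 'a \<Rightarrow> real \<Rightarrow> real" where
  "laplace_stay l x s = l * (LBINT t:{0<..}. exp (- l * t) * stay x t s)"

lemma integrable_exp_stay:
  assumes "l > 0" "s \<ge> 0" "x \<in> S"
  shows "set_integrable lborel {0<..} (\<lambda>t. exp (- l * t) * stay x t s)"
proof -
  have 1: "set_integrable lborel {0<..} (\<lambda>t. exp (- (t * l)))"
    using assms by (intro integrable_I0i_exp_mscale)
  have m: "(\<lambda>t. stay x t s) \<in> borel_measurable borel"
    by (intro borel_measurable_continuous_onI continuous_on_stay)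
  show ?thesis
    using 1 unfolding set_integrable_def
  proof (rule Bochner_Integration.integrable_bound)
    show "(\<lambda>t. indicat_real {0<..} t *\<^sub>R (exp (- l * t) * stay x t s)) \<in> borel_measurable lborel"
      using m by measurable
    show "AE t in lborel. norm (indicat_real {0<..} t *\<^sub>R (exp (- l * t) * stay x t s))
            \<le> norm (indicat_real {0<..} t *\<^sub>R exp (- (t * l)))"
      using stay_nonneg[OF _ assms(3), of _ s] stay_le_1[OF _ assms(2,3)]
      by (intro AE_I2) (auto simp: indicator_def abs_mult mult_ac mult_le_cancel_right1)
  qed
qed

lemma stay_backward:
  assumes "x \<in> S"
  shows "((\<lambda>t. stay x t s) has_real_derivative (\<Sum>z\<in>S. Q x z * stay z t s)) (at t)"
proof -
  have "((\<lambda>t. stay x t s) has_real_derivative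
      (\<Sum>y\<in>S. (\<Sum>z\<in>S. Q x z * mexp S Q t z y) * exp (Q y y * s))) (at t)"
    unfolding stay_def using assms by (auto intro!: derivative_eq_intros mexp_backward fin)
  also have "(\<Sum>y\<in>S. (\<Sum>z\<in>S. Q x z * mexp S Q t z y) * exp (Q y y * s))
     = (\<Sum>y\<in>S. \<Sum>z\<in>S. Q x z * (mexp S Q t z y * exp (Q y y * s)))"
    by (simp add: sum_distrib_right mult.assoc)
  also have "\<dots> = (\<Sum>z\<in>S. Q x z * stay z t s)"
    by (subst sum.swap) (simp add: stay_def sum_distrib_left)
  finally show ?thesis .
qed

text \<open>Integration by parts: by the backward equation \<open>f\<close> is the derivative of
  \<open>F\<close>, whose boundary values are 0 at infinity and
  \<open>stay x 0 s = exp (Q x x * s)\<close> at 0.\<close>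

lemma laplace_stay_resolvent:
  assumes l: "l > 0" and s: "s \<ge> 0" and x: "x \<in> S"
  shows "l * laplace_stay l x s - (\<Sum>z\<in>S. Q x z * laplace_stay l z s) = l * exp (Q x x * s)"
proof -
  define F where "F t = exp (- l * t) * stay x t s" for t
  define f where "f t = (\<Sum>z\<in>S. Q x z * (exp (- l * t) * stay z t s)) - l * (exp (- l * t) * stay x t s)" for t
  have int: "set_integrable lborel {0<..} (\<lambda>t. exp (- l * t) * stay z t s)" if "z \<in> S" for z
    using integrable_exp_stay[OF l s that] .
  have int1: "set_integrable lborel {0<..} (\<lambda>t. \<Sum>z\<in>S. Q x z * (exp (- l * t) * stay z t s))"
    using int unfolding set_integrable_def scaleR_sum_right
    by (intro Bochner_Integration.integrable_sum) (simp add: mult.left_commute[of _ "Q x _"])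
  have int2: "set_integrable lborel {0<..} (\<lambda>t. l * (exp (- l * t) * stay x t s))"
    using int[OF x] by (intro set_integrable_mult_right) auto
  have "(LBINT t:{0<..}. \<Sum>z\<in>S. Q x z * (exp (- l * t) * stay z t s))
      = (\<Sum>z\<in>S. LBINT t:{0<..}. Q x z * (exp (- l * t) * stay z t s))"
    using int unfolding set_integrable_def set_lebesgue_integral_def scaleR_sum_right
    by (intro Bochner_Integration.integral_sum) (simp add: mult.left_commute[of _ "Q x _"])
  then have "(LBINT t:{0<..}. f t) = (\<Sum>z\<in>S. Q x z * (LBINT t:{0<..}. exp (- l * t) * stay z t s))
      - l * (LBINT t:{0<..}. exp (- l * t) * stay x t s)"
    unfolding f_def by (subst set_integral_diff[OF int1 int2]) simp
  moreover have "(LBINT t=0..\<infinity>. f t) = 0 - stay x 0 s"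
  proof (rule interval_integral_FTC_integrable[where F = F])
    show "(F has_vector_derivative f t) (at t)" for t
      unfolding F_def f_def has_real_derivative_iff_has_vector_derivative[symmetric]
      by (auto intro!: derivative_eq_intros stay_backward x simp: sum_distrib_left sum_distrib_right algebra_simps)
    have "continuous_on UNIV f"
      unfolding f_def by (intro continuous_intros continuous_on_stay)
    then show "isCont f t" for t
      by (simp add: continuous_on_eq_continuous_at)
    show "set_integrable lborel (einterval 0 \<infinity>) f"
      unfolding f_def zero_ereal_def einterval_eq by (intro set_integral_diff int1 int2)
    have "continuous_on UNIV F"
      unfolding F_def by (intro continuous_intros continuous_on_stay)
    then have "isCont F 0"
      by (simp add: continuous_on_eq_continuous_at)
    then have "(F \<longlongrightarrow> F 0) (at_right 0)"
      unfolding isCont_def by (rule filterlim_mono[OF _ order_refl at_le]) auto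
    then show "((F \<circ> real_of_ereal) \<longlongrightarrow> stay x 0 s) (at_right 0)"
      by (simp add: ereal_tendsto_simps1 zero_ereal_def F_def)
    have "(F \<longlongrightarrow> 0) at_top"
    proof (rule tendsto_sandwich[OF _ _ tendsto_const])
      show "\<forall>\<^sub>F t in at_top. 0 \<le> F t"
        using eventually_ge_at_top[of 0] by eventually_elim (auto simp: F_def stay_nonneg x)
      show "\<forall>\<^sub>F t in at_top. F t \<le> exp (- l * t)"
        using eventually_ge_at_top[of 0]
        by eventually_elim (auto simp: F_def x s intro!: mult_right_le_one_le stay_nonneg stay_le_1)
      show "((\<lambda>t. exp (- l * t)) \<longlongrightarrow> 0) at_top"
        using l by (intro filterlim_compose[OF exp_at_bot] filterlim_tendsto_neg_mult_at_bot[OF tendsto_const] filterlim_ident) auto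
    qed
    then show "((F \<circ> real_of_ereal) \<longlongrightarrow> 0) (at_left \<infinity>)"
      by (simp add: ereal_tendsto_simps1)
  qed simp
  then have "(LBINT t:{0<..}. f t) = - stay x 0 s"
    by (simp add: interval_lebesgue_integral_0_infty)
  moreover have "stay x 0 s = exp (Q x x * s)"
  proof -
    have "stay x 0 s = (\<Sum>y\<in>S. if x = y then exp (Q y y * s) else 0)"
      by (auto simp: stay_def intro!: sum.cong)
    then show ?thesis using x fin by simp
  qed
  ultimately show ?thesis
    by (simp add: laplace_stay_def mult.left_commute[of "Q x _" l] sum_distrib_left[symmetric]
        right_diff_distrib[symmetric])
qed

end

subsection \<open>The Green kernel of the hypercube\<close>

definition flip :: "nat \<Rightarrow> (nat \<Rightarrow> int) \<Rightarrow> nat \<Rightarrow> int" where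
  "flip i x = x(i := - x i)"

definition cube_avg :: "nat \<Rightarrow> ((nat \<Rightarrow> int) \<Rightarrow> real) \<Rightarrow> (nat \<Rightarrow> int) \<Rightarrow> real" where
  "cube_avg n f x = (\<Sum>i<n. f (flip i x)) / real n"

definition walsh :: "nat set \<Rightarrow> (nat \<Rightarrow> int) \<Rightarrow> real" where
  "walsh A x = (\<Prod>i\<in>A. real_of_int (x i))"

text \<open>The Walsh function of \<open>A\<close> is an eigenfunction of \<open>1 - cube_avg\<close> with eigenvalue
  \<open>2 |A| / n\<close>; inverting these eigenvalues off the constants gives the kernel.\<close>

definition cube_green :: "nat \<Rightarrow> (nat \<Rightarrow> int) \<Rightarrow> (nat \<Rightarrow> int) \<Rightarrow> real" where
  "cube_green n x y =
     real n / 2 / 2 ^ n * (\<Sum>A\<in>Pow {..<n} - {{}}. walsh A x * walsh A y / real (card A))"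

section \<open>Walsh functions and the Poisson equation of the Green kernel\<close>

lemma finite_hcube [simp]: "finite (hcube n)"
  by (auto simp: hcube_def intro!: finite_PiE)

lemma card_hcube: "card (hcube n) = 2 ^ n"
  by (simp add: hcube_def card_PiE numeral_2_eq_2)

lemma hcube_one_in: "hcube_one n \<in> hcube n"
  by (auto simp: hcube_def hcube_one_def)

lemma hcube_nth: "x \<in> hcube n \<Longrightarrow> i < n \<Longrightarrow> x i = 1 \<or> x i = - 1"
  by (auto simp: hcube_def PiE_def Pi_def)

lemma hcube_eqI: "x \<in> hcube n \<Longrightarrow> y \<in> hcube n \<Longrightarrow> (\<And>i. i < n \<Longrightarrow> x i = y i) \<Longrightarrow> x = y"
  unfolding hcube_def by (rule PiE_ext) auto

lemma flip_in_hcube: "x \<in> hcube n \<Longrightarrow> i < n \<Longrightarrow> flip i x \<in> hcube n"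
  by (fastforce simp: hcube_def flip_def PiE_def Pi_def extensional_def)

lemma flip_flip [simp]: "flip i (flip i x) = x"
  by (auto simp: flip_def)

lemma walsh_flip: "finite A \<Longrightarrow> walsh A (flip i x) = (if i \<in> A then - walsh A x else walsh A x)"
proof (induction A rule: finite_induct)
  case (insert j A)
  then show ?case by (auto simp: walsh_def flip_def)
qed (auto simp: walsh_def)

text \<open>The sum over subsets expands the product of the factors \<open>x i * y i + 1\<close>,
  each 2 where the configurations agree and 0 where they differ.\<close>

lemma sum_walsh: 
  assumes "x \<in> hcube n" "y \<in> hcube n"
  shows "(\<Sum>A\<in>Pow {..<n}. walsh A x * walsh A y) = (if x = y then 2 ^ n else 0)"
proof -
  have "(\<Sum>A\<in>Pow {..<n}. walsh A x * walsh A y) = (\<Prod>i<n. real_of_int (x i * y i) + 1)"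
    by (subst prod_add) (auto simp: walsh_def prod.distrib)
  also have "\<dots> = (if x = y then 2 ^ n else 0)"
  proof (cases "x = y")
    case True
    have "(\<Prod>i<n. real_of_int (x i * y i) + 1) = (\<Prod>i<n. 2)"
      using hcube_nth[OF assms(1)] True by (intro prod.cong) force+
    then show ?thesis using True by simp
  next
    case False
    then obtain i where "i < n" "x i \<noteq> y i"
      using hcube_eqI[OF assms] by blast
    then have "real_of_int (x i * y i) + 1 = 0"
      using hcube_nth[OF assms(1), of i] hcube_nth[OF assms(2), of i] by auto
    with \<open>i < n\<close> False show ?thesis
      by (auto intro!: prod_zero)
  qed
  finally show ?thesis .
qed

text \<open>The eigenvalue 2|A|/n cancels the weight n/(2|A|) of the kernel. What is left is the
  completeness relation \<open>sum_walsh\<close> without the term of the empty set, whence the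
  correction \<open>1 / 2 ^ n\<close>.\<close>

lemma cube_green_poisson:
  assumes "x \<in> hcube n" "y \<in> hcube n" "n > 0"
  shows "cube_green n x y - cube_avg n (\<lambda>x. cube_green n x y) x = (if x = y then 1 else 0) - 1 / 2 ^ n"
proof -
  \<comment> \<open>Flipping a coordinate outside \<open>A\<close> changes nothing, flipping one
    inside changes the sign; each of the \<open>card A\<close> latter ones contributes twice the
    Walsh function.\<close>
  have ev: "walsh A x - (\<Sum>i<n. walsh A (flip i x)) / real n = 2 * real (card A) / real n * walsh A x"
    if "A \<subseteq> {..<n}" for A
  proof -
    have fA: "finite A" using that finite_subset by blast
    have "(\<Sum>i<n. walsh A (flip i x)) = (\<Sum>i<n. walsh A x - (if i \<in> A then 2 * walsh A x else 0))"
      using fA by (intro sum.cong) (auto simp: walsh_flip)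
    also have "\<dots> = real n * walsh A x - 2 * walsh A x * real (card ({..<n} \<inter> A))"
      by (simp add: sum_subtractf sum.If_cases)
    also have "{..<n} \<inter> A = A" using that by auto
    finally show ?thesis using assms(3) by (simp add: field_simps)
  qed
  define N where "N = Pow {..<n} - {{}::nat set}"
  define c where "c = real n / 2 / 2 ^ n"
  define T where "T A = (\<Sum>i<n. walsh A (flip i x))" for A
  have "(\<Sum>i<n. \<Sum>A\<in>N. walsh A (flip i x) * walsh A y / real (card A))
      = (\<Sum>A\<in>N. T A * walsh A y / real (card A))"
    by (subst sum.swap) (simp add: T_def sum_distrib_right sum_divide_distrib)
  then have "cube_avg n (\<lambda>x. cube_green n x y) x = c * (\<Sum>A\<in>N. T A * walsh A y / real (card A)) / real n"
    unfolding cube_avg_def cube_green_def N_def[symmetric] c_def[symmetric]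
    by (simp add: sum_distrib_left[symmetric])
  moreover have "(\<Sum>A\<in>N. (walsh A x - T A / real n) * walsh A y / real (card A))
      = (\<Sum>A\<in>N. walsh A x * walsh A y / real (card A)) - (\<Sum>A\<in>N. T A * walsh A y / real (card A)) / real n"
    by (simp add: left_diff_distrib diff_divide_distrib sum_subtractf sum_divide_distrib mult.commute[of "real n"])
  ultimately have "cube_green n x y - cube_avg n (\<lambda>x. cube_green n x y) x
    = c * (\<Sum>A\<in>N. (walsh A x - T A / real n) * walsh A y / real (card A))"
    unfolding cube_green_def N_def[symmetric] c_def[symmetric]
    by (simp add: right_diff_distrib)
  then have "cube_green n x y - cube_avg n (\<lambda>x. cube_green n x y) x
    = c * (\<Sum>A\<in>N. (walsh A x - (\<Sum>i<n. walsh A (flip i x)) / real n) * walsh A y / real (card A))"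
    by (simp add: T_def)
  also have "(\<Sum>A\<in>N. (walsh A x - (\<Sum>i<n. walsh A (flip i x)) / real n) * walsh A y / real (card A))
     = (\<Sum>A\<in>N. 2 / real n * (walsh A x * walsh A y))"
  proof (rule sum.cong)
    fix A assume "A \<in> N"
    then have "A \<subseteq> {..<n}" "card A > 0"
      by (auto simp: N_def card_gt_0_iff finite_subset)
    then show "(walsh A x - (\<Sum>i<n. walsh A (flip i x)) / real n) * walsh A y / real (card A)
         = 2 / real n * (walsh A x * walsh A y)"
      by (simp add: ev)
  qed simp
  also have "\<dots> = 2 / real n * (\<Sum>A\<in>N. walsh A x * walsh A y)"
    by (simp add: sum_distrib_left)
  also have "(\<Sum>A\<in>N. walsh A x * walsh A y) = (if x = y then 2 ^ n else 0) - 1"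
    using sum_walsh[OF assms(1,2)] unfolding N_def by (subst sum_diff) (auto simp: walsh_def)
  finally have "cube_green n x y - cube_avg n (\<lambda>x. cube_green n x y) x
    = (c * (2 / real n)) * ((if x = y then 2 ^ n else 0) - 1)"
    by (simp only: mult.assoc)
  moreover have "c * (2 / real n) = 1 / 2 ^ n"
    using assms(3) by (simp add: c_def)
  ultimately show ?thesis
    by (auto simp: field_simps)
qed

text \<open>A flip in a coordinate of \<open>A\<close> permutes the cube and reverses the sign of
  the Walsh function, so nonempty sets contribute 0.\<close>

lemma sum_cube_green:
  assumes "n > 0"
  shows "(\<Sum>x\<in>hcube n. cube_green n y x) = 0"
proof -
  have z: "(\<Sum>x\<in>hcube n. walsh A x) = 0" if A: "A \<subseteq> {..<n}" "A \<noteq> {}" for A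
  proof -
    obtain i where i: "i \<in> A" "i < n" using A by auto
    have fA: "finite A" using A(1) finite_subset by blast
    have "(\<Sum>x\<in>hcube n. walsh A x) = (\<Sum>x\<in>hcube n. walsh A (flip i x))"
      by (rule sum.reindex_bij_witness[of _ "flip i" "flip i"]) (auto intro: flip_in_hcube i)
    also have "\<dots> = - (\<Sum>x\<in>hcube n. walsh A x)"
      using i fA by (simp add: walsh_flip sum_negf)
    finally show ?thesis by simp
  qed
  have "(\<Sum>x\<in>hcube n. \<Sum>A\<in>Pow {..<n} - {{}}. walsh A y * walsh A x / real (card A))
     = (\<Sum>A\<in>Pow {..<n} - {{}}. walsh A y * (\<Sum>x\<in>hcube n. walsh A x) / real (card A))"
    by (subst sum.swap) (simp add: sum_distrib_left sum_divide_distrib)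
  then show ?thesis
    unfolding cube_green_def sum_distrib_left[symmetric] by (simp add: z)
qed

section \<open>Pointwise bounds on the Green kernel from an integral representation\<close>

definition walsh_sum :: "nat \<Rightarrow> (nat \<Rightarrow> real) \<Rightarrow> real" where
  "walsh_sum n z = (\<Sum>A\<in>Pow {..<n} - {{}}. (\<Prod>i\<in>A. z i) / real (card A))"

text \<open>Writing 1/|A| as the integral of r^(|A|-1) over [0,1] removes the denominators of
  \<open>walsh_sum\<close>. The integrand is ((1 + r z_1)...(1 + r z_n) - 1)/r, given here as a
  polynomial so that it also makes sense at r = 0.\<close>

definition walsh_poly :: "nat \<Rightarrow> (nat \<Rightarrow> real) \<Rightarrow> real \<Rightarrow> real" where
  "walsh_poly n z r = (\<Sum>A\<in>Pow {..<n} - {{}}. (\<Prod>i\<in>A. z i) * r ^ (card A - 1))"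

lemma cube_green_eq:
  "cube_green n x y = real n / 2 / 2 ^ n * walsh_sum n (\<lambda>i. real_of_int (x i * y i))"
  by (simp add: cube_green_def walsh_sum_def walsh_def prod.distrib)

lemma has_integral_power_unit: "((\<lambda>r. r ^ m) has_integral 1 / real (Suc m)) {0..1::real}"
proof -
  have "((\<lambda>r. r ^ m) has_integral (1 ^ Suc m / real (Suc m) - 0 ^ Suc m / real (Suc m))) {0..1::real}"
    by (rule fundamental_theorem_of_calculus)
       (auto intro!: derivative_eq_intros simp: has_real_derivative_iff_has_vector_derivative[symmetric] simp del: power_Suc of_nat_Suc)
  then show ?thesis by simp
qed

lemma has_integral_one_plus_power:
  "((\<lambda>r. (1 + r) ^ m) has_integral (2 ^ Suc m - 1) / real (Suc m)) {0..1::real}"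
proof -
  have "((\<lambda>r. (1 + r) ^ m) has_integral ((1 + 1) ^ Suc m / real (Suc m) - (1 + 0) ^ Suc m / real (Suc m))) {0..1::real}"
    by (rule fundamental_theorem_of_calculus)
       (auto intro!: derivative_eq_intros simp: has_real_derivative_iff_has_vector_derivative[symmetric] simp del: power_Suc of_nat_Suc)
  then show ?thesis by (simp add: diff_divide_distrib)
qed

lemma has_integral_walsh_poly: "(walsh_poly n z has_integral walsh_sum n z) {0..1}"
proof -
  have "((\<lambda>r. \<Sum>A\<in>Pow {..<n} - {{}}. (\<Prod>i\<in>A. z i) * r ^ (card A - 1)) has_integral
     (\<Sum>A\<in>Pow {..<n} - {{}}. (\<Prod>i\<in>A. z i) * (1 / real (card A)))) {0..1}"
  proof (intro has_integral_sum has_integral_mult_right)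
    fix A assume "A \<in> Pow {..<n} - {{}}"
    then have "card A > 0" by (auto simp: card_gt_0_iff finite_subset)
    then show "((\<lambda>r. r ^ (card A - 1)) has_integral 1 / real (card A)) {0..1::real}"
      using has_integral_power_unit[of "card A - 1"] by simp
  qed simp
  then show ?thesis
    by (simp add: walsh_poly_def[abs_def] walsh_sum_def)
qed

lemma walsh_poly_eq: "r * walsh_poly n z r = (\<Prod>i<n. 1 + r * z i) - 1"
proof -
  have "(\<Prod>i<n. 1 + r * z i) = (\<Prod>i<n. r * z i + 1)"
    by (simp add: add.commute)
  also have "\<dots> = (\<Sum>A\<in>Pow {..<n}. (\<Prod>i\<in>A. z i) * r ^ card A)"
    by (subst prod_add) (auto simp: prod.distrib mult_ac)
  also have "\<dots> = 1 + (\<Sum>A\<in>Pow {..<n} - {{}}. (\<Prod>i\<in>A. z i) * r ^ card A)"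
    by (subst sum.remove[of _ "{}"]) auto
  also have "(\<Sum>A\<in>Pow {..<n} - {{}}. (\<Prod>i\<in>A. z i) * r ^ card A) = r * walsh_poly n z r"
    unfolding walsh_poly_def sum_distrib_left
  proof (rule sum.cong)
    fix A assume "A \<in> Pow {..<n} - {{}}"
    then have "card A > 0" by (auto simp: card_gt_0_iff finite_subset)
    then show "(\<Prod>i\<in>A. z i) * r ^ card A = r * ((\<Prod>i\<in>A. z i) * r ^ (card A - 1))"
      by (cases "card A") auto
  qed simp
  finally show ?thesis by simp
qed

text \<open>Bounds on \<open>walsh_poly\<close> come from \<open>walsh_poly_eq\<close> after
  division by \<open>r\<close>, hence only for positive \<open>r\<close>; redefining one integrand
  at 0 closes the gap.\<close>

lemma has_integral_le_off_zero:
  fixes f g :: "real \<Rightarrow> real"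
  assumes "(f has_integral i) {0..1}" "(g has_integral j) {0..1}"
    and "\<And>r. 0 < r \<Longrightarrow> r \<le> 1 \<Longrightarrow> f r \<le> g r"
  shows "i \<le> j"
proof (rule has_integral_le)
  show "((\<lambda>r. if r = 0 then g 0 else f r) has_integral i) {0..1}"
    by (rule has_integral_spike_finite[OF _ _ assms(1), of "{0}"]) auto
qed (use assms in auto)

text \<open>The product is smallest when every \<open>z i\<close> is -1, and then Bernoulli's
  inequality bounds it below by 1 - n r.\<close>

lemma walsh_sum_ge:
  assumes z: "\<And>i. i < n \<Longrightarrow> z i = 1 \<or> z i = - 1"
  shows "walsh_sum n z \<ge> - real n"
proof (rule has_integral_le_off_zero[OF _ has_integral_walsh_poly])
  show "((\<lambda>r. - real n) has_integral - real n) {0..1::real}"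
    using has_integral_const_real[of "- real n" 0 1] by simp
  fix r :: real assume r: "0 < r" "r \<le> 1"
  have "1 + real n * (- r) \<le> (1 + (- r)) ^ n"
    using r by (intro Bernoulli_inequality) auto
  also have "\<dots> = (\<Prod>i<n. 1 - r)" by simp
  also have "\<dots> \<le> (\<Prod>i<n. 1 + r * z i)"
    using r z by (intro prod_mono) force
  also have "\<dots> = r * walsh_poly n z r + 1"
    by (simp add: walsh_poly_eq)
  finally have "r * (- real n) \<le> r * walsh_poly n z r" by (simp add: mult_ac)
  then show "- real n \<le> walsh_poly n z r"
    by (rule mult_left_le_imp_le) (use r in auto)
qed

text \<open>One factor 1 - r in place of 1 + r costs at least 2 r (1 + r)^(n-1). Divided by r and
  integrated, this is the extra term on the left; in the scale of the kernel it amounts to 1 -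
  2^(-n), the gap between diagonal and off-diagonal entries.\<close>

lemma walsh_sum_le:
  assumes z: "\<And>i. i < n \<Longrightarrow> z i = 1 \<or> z i = - 1" and j: "j < n" "z j = - 1"
  shows "walsh_sum n z + 2 * (2 ^ n - 1) / real n \<le> walsh_sum n (\<lambda>_. 1)"
proof (rule has_integral_le_off_zero[OF _ has_integral_walsh_poly])
  obtain m where m: "n = Suc m" using j by (cases n) auto
  show "((\<lambda>r. walsh_poly n z r + 2 * (1 + r) ^ (n - 1)) has_integral
      (walsh_sum n z + 2 * (2 ^ n - 1) / real n)) {0..1}"
    using has_integral_add[OF has_integral_walsh_poly
        has_integral_mult_right[OF has_integral_one_plus_power[of m], of 2], of n z]
    by (simp add: m)
  fix r :: real assume r: "0 < r" "r \<le> 1"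
  have "(\<Prod>i<n. 1 + r * z i) = (1 - r) * (\<Prod>i\<in>{..<n} - {j}. 1 + r * z i)"
    using j by (subst prod.remove[of _ j]) auto
  also have "\<dots> \<le> (1 - r) * (\<Prod>i\<in>{..<n} - {j}. 1 + r)"
    using r z by (intro mult_left_mono prod_mono) force+
  also have "\<dots> = (1 - r) * (1 + r) ^ m"
    using j m by simp
  finally have "r * walsh_poly n z r + 2 * r * (1 + r) ^ m \<le> (1 + r) ^ n - 1"
    by (simp add: walsh_poly_eq m algebra_simps)
  also have "\<dots> = r * walsh_poly n (\<lambda>_. 1) r"
    by (simp add: walsh_poly_eq)
  finally have "r * (walsh_poly n z r + 2 * (1 + r) ^ m) \<le> r * walsh_poly n (\<lambda>_. 1) r"
    by (simp add: algebra_simps)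
  then show "walsh_poly n z r + 2 * (1 + r) ^ (n - 1) \<le> walsh_poly n (\<lambda>_. 1) r"
    using r m by (simp add: mult_le_cancel_left_pos)
qed

text \<open>The integrand ((1+r)^n - 1)/r is a geometric sum in 1 + r, integrated term by
  term.\<close>

lemma walsh_sum_ones: "walsh_sum n (\<lambda>_. 1) \<le> (\<Sum>m<n. 2 ^ Suc m / real (Suc m))"
proof -
  have "walsh_sum n (\<lambda>_. 1) \<le> (\<Sum>m<n. (2 ^ Suc m - 1) / real (Suc m))"
  proof (rule has_integral_le_off_zero[OF has_integral_walsh_poly])
    show "((\<lambda>r. \<Sum>m<n. (1 + r) ^ m) has_integral (\<Sum>m<n. (2 ^ Suc m - 1) / real (Suc m))) {0..1}"
      by (intro has_integral_sum has_integral_one_plus_power) auto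
    show "walsh_poly n (\<lambda>_. 1) r \<le> (\<Sum>m<n. (1 + r) ^ m)" if "0 < r" for r :: real
      using walsh_poly_eq[of r n "\<lambda>_. 1"] power_diff_1_eq[of "1 + r" n] that by simp
  qed
  also have "\<dots> \<le> (\<Sum>m<n. 2 ^ Suc m / real (Suc m))"
    by (intro sum_mono divide_right_mono) auto
  finally show ?thesis .
qed

text \<open>The last terms dominate, so the sum is 2^(n+1)/n up to a relative error of order 1/n.
  With the constant 6 the induction step leaves a surplus proportional to (n - 3)(5n + 2), hence the
  start at 3.\<close>

lemma sum_two_power_div_le:
  assumes "n \<ge> 1"
  shows "(\<Sum>m<n. 2 ^ Suc m / real (Suc m)) \<le> 2 ^ Suc n / real n * (1 + 6 / real n)"
proof (cases "n \<ge> 3")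
  case True
  then show ?thesis
  proof (induction n rule: dec_induct)
    case base
    show ?case by (simp add: eval_nat_numeral)
  next
    case (step n)
    have n: "real n \<ge> 3" using step by simp
    have "2 / (N + 1) * (1 + 6 / (N + 1)) - (1 / N * (1 + 6 / N) + 1 / (N + 1))
        = (N - 3) * (5 * N + 2) / (N ^ 2 * (N + 1) ^ 2)" if "N \<ge> 3" for N :: real
      using that by (simp add: divide_simps) (simp add: power2_eq_square algebra_simps)
    moreover have "(real n - 3) * (5 * real n + 2) / (real n ^ 2 * (real n + 1) ^ 2) \<ge> 0"
      using n by auto
    ultimately have *: "1 / real n * (1 + 6 / real n) + 1 / real (Suc n) \<le> 2 / real (Suc n) * (1 + 6 / real (Suc n))"
      using n by (smt (verit) of_nat_Suc)
    have "(\<Sum>m<Suc n. 2 ^ Suc m / real (Suc m)) \<le> 2 ^ Suc n / real n * (1 + 6 / real n) + 2 ^ Suc n / real (Suc n)"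
      using step.IH by simp
    also have "\<dots> = 2 ^ Suc n * (1 / real n * (1 + 6 / real n) + 1 / real (Suc n))"
      by (simp add: field_simps)
    also have "\<dots> \<le> 2 ^ Suc n * (2 / real (Suc n) * (1 + 6 / real (Suc n)))"
      using * by (intro mult_left_mono) auto
    also have "\<dots> = 2 ^ Suc (Suc n) / real (Suc n) * (1 + 6 / real (Suc n))"
      by simp
    finally show ?case .
  qed
next
  case False
  with assms have "n = 1 \<or> n = 2" by auto
  then show ?thesis by (auto simp: eval_nat_numeral)
qed

text \<open>Serves to replace n^2/2^n by 8/n. From n = 4 on, the cube at most doubles from n to n +
  1.\<close>

lemma cube_le_two_power: "real n ^ 3 \<le> 8 * 2 ^ n"
proof (cases "n \<ge> 4")
  case True
  then show ?thesis
  proof (induction n rule: dec_induct)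
    case (step n)
    have n: "real n \<ge> 4" using step by simp
    have "4 * real n \<le> real n * real n"
      using n by (intro mult_right_mono) auto
    then have "3 * real n ^ 2 + 3 * real n + 1 \<le> 4 * real n ^ 2"
      unfolding power2_eq_square using n by linarith
    also have "\<dots> \<le> real n * real n ^ 2"
      using n by (intro mult_right_mono) auto
    finally have "real (Suc n) ^ 3 \<le> 2 * real n ^ 3"
      by (simp add: power2_eq_square power3_eq_cube algebra_simps)
    with step.IH show ?case by simp
  qed simp
next
  case False
  then have "n = 0 \<or> n = 1 \<or> n = 2 \<or> n = 3" by auto
  then show ?thesis by auto
qed

lemma inverse_two_power_le: "n \<ge> 1 \<Longrightarrow> 1 / 2 ^ n \<le> 1 / real n"
  using less_exp[of n] of_nat_less_iff[of n "2 ^ n", where 'a = real] by (intro divide_left_mono) auto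

lemma cube_green_ge:
  assumes "x \<in> hcube n" "y \<in> hcube n"
  shows "cube_green n x y \<ge> - (real n ^ 2 / 2 ^ n)"
proof -
  have "walsh_sum n (\<lambda>i. real_of_int (x i * y i)) \<ge> - real n"
    using hcube_nth[OF assms(1)] hcube_nth[OF assms(2)] by (intro walsh_sum_ge) force
  then have "real n / 2 / 2 ^ n * walsh_sum n (\<lambda>i. real_of_int (x i * y i)) \<ge> real n / 2 / 2 ^ n * - real n"
    by (intro mult_left_mono) auto
  moreover have "real n / 2 / 2 ^ n * - real n \<ge> - (real n ^ 2 / 2 ^ n)"
    by (simp add: field_simps power2_eq_square)
  ultimately show ?thesis
    unfolding cube_green_eq by linarith
qed

lemma cube_green_diag:
  assumes "x \<in> hcube n"
  shows "cube_green n x x = real n / 2 / 2 ^ n * walsh_sum n (\<lambda>_. 1)"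
proof -
  have "real_of_int (x i * x i) = 1" if "i < n" for i
    using hcube_nth[OF assms that] by auto
  then have "walsh_sum n (\<lambda>i. real_of_int (x i * x i)) = walsh_sum n (\<lambda>_. 1)"
    unfolding walsh_sum_def
    by (intro sum.cong arg_cong2[of _ _ _ _ "(/)"] prod.cong refl) auto
  then show ?thesis by (simp add: cube_green_eq)
qed

lemma cube_green_diag_le:
  assumes "x \<in> hcube n" "n \<ge> 1"
  shows "cube_green n x x \<le> 1 + 6 / real n"
proof -
  have "cube_green n x x \<le> real n / 2 / 2 ^ n * (2 ^ Suc n / real n * (1 + 6 / real n))"
    unfolding cube_green_diag[OF assms(1)]
    using order_trans[OF walsh_sum_ones sum_two_power_div_le[OF assms(2)]]
    by (intro mult_left_mono) auto
  also have "\<dots> = 1 + 6 / real n"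
    using assms(2) by (simp add: field_simps)
  finally show ?thesis .
qed

text \<open>By \<open>walsh_sum_le\<close> an off-diagonal entry is at most the diagonal one minus 1
  - 2^(-n), and the diagonal exceeds 1 by at most 6/n.\<close>

lemma cube_green_off_diag_le:
  assumes "x \<in> hcube n" "y \<in> hcube n" "x \<noteq> y" "n \<ge> 1"
  shows "cube_green n x y \<le> 7 / real n"
proof -
  obtain j where j: "j < n" "x j \<noteq> y j"
    using hcube_eqI[OF assms(1,2)] assms(3) by blast
  have "walsh_sum n (\<lambda>i. real_of_int (x i * y i)) + 2 * (2 ^ n - 1) / real n \<le> walsh_sum n (\<lambda>_. 1)"
    using hcube_nth[OF assms(1)] hcube_nth[OF assms(2)] j by (intro walsh_sum_le[of _ _ j]) force+
  then have "real n / 2 / 2 ^ n * (walsh_sum n (\<lambda>i. real_of_int (x i * y i)) + 2 * (2 ^ n - 1) / real n)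
     \<le> cube_green n x x"
    unfolding cube_green_diag[OF assms(1)] by (intro mult_left_mono) auto
  also have "real n / 2 / 2 ^ n * (walsh_sum n (\<lambda>i. real_of_int (x i * y i)) + 2 * (2 ^ n - 1) / real n)
     = cube_green n x y + 1 - 1 / 2 ^ n"
    using assms(4) unfolding cube_green_eq by (simp add: field_simps)
  also note cube_green_diag_le[OF assms(1,4)]
  finally have "cube_green n x y \<le> 6 / real n + 1 / 2 ^ n" by simp
  with inverse_two_power_le[OF assms(4)] show ?thesis by (simp add: add_divide_distrib[symmetric])
qed

text \<open>The Poisson equation expresses the diagonal entry by the average over the neighbours,
  where the general lower bound \<open>cube_green_ge\<close> applies.\<close>

lemma cube_green_diag_ge:
  assumes "x \<in> hcube n" "n \<ge> 1"
  shows "cube_green n x x \<ge> 1 - 1 / 2 ^ n - real n ^ 2 / 2 ^ n"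
proof -
  have "cube_avg n (\<lambda>u. cube_green n u x) x \<ge> - (real n ^ 2 / 2 ^ n)"
  proof -
    have "(\<Sum>i<n. cube_green n (flip i x) x) \<ge> (\<Sum>i<n. - (real n ^ 2 / 2 ^ n))"
      using assms by (intro sum_mono cube_green_ge flip_in_hcube) auto
    then show ?thesis
      using assms(2) by (simp add: cube_avg_def field_simps)
  qed
  then show ?thesis
    using cube_green_poisson[OF assms(1,1)] assms(2) by simp
qed

lemma cube_green_near_identity:
  assumes "x \<in> hcube n" "y \<in> hcube n" "n \<ge> 1"
  shows "\<bar>cube_green n x y - (if x = y then 1 else 0)\<bar> \<le> 10 / real n"
proof -
  have 2: "real n ^ 2 / 2 ^ n \<le> 8 / real n"
    using cube_le_two_power[of n] assms(3) by (simp add: field_simps power2_eq_square power3_eq_cube)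
  have 3: "9 / real n = 1 / real n + 8 / real n" "6 / real n \<le> 10 / real n" "7 / real n \<le> 10 / real n"
    "9 / real n \<le> 10 / real n"
    by (auto intro!: divide_right_mono simp: add_divide_distrib[symmetric])
  show ?thesis
    using cube_green_ge[OF assms(1,2)] cube_green_off_diag_le[OF assms(1,2) _ assms(3)]
      cube_green_diag_ge[OF assms(1,3)] cube_green_diag_le[OF assms(1,3)]
      inverse_two_power_le[OF assms(3)] 2 3
    by (cases "x = y") (auto simp: abs_le_iff)
qed

text \<open>Since the kernel is at least -a with a = n^2/2^n, its absolute value is at most the
  kernel plus 2a. The kernel sums to 0 over a row, so 2a contributes 2 n^2 in total and the identity
  contributes 1.\<close>

lemma sum_abs_cube_green:
  assumes "y \<in> hcube n" "n \<ge> 1"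
  shows "(\<Sum>x\<in>hcube n. \<bar>cube_green n y x - (if y = x then 1 else 0)\<bar>) \<le> 2 * real n ^ 2 + 1"
proof -
  have "(\<Sum>x\<in>hcube n. \<bar>cube_green n y x - (if y = x then 1 else 0)\<bar>)
    \<le> (\<Sum>x\<in>hcube n. (cube_green n y x + 2 * (real n ^ 2 / 2 ^ n)) + (if y = x then 1 else 0))"
    using cube_green_ge[OF assms(1)] by (intro sum_mono) (fastforce simp: abs_le_iff)
  also have "\<dots> = 2 * real n ^ 2 + 1"
    using assms by (simp add: sum.distrib sum_cube_green card_hcube)
  finally show ?thesis .
qed

subsection \<open>Walks on the hypercube with sparse killing\<close>

definition cube_mean :: "nat \<Rightarrow> ((nat \<Rightarrow> int) \<Rightarrow> real) \<Rightarrow> real" where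
  "cube_mean n f = (\<Sum>x\<in>hcube n. f x) / 2 ^ n"

definition green_op :: "nat \<Rightarrow> ((nat \<Rightarrow> int) \<Rightarrow> real) \<Rightarrow> (nat \<Rightarrow> int) \<Rightarrow> real" where
  "green_op n f x = (\<Sum>y\<in>hcube n. cube_green n x y * f y)"

text \<open>The part of the kernel beyond the identity, in absolute value, applied to
  \<open>f\<close>; its maximum over the cube is the error of every estimate below.\<close>

definition green_excess :: "nat \<Rightarrow> ((nat \<Rightarrow> int) \<Rightarrow> real) \<Rightarrow> (nat \<Rightarrow> int) \<Rightarrow> real" where
  "green_excess n f x = (\<Sum>y\<in>hcube n. \<bar>cube_green n x y - (if x = y then 1 else 0)\<bar> * f y)"

lemma cube_avg_const [simp]: "n > 0 \<Longrightarrow> cube_avg n (\<lambda>_. c) x = c"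
  by (simp add: cube_avg_def)

lemma cube_avg_add: "cube_avg n (\<lambda>x. f x + g x) x = cube_avg n f x + cube_avg n g x"
  by (simp add: cube_avg_def sum.distrib add_divide_distrib)

lemma cube_avg_diff: "cube_avg n (\<lambda>x. f x - g x) x = cube_avg n f x - cube_avg n g x"
  by (simp add: cube_avg_def sum_subtractf diff_divide_distrib)

lemma cube_avg_cmult: "cube_avg n (\<lambda>x. c * f x) x = c * cube_avg n f x"
  by (simp add: cube_avg_def sum_distrib_left)

lemma cube_avg_mono:
  "x \<in> hcube n \<Longrightarrow> (\<And>y. y \<in> hcube n \<Longrightarrow> f y \<le> g y) \<Longrightarrow> cube_avg n f x \<le> cube_avg n g x"
  by (auto simp: cube_avg_def intro!: divide_right_mono sum_mono flip_in_hcube)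

text \<open>At a maximiser the neighbour average is at most the maximum m, so m <= (1 - k) m + k e,
  and k > 0 cancels.\<close>

lemma cube_max_principle:
  assumes n: "n > 0" and k: "\<And>x. x \<in> hcube n \<Longrightarrow> 0 < k x \<and> k x \<le> 1"
    and sub: "\<And>x. x \<in> hcube n \<Longrightarrow> z x \<le> (1 - k x) * cube_avg n z x + k x * e"
    and x: "x \<in> hcube n"
  shows "z x \<le> e"
proof -
  define m where "m = Max (z ` hcube n)"
  have le: "z y \<le> m" if "y \<in> hcube n" for y
    using that by (simp add: m_def)
  have "m \<in> z ` hcube n"
    unfolding m_def using x by (intro Max_in) auto
  then obtain y where y: "y \<in> hcube n" "z y = m" by auto
  have "cube_avg n z y \<le> m"
    using cube_avg_mono[OF y(1), of z "\<lambda>_. m"] le n by simp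
  then have "m \<le> (1 - k y) * m + k y * e"
    using sub[OF y(1)] y(2) k[OF y(1)] mult_left_mono[of "cube_avg n z y" m "1 - k y"] by simp
  then have "k y * m \<le> k y * e" by (simp add: algebra_simps)
  then have "m \<le> e" using k[OF y(1)] by simp
  with le[OF x] show ?thesis by simp
qed

lemma green_op_poisson:
  assumes "n > 0" "x \<in> hcube n"
  shows "green_op n f x - cube_avg n (green_op n f) x = f x - cube_mean n f"
proof -
  have "cube_avg n (green_op n f) x = (\<Sum>y\<in>hcube n. cube_avg n (\<lambda>x. cube_green n x y) x * f y)"
    unfolding cube_avg_def green_op_def
    by (subst sum.swap) (simp add: sum_distrib_right sum_divide_distrib)
  then have "green_op n f x - cube_avg n (green_op n f) x
     = (\<Sum>y\<in>hcube n. (cube_green n x y - cube_avg n (\<lambda>x. cube_green n x y) x) * f y)"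
    by (simp add: green_op_def left_diff_distrib sum_subtractf)
  also have "\<dots> = (\<Sum>y\<in>hcube n. (if x = y then f y else 0) - f y / 2 ^ n)"
    using assms by (intro sum.cong refl) (auto simp: cube_green_poisson algebra_simps)
  also have "\<dots> = f x - cube_mean n f"
    using assms by (simp add: sum_subtractf cube_mean_def sum_divide_distrib)
  finally show ?thesis .
qed

lemma abs_green_op_diff:
  assumes "x \<in> hcube n" "\<And>y. y \<in> hcube n \<Longrightarrow> \<bar>f y\<bar> \<le> k y"
  shows "\<bar>green_op n f x - f x\<bar> \<le> green_excess n k x"
proof -
  have "green_op n f x - f x = (\<Sum>y\<in>hcube n. cube_green n x y * f y - (if x = y then f y else 0))"
    using assms by (simp add: green_op_def sum_subtractf)
  also have "\<dots> = (\<Sum>y\<in>hcube n. (cube_green n x y - (if x = y then 1 else 0)) * f y)"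
    by (intro sum.cong) (auto simp: algebra_simps)
  also have "\<bar>\<dots>\<bar> \<le> (\<Sum>y\<in>hcube n. \<bar>(cube_green n x y - (if x = y then 1 else 0)) * f y\<bar>)"
    by (rule sum_abs)
  also have "\<dots> \<le> green_excess n k x"
    unfolding green_excess_def abs_mult using assms by (intro sum_mono mult_left_mono) auto
  finally show ?thesis .
qed

text \<open>The function \<open>c + green_op q\<close> with \<open>q = k f - c k\<close> almost solves the equation of \<open>u\<close>.\<close>

lemma homogenization:
  assumes n: "n > 0" and k: "\<And>x. x \<in> hcube n \<Longrightarrow> 0 < k x \<and> k x \<le> 1"
    and f: "\<And>x. x \<in> hcube n \<Longrightarrow> 0 \<le> f x \<and> f x \<le> 1"
    and u: "\<And>x. x \<in> hcube n \<Longrightarrow> u x = k x * f x + (1 - k x) * cube_avg n u x"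
    and ex: "\<And>x. x \<in> hcube n \<Longrightarrow> green_excess n k x \<le> e"
    and x: "x \<in> hcube n"
  shows "\<bar>u x - cube_mean n (\<lambda>x. k x * f x) / cube_mean n k\<bar> \<le> 2 * e + k x"
proof -
  define c where "c = cube_mean n (\<lambda>x. k x * f x) / cube_mean n k"
  have mk: "cube_mean n k > 0"
    unfolding cube_mean_def using k x by (intro divide_pos_pos sum_pos) auto
  have "cube_mean n (\<lambda>x. k x * f x) \<le> cube_mean n k"
    unfolding cube_mean_def using k f
    by (intro divide_right_mono sum_mono) (auto intro!: mult_right_le_one_le simp: less_imp_le)
  moreover have "cube_mean n (\<lambda>x. k x * f x) \<ge> 0"
    unfolding cube_mean_def using k f by (intro divide_nonneg_nonneg sum_nonneg) (auto simp: less_imp_le)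
  ultimately have c: "0 \<le> c" "c \<le> 1"
    using mk by (auto simp: c_def)
  define q where "q x = k x * f x - c * k x" for x
  have q: "\<bar>q y\<bar> \<le> k y" if "y \<in> hcube n" for y
  proof -
    have "\<bar>f y - c\<bar> \<le> 1" using f[OF that] c by auto
    then have "k y * \<bar>f y - c\<bar> \<le> k y * 1"
      using k[OF that] by (intro mult_left_mono) auto
    moreover have "\<bar>q y\<bar> = k y * \<bar>f y - c\<bar>"
      using k[OF that] by (simp add: q_def abs_mult[symmetric] algebra_simps abs_if)
    ultimately show ?thesis by simp
  qed
  have "cube_mean n q = cube_mean n (\<lambda>x. k x * f x) - c * cube_mean n k"
    by (simp add: q_def cube_mean_def sum_subtractf sum_distrib_left diff_divide_distrib)
  \<comment> \<open>This equation determines \<open>c\<close>: with mean zero,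
    \<open>green_op_poisson\<close> has no constant term and \<open>w\<close> solves
    \<open>w - cube_avg n w = q\<close> exactly.\<close>
  then have mq: "cube_mean n q = 0"
    using mk by (simp add: c_def)
  define w where "w = green_op n q"
  have w: "w y - cube_avg n w y = q y" if "y \<in> hcube n" for y
    using green_op_poisson[OF n that, of q] mq by (simp add: w_def)
  \<comment> \<open>The neighbour average of \<open>w\<close> is \<open>w - q\<close>, precisely
    what the excess bounds. It is also the source term, weighted with \<open>k\<close>, in the
    equation of the error \<open>z\<close>.\<close>
  have Aw: "\<bar>cube_avg n w y\<bar> \<le> e" if "y \<in> hcube n" for y
    using abs_green_op_diff[OF that, of q k] q ex[OF that] w[OF that] by (auto simp: w_def abs_minus_commute)
  define z where "z x = c + w x - u x" for x
  have zeq: "z y = (1 - k y) * cube_avg n z y + k y * cube_avg n w y" if "y \<in> hcube n" for y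
  proof -
    have avg: "cube_avg n z y = c + cube_avg n w y - cube_avg n u y"
      using n by (simp add: z_def[abs_def] cube_avg_diff cube_avg_add)
    have "w y = cube_avg n w y + (k y * f y - c * k y)"
      using w[OF that] by (simp add: q_def)
    then have "z y = c + (cube_avg n w y + (k y * f y - c * k y)) - (k y * f y + (1 - k y) * cube_avg n u y)"
      using u[OF that] by (simp add: z_def)
    then show ?thesis
      unfolding avg by (simp add: algebra_simps)
  qed
  have "z x \<le> e"
  proof (rule cube_max_principle[OF n k _ x])
    fix y assume y: "y \<in> hcube n"
    have "k y * cube_avg n w y \<le> k y * e"
      using k[OF y] Aw[OF y] by (intro mult_left_mono) auto
    then show "z y \<le> (1 - k y) * cube_avg n z y + k y * e"
      using zeq[OF y] by simp
  qed
  moreover have "- z x \<le> e"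
  proof (rule cube_max_principle[OF n k _ x])
    fix y assume y: "y \<in> hcube n"
    have "k y * - cube_avg n w y \<le> k y * e"
      using k[OF y] Aw[OF y] by (intro mult_left_mono) auto
    then show "- z y \<le> (1 - k y) * cube_avg n (\<lambda>y. - z y) y + k y * e"
      using zeq[OF y] cube_avg_cmult[of n "-1" z y] by simp
  qed
  \<comment> \<open>The distance of \<open>u\<close> from \<open>c\<close> is at most |z| + |w|, and
    |w| is at most the average of \<open>w\<close>, bounded by \<open>e\<close>, plus |q|, bounded
    by \<open>k\<close>.\<close>
  ultimately show ?thesis
    using w[OF x] Aw[OF x] q[OF x] unfolding z_def c_def[symmetric] by linarith
qed

text \<open>The kernel column of \<open>y\<close>, shifted to be nonnegative, peaks at
  \<open>y\<close> and is small elsewhere, but fails to be a supersolution by 1/2^n because of the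
  constant in its Poisson equation. The function \<open>S\<close> has a surplus of at least the mean
  of \<open>k\<close> everywhere; adding it with weight 1/(2^n m) repairs the defect.\<close>

lemma hitting_supersolution:
  assumes n: "n > 0" and k: "\<And>x. x \<in> hcube n \<Longrightarrow> 0 < k x \<and> k x \<le> 1"
    and ex: "\<And>x. x \<in> hcube n \<Longrightarrow> green_excess n k x \<le> 1"
    and y: "y \<in> hcube n"
  obtains U where "\<And>x. x \<in> hcube n \<Longrightarrow> U x \<ge> 0"
    "\<And>x. x \<in> hcube n \<Longrightarrow> (1 - k x) * cube_avg n U x \<le> U x"
    "U y \<ge> 1 / 2"
    "\<And>x. x \<in> hcube n \<Longrightarrow> x \<noteq> y \<Longrightarrow> U x \<le> 7 / real n + real n ^ 2 / 2 ^ n + 5 / (2 ^ n * cube_mean n k)"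
proof -
  define m where "m = cube_mean n k"
  have m0: "m > 0"
    unfolding m_def cube_mean_def using k y by (intro divide_pos_pos sum_pos) auto
  have "(\<Sum>x\<in>hcube n. k x) \<le> (\<Sum>x\<in>hcube n. 1)"
    using k by (intro sum_mono) auto
  then have m1: "m \<le> 1"
    by (simp add: m_def cube_mean_def card_hcube)
  define G where "G = green_op n k"
  have G: "\<bar>G x - k x\<bar> \<le> 1" if "x \<in> hcube n" for x
    using abs_green_op_diff[OF that, of k k] ex[OF that] k by (force simp: G_def)
  have AG: "G x - cube_avg n G x = k x - m" if "x \<in> hcube n" for x
    using green_op_poisson[OF n that, of k] by (simp add: G_def m_def)
  \<comment> \<open>\<open>G\<close> lies between -1 and 2, which keeps \<open>S\<close>
    nonnegative. The 3 leaves \<open>k * (2 - cube_avg n G)\<close> in the computation of the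
    surplus, nonnegative because the average is \<open>G - k + m\<close>, at most 2.\<close>
  define S where "S x = 3 - G x" for x
  have S: "0 \<le> S x" "S x \<le> 5" if "x \<in> hcube n" for x
    using G[OF that] k[OF that] by (auto simp: S_def)
  have S_super: "S x - (1 - k x) * cube_avg n S x \<ge> m" if "x \<in> hcube n" for x
  proof -
    have avg: "cube_avg n S x = 3 - cube_avg n G x"
      using n by (simp add: S_def[abs_def] cube_avg_diff)
    have "k x * cube_avg n G x \<le> k x * 2"
      using k[OF that] G[OF that] AG[OF that] m0 m1 by (intro mult_left_mono) auto
    moreover have "S x - (1 - k x) * (3 - cube_avg n G x) = m + (k x * 2 - k x * cube_avg n G x)"
      using AG[OF that] by (simp add: S_def algebra_simps)
    ultimately show ?thesis
      unfolding avg by linarith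
  qed
  define a where "a = real n ^ 2 / 2 ^ n"
  define h where "h x = cube_green n x y + a" for x
  have h0: "h x \<ge> 0" if "x \<in> hcube n" for x
    using cube_green_ge[OF that y] by (simp add: h_def a_def)
  define U where "U x = h x + 1 / (2 ^ n * m) * S x" for x
  have U_super: "U x - (1 - k x) * cube_avg n U x \<ge> 0" if x: "x \<in> hcube n" for x
  proof -
    have "cube_avg n U x = cube_avg n h x + 1 / (2 ^ n * m) * cube_avg n S x"
      by (simp add: U_def[abs_def] cube_avg_add cube_avg_cmult del: times_divide_eq_left)
    then have "U x - (1 - k x) * cube_avg n U x
      = (h x - cube_avg n h x) + k x * cube_avg n h x + 1 / (2 ^ n * m) * (S x - (1 - k x) * cube_avg n S x)"
      by (simp add: U_def algebra_simps diff_divide_distrib add_divide_distrib)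
    moreover have "h x - cube_avg n h x \<ge> - 1 / 2 ^ n"
      using cube_green_poisson[OF x y n] n by (auto simp: h_def[abs_def] cube_avg_add)
    moreover have "cube_avg n h x \<ge> 0"
      using h0 flip_in_hcube[OF x] by (auto simp: cube_avg_def intro!: divide_nonneg_nonneg sum_nonneg)
    then have "k x * cube_avg n h x \<ge> 0"
      using k[OF x] by simp
    moreover have "1 / (2 ^ n * m) * (S x - (1 - k x) * cube_avg n S x) \<ge> 1 / (2 ^ n * m) * m"
      using S_super[OF x] m0 by (intro mult_left_mono) auto
    then have "1 / (2 ^ n * m) * (S x - (1 - k x) * cube_avg n S x) \<ge> 1 / 2 ^ n"
      using m0 by simp
    ultimately show ?thesis by simp
  qed
  show thesis
  proof
    show "U x \<ge> 0" if "x \<in> hcube n" for x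
      using h0[OF that] S(1)[OF that] m0 by (simp add: U_def)
    show "(1 - k x) * cube_avg n U x \<le> U x" if "x \<in> hcube n" for x
      using U_super[OF that] by simp
    have "(2::real) ^ 1 \<le> 2 ^ n"
      using n by (intro power_increasing) auto
    then have "1 / 2 ^ n \<le> (1 / 2 :: real)"
      by (simp add: field_simps)
    moreover have "1 / (2 ^ n * m) * S y \<ge> 0"
      using S(1)[OF y] m0 by simp
    moreover have "1 - 1 / 2 ^ n - real n ^ 2 / 2 ^ n \<le> cube_green n y y"
      using cube_green_diag_ge[OF y] n by simp
    ultimately show "U y \<ge> 1 / 2"
      unfolding U_def h_def a_def by linarith
    show "U x \<le> 7 / real n + real n ^ 2 / 2 ^ n + 5 / (2 ^ n * cube_mean n k)"
      if x: "x \<in> hcube n" "x \<noteq> y" for x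
    proof -
      have "1 / (2 ^ n * m) * S x \<le> 1 / (2 ^ n * m) * 5"
        using S(2)[OF x(1)] m0 by (intro mult_left_mono) auto
      then show ?thesis
        using cube_green_off_diag_le[OF x(1) y x(2)] n unfolding U_def h_def a_def m_def by (simp add: add_mono)
    qed
  qed
qed

subsection \<open>The rescaled trap model\<close>

definition trap_gen :: "nat \<Rightarrow> ((nat \<Rightarrow> int) \<Rightarrow> real) \<Rightarrow> (nat \<Rightarrow> int) \<Rightarrow> (nat \<Rightarrow> int) \<Rightarrow> real" where
  "trap_gen n W x y = (if x = y then - W x else if hc_adj n x y then W x / real n else 0)"

lemma hc_adj_iff_flip: "x \<in> hcube n \<Longrightarrow> {y. hc_adj n x y} = (\<lambda>i. flip i x) ` {..<n}"
proof (intro set_eqI iffI)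
  fix y assume x: "x \<in> hcube n" and "y \<in> {y. hc_adj n x y}"
  then have y: "y \<in> hcube n" and "card {i \<in> {0..<n}. x i \<noteq> y i} = 1"
    by (auto simp: hc_adj_def)
  then obtain i where i: "{i \<in> {0..<n}. x i \<noteq> y i} = {i}"
    by (auto simp: card_1_singleton_iff)
  then have "i < n" "x i \<noteq> y i" by auto
  have "y = flip i x"
  proof (rule hcube_eqI[OF y flip_in_hcube[OF x \<open>i < n\<close>]])
    fix j assume "j < n"
    show "y j = flip i x j"
    proof (cases "j = i")
      case True
      then show ?thesis
        using hcube_nth[OF x \<open>i < n\<close>] hcube_nth[OF y \<open>i < n\<close>] \<open>x i \<noteq> y i\<close> by (auto simp: flip_def)
    next
      case False
      then have "j \<notin> {i \<in> {0..<n}. x i \<noteq> y i}" using i by auto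
      then show ?thesis using False \<open>j < n\<close> by (auto simp: flip_def)
    qed
  qed
  then show "y \<in> (\<lambda>i. flip i x) ` {..<n}" using \<open>i < n\<close> by auto
next
  fix y assume x: "x \<in> hcube n" and "y \<in> (\<lambda>i. flip i x) ` {..<n}"
  then obtain i where i: "i < n" "y = flip i x" by auto
  have "{j \<in> {0..<n}. x j \<noteq> y j} = {i}"
    using i hcube_nth[OF x i(1)] by (auto simp: flip_def split: if_splits)
  then show "y \<in> {y. hc_adj n x y}"
    using x i by (simp add: hc_adj_def flip_in_hcube)
qed

lemma inj_on_flip: "x \<in> hcube n \<Longrightarrow> inj_on (\<lambda>i. flip i x) {..<n}"
proof (rule inj_onI)
  fix i j assume x: "x \<in> hcube n" and ij: "i \<in> {..<n}" "j \<in> {..<n}" "flip i x = flip j x"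
  have "flip i x i = flip j x i" using ij by simp
  then show "i = j"
    using hcube_nth[OF x, of i] ij by (auto simp: flip_def split: if_splits)
qed

lemma sum_hc_adj:
  assumes "x \<in> hcube n" "n > 0"
  shows "(\<Sum>y\<in>hcube n - {x}. if hc_adj n x y then f y else 0) = real n * cube_avg n f x"
proof -
  have "{y. hc_adj n x y} \<subseteq> hcube n - {x}"
    by (auto simp: hc_adj_def)
  then have "(\<Sum>y\<in>hcube n - {x}. if hc_adj n x y then f y else 0) = (\<Sum>y\<in>{y. hc_adj n x y}. f y)"
    by (intro sum.mono_neutral_cong_right) auto
  also have "\<dots> = (\<Sum>i<n. f (flip i x))"
    unfolding hc_adj_iff_flip[OF assms(1)] using inj_on_flip[OF assms(1)]
    by (subst sum.reindex) auto
  finally show ?thesis using assms(2) by (simp add: cube_avg_def)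
qed

lemma trap_gen_apply:
  assumes "x \<in> hcube n" "n > 0"
  shows "(\<Sum>y\<in>hcube n. trap_gen n W x y * f y) = W x * (cube_avg n f x - f x)"
proof -
  have "(\<Sum>y\<in>hcube n - {x}. trap_gen n W x y * f y)
      = (\<Sum>y\<in>hcube n - {x}. W x / real n * (if hc_adj n x y then f y else 0))"
    by (intro sum.cong refl) (auto simp: trap_gen_def)
  then have "(\<Sum>y\<in>hcube n. trap_gen n W x y * f y)
      = - W x * f x + (\<Sum>y\<in>hcube n - {x}. W x / real n * (if hc_adj n x y then f y else 0))"
    by (subst sum.remove[OF finite_hcube assms(1)]) (simp add: trap_gen_def)
  also have "\<dots> = W x * (cube_avg n f x - f x)"
    using assms by (simp add: sum_distrib_left[symmetric] sum_hc_adj algebra_simps del: times_divide_eq_left)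
  finally show ?thesis .
qed

lemma mat_pow_cong:
  assumes "\<And>x y. x \<in> S \<Longrightarrow> y \<in> S \<Longrightarrow> Q x y = Q' x y" "y \<in> S"
  shows "mat_pow S Q k x y = mat_pow S Q' k x y"
  using assms(2) by (induction k arbitrary: y) (auto simp: assms(1) intro!: sum.cong)

text \<open>Measuring time in units of \<open>c\<close> multiplies all rates by \<open>c\<close>;
  the n neighbours and the factor 1/n combine to the exit rate \<open>c / trap\<close>.\<close>

lemma ctmc_trans_btm:
  assumes "n > 0" "y \<in> hcube n"
  shows "ctmc_trans (hcube n) (btm_rate n \<beta> V) (c * t) x y
       = mexp (hcube n) (trap_gen n (\<lambda>x. c / trap \<beta> V x)) t x y"
proof -
  have "c * ctmc_gen (hcube n) (btm_rate n \<beta> V) u v = trap_gen n (\<lambda>x. c / trap \<beta> V x) u v"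
    if "u \<in> hcube n" for u v
  proof (cases "u = v")
    case True
    have "(\<Sum>z\<in>hcube n - {u}. btm_rate n \<beta> V u z)
        = 1 / real n * (1 / trap \<beta> V u) * (\<Sum>z\<in>hcube n - {u}. if hc_adj n u z then 1 else 0)"
      unfolding sum_distrib_left by (intro sum.cong) (auto simp: btm_rate_def)
    also have "\<dots> = 1 / trap \<beta> V u"
      using sum_hc_adj[OF that assms(1), of "\<lambda>_. 1"] assms(1) by simp
    finally show ?thesis
      using True by (simp add: ctmc_gen_def trap_gen_def)
  qed (auto simp: ctmc_gen_def trap_gen_def btm_rate_def)
  then have "mexp (hcube n) (\<lambda>x y. c * ctmc_gen (hcube n) (btm_rate n \<beta> V) x y) t x y
      = mexp (hcube n) (trap_gen n (\<lambda>x. c / trap \<beta> V x)) t x y"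
    unfolding mexp_def using assms(2)
    by (intro suminf_cong arg_cong2[of _ _ _ _ "(*)"] refl mat_pow_cong) auto
  then show ?thesis
    by (simp add: ctmc_trans_eq_mexp mexp_scale)
qed

locale trap_cube =
  fixes n :: nat and W :: "(nat \<Rightarrow> int) \<Rightarrow> real"
  assumes n_pos: "n > 0" and W_pos: "\<And>x. W x > 0"
begin

sublocale finite_generator "hcube n" "trap_gen n W"
proof
  show "(\<Sum>y\<in>hcube n. trap_gen n W x y) = 0" if "x \<in> hcube n" for x
    using trap_gen_apply[OF that n_pos, of W "\<lambda>_. 1"] n_pos by simp
qed (auto simp: trap_gen_def less_imp_le[OF W_pos])

text \<open>The probability that an independent exponential clock of rate \<open>l\<close> rings
  before the chain leaves \<open>x\<close>.\<close>

definition kill :: "real \<Rightarrow> (nat \<Rightarrow> int) \<Rightarrow> real" where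
  "kill l x = l / (l + W x)"

lemma kill_bounds: "l > 0 \<Longrightarrow> 0 < kill l x \<and> kill l x \<le> 1"
  using W_pos[of x] by (auto simp: kill_def intro!: divide_pos_pos add_pos_pos)

lemma one_minus_kill: "l > 0 \<Longrightarrow> 1 - kill l x = W x / (l + W x)"
  using W_pos[of x] by (simp add: kill_def field_simps)

text \<open>Decomposition at the first event: either the clock of rate \<open>l\<close> rings at
  \<open>x\<close>, and the window has to pass there, or the chain first moves to a uniform
  neighbour. Formally it is the resolvent equation divided by \<open>l + W x\<close>.\<close>

lemma laplace_stay_eq:
  assumes l: "l > 0" and "s \<ge> 0" "x \<in> hcube n"
  shows "laplace_stay l x s
       = kill l x * exp (- W x * s) + (1 - kill l x) * cube_avg n (\<lambda>z. laplace_stay l z s) x"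
proof -
  have pos: "l + W x > 0" using l W_pos[of x] by simp
  have "l * laplace_stay l x s - W x * (cube_avg n (\<lambda>z. laplace_stay l z s) x - laplace_stay l x s)
      = l * exp (- W x * s)"
    using laplace_stay_resolvent[OF assms] trap_gen_apply[OF assms(3) n_pos, of W "\<lambda>z. laplace_stay l z s"]
    by (simp add: trap_gen_def)
  then have "(l + W x) * laplace_stay l x s
      = l * exp (- W x * s) + W x * cube_avg n (\<lambda>z. laplace_stay l z s) x"
    by (simp add: algebra_simps)
  then have "laplace_stay l x s
      = (l * exp (- W x * s) + W x * cube_avg n (\<lambda>z. laplace_stay l z s) x) / (l + W x)"
    using pos by (simp add: field_simps)
  then show ?thesis
    unfolding one_minus_kill[OF l] unfolding kill_def by (simp add: add_divide_distrib)
qed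

lemma laplace_stay_approx:
  assumes "l > 0" "s \<ge> 0" "x \<in> hcube n"
    and "\<And>x. x \<in> hcube n \<Longrightarrow> green_excess n (kill l) x \<le> e"
  shows "\<bar>laplace_stay l x s - cube_mean n (\<lambda>x. kill l x * exp (- W x * s)) / cube_mean n (kill l)\<bar>
     \<le> 2 * e + kill l x"
proof (rule homogenization[OF n_pos])
  show "laplace_stay l x s
       = kill l x * exp (- W x * s) + (1 - kill l x) * cube_avg n (\<lambda>z. laplace_stay l z s) x"
    if "x \<in> hcube n" for x using laplace_stay_eq assms that by blast
  show "0 \<le> exp (- W x * s) \<and> exp (- W x * s) \<le> 1" for x
    using assms(2) W_pos[of x] by (simp add: mult_nonneg_nonneg less_imp_le)
qed (use assms kill_bounds in auto)

text \<open>The bound of \<open>hitting_supersolution\<close> away from \<open>y\<close>; the factor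
  2 accounts for \<open>U y\<close> being only at least 1/2.\<close>

definition hit_bound :: "real" where
  "hit_bound = 2 * (7 / real n + real n ^ 2 / 2 ^ n + 5 / (2 ^ n * cube_mean n (kill 1)))"

text \<open>Multiplied by \<open>1 + W x\<close>, the inequality for \<open>U\<close> with killing
  rate 1 says that the generator maps \<open>U\<close> below \<open>U\<close>, so
  \<open>mexp_le_supersolution\<close> applies with \<open>l = 1\<close>.\<close>

lemma mexp_off_diag_le:
  assumes ex: "\<And>x. x \<in> hcube n \<Longrightarrow> green_excess n (kill 1) x \<le> 1"
    and "t \<ge> 0" "x \<in> hcube n" "y \<in> hcube n" "x \<noteq> y"
  shows "mexp (hcube n) (trap_gen n W) t x y \<le> exp t * hit_bound"
proof -
  let ?P = "mexp (hcube n) (trap_gen n W)"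
  obtain U where U: "\<And>x. x \<in> hcube n \<Longrightarrow> U x \<ge> 0"
    "\<And>x. x \<in> hcube n \<Longrightarrow> (1 - kill 1 x) * cube_avg n U x \<le> U x"
    "U y \<ge> 1 / 2"
    "\<And>x. x \<in> hcube n \<Longrightarrow> x \<noteq> y \<Longrightarrow> U x \<le> hit_bound / 2"
    using hitting_supersolution[OF n_pos _ ex assms(4)] kill_bounds[of 1]
    unfolding hit_bound_def by (metis nonzero_mult_div_cancel_left zero_less_one zero_neq_numeral)
  have "U y * ?P t x y \<le> exp (1 * t) * U x"
  proof (rule mexp_le_supersolution[OF U(1)])
    fix x assume x: "x \<in> hcube n"
    have pos: "1 + W x > 0" using W_pos[of x] by simp
    have "W x / (1 + W x) * cube_avg n U x \<le> U x"
      using U(2)[OF x] one_minus_kill[of 1 x] by simp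
    then have "W x * cube_avg n U x \<le> U x * (1 + W x)"
      using pos by (simp add: field_simps)
    then show "(\<Sum>z\<in>hcube n. trap_gen n W x z * U z) \<le> 1 * U x"
      using trap_gen_apply[OF x n_pos, of W U] by (simp add: algebra_simps)
  qed (use assms in auto)
  moreover have "1 / 2 * ?P t x y \<le> U y * ?P t x y"
    using U(3) assms by (intro mult_right_mono mexp_nonneg) auto
  moreover have "exp (1 * t) * U x \<le> exp (1 * t) * (hit_bound / 2)"
    using U(4)[OF assms(3,5)] by (intro mult_left_mono) auto
  ultimately have "1 / 2 * ?P t x y \<le> exp (1 * t) * (hit_bound / 2)"
    by linarith
  then show ?thesis by simp
qed

text \<open>Being at \<open>y\<close> again without having stayed requires coming back from another
  site. This bounds the return probability minus the staying probability uniformly in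
  \<open>y\<close>, and the law at time \<open>t\<close> averages the bound.\<close>

lemma return_prob_approx:
  assumes ex: "\<And>x. x \<in> hcube n \<Longrightarrow> green_excess n (kill 1) x \<le> 1"
    and "t \<ge> 0" "s \<ge> 0" "x \<in> hcube n"
  shows "\<bar>(\<Sum>y\<in>hcube n. mexp (hcube n) (trap_gen n W) t x y * mexp (hcube n) (trap_gen n W) s y y)
           - stay x t s\<bar> \<le> exp s * hit_bound"
proof -
  let ?P = "mexp (hcube n) (trap_gen n W)"
  have "cube_mean n (kill 1) \<ge> 0"
    unfolding cube_mean_def using kill_bounds[of 1]
    by (intro divide_nonneg_nonneg sum_nonneg) (auto simp: less_imp_le)
  then have hb: "hit_bound \<ge> 0"
    by (simp add: hit_bound_def)
  have diag: "exp (trap_gen n W y y * s) \<le> ?P s y y"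
    "?P s y y \<le> exp (trap_gen n W y y * s) + exp s * hit_bound" if y: "y \<in> hcube n" for y
  proof -
    show "exp (trap_gen n W y y * s) \<le> ?P s y y"
      using assms y by (intro mexp_diag_ge)
    show "?P s y y \<le> exp (trap_gen n W y y * s) + exp s * hit_bound"
    proof (rule mexp_diag_le)
      fix r z assume *: "0 \<le> r" "r \<le> s" "z \<in> hcube n" "z \<noteq> y"
      have "?P r z y \<le> exp r * hit_bound"
        using * y ex by (intro mexp_off_diag_le) auto
      also have "\<dots> \<le> exp s * hit_bound"
        using * hb by (intro mult_right_mono) auto
      finally show "?P r z y \<le> exp s * hit_bound" .
    qed (use assms y hb in auto)
  qed
  have "(\<Sum>y\<in>hcube n. ?P t x y * ?P s y y) - stay x t s
     = (\<Sum>y\<in>hcube n. ?P t x y * (?P s y y - exp (trap_gen n W y y * s)))"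
    by (simp add: stay_def right_diff_distrib sum_subtractf)
  moreover have "\<dots> \<ge> 0"
    using diag assms by (intro sum_nonneg mult_nonneg_nonneg mexp_nonneg) auto
  moreover have "(\<Sum>y\<in>hcube n. ?P t x y * (?P s y y - exp (trap_gen n W y y * s)))
     \<le> (\<Sum>y\<in>hcube n. ?P t x y * (exp s * hit_bound))"
    using diag(2) assms by (intro sum_mono mult_left_mono mexp_nonneg) (auto simp: algebra_simps)
  moreover have "\<dots> = exp s * hit_bound"
    using mexp_row_sum[OF assms(4)] by (simp add: sum_distrib_right[symmetric])
  ultimately show ?thesis by simp
qed

end

subsection \<open>The Laplace transform of the arcsine law\<close>

lemma nn_integral_powr_exp:
  assumes "a > 0" "p > 0"
  shows "(\<integral>\<^sup>+x. ennreal (x powr (a - 1) * exp (- (p * x))) * indicator {0..} x \<partial>lborel)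
       = ennreal (Gamma a * p powr (- a))"
proof -
  have "(\<integral>\<^sup>+x. ennreal (x powr (a - 1) * exp (- (p * x))) * indicator {0..} x \<partial>lborel)
     = ennreal (1 / p) * (\<integral>\<^sup>+x. ennreal ((x / p) powr (a - 1) * exp (- x)) * indicator {0..} (x / p) \<partial>lborel)"
    using assms by (subst nn_integral_real_affine[where c = "1 / p" and t = 0]) auto
  also have "(\<integral>\<^sup>+x. ennreal ((x / p) powr (a - 1) * exp (- x)) * indicator {0..} (x / p) \<partial>lborel)
     = (\<integral>\<^sup>+x. ennreal (p powr (1 - a)) * ennreal (indicator {0..} x * x powr (a - 1) / exp x) \<partial>lborel)"
  proof (rule nn_integral_cong)
    fix x :: real
    show "ennreal ((x / p) powr (a - 1) * exp (- x)) * indicator {0..} (x / p)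
        = ennreal (p powr (1 - a)) * ennreal (indicator {0..} x * x powr (a - 1) / exp x)"
    proof (cases "x \<ge> 0")
      case True
      have "(x / p) powr (a - 1) = p powr (1 - a) * x powr (a - 1)"
        using True assms by (simp add: powr_divide powr_diff field_simps)
      then show ?thesis
        using True assms by (simp add: ennreal_mult'[symmetric] exp_minus field_simps)
    qed (use assms in \<open>auto simp: zero_le_divide_iff\<close>)
  qed
  also have "\<dots> = ennreal (p powr (1 - a)) * ennreal (Gamma a)"
    using assms by (simp add: nn_integral_cmult Gamma_conv_nn_integral_real)
  also have "ennreal (1 / p) * (ennreal (p powr (1 - a)) * ennreal (Gamma a)) = ennreal (Gamma a * p powr (- a))"
    using assms Gamma_real_pos[of a]
    by (simp add: ennreal_mult'[symmetric] powr_minus powr_diff field_simps)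
  finally show ?thesis .
qed

context
  fixes \<alpha> :: real
  assumes \<alpha>: "0 < \<alpha>" "\<alpha> < 1"
begin

definition shift_laplace :: "real \<Rightarrow> real \<Rightarrow> ennreal" where
  "shift_laplace l s = (\<integral>\<^sup>+x. ennreal (exp (- (l * x)) * (x + s) powr (- \<alpha>)) * indicator {0..} x \<partial>lborel)"

text \<open>The convolution at \<open>t\<close> of r^(a-1) with (r+s)^(-a), where a =
  \<open>\<alpha>\<close>. The substitution r = (t+s) x turns it into the integral that defines
  \<open>Asl\<close> at t/(t+s).\<close>

definition arcsine_conv :: "real \<Rightarrow> real \<Rightarrow> ennreal" where
  "arcsine_conv s t = (\<integral>\<^sup>+r. ennreal (r powr (\<alpha> - 1) * (t - r + s) powr (- \<alpha>)) * indicator {0..t} r \<partial>lborel)"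

text \<open>The form in which the limit arises from the environment, as a ratio of means where
  common constants cancel; \<open>laplace_Asl\<close> identifies it as a Laplace transform.\<close>

definition arcsine_laplace :: "real \<Rightarrow> real \<Rightarrow> real" where
  "arcsine_laplace l s = enn2real (shift_laplace l s) / enn2real (shift_laplace l 0)"

lemma shift_laplace_0: "l > 0 \<Longrightarrow> shift_laplace l 0 = ennreal (Gamma (1 - \<alpha>) * l powr (\<alpha> - 1))"
  using nn_integral_powr_exp[of "1 - \<alpha>" l] \<alpha> by (simp add: shift_laplace_def mult.commute)

lemma shift_laplace_le_0:
  assumes "s \<ge> 0"
  shows "shift_laplace l s \<le> shift_laplace l 0"
  unfolding shift_laplace_def
proof (rule nn_integral_mono_AE)
  show "AE x in lborel. ennreal (exp (- (l * x)) * (x + s) powr (- \<alpha>)) * indicator {0..} x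
      \<le> ennreal (exp (- (l * x)) * (x + 0) powr (- \<alpha>)) * indicator {0..} x"
    using AE_lborel_singleton[of "0::real"]
  proof eventually_elim
    case (elim x)
    then show ?case
      using \<alpha> assms by (cases "x > 0") (auto simp: indicator_def intro!: ennreal_leI mult_left_mono powr_mono2')
  qed
qed

lemma shift_laplace_finite:
  assumes "l > 0" "s \<ge> 0"
  shows "shift_laplace l s < \<infinity>"
  using shift_laplace_le_0[OF assms(2), of l] shift_laplace_0[OF assms(1)]
  by (simp add: order_le_less_trans)

text \<open>The Laplace transform of a convolution is a product. With nonnegative integrals the
  interchange is Tonelli's theorem and needs no integrability.\<close>

lemma laplace_arcsine_conv:
  assumes "l > 0" "s \<ge> 0"
  shows "(\<integral>\<^sup>+t. ennreal (exp (- (l * t))) * arcsine_conv s t \<partial>lborel)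
       = ennreal (Gamma \<alpha> * l powr (- \<alpha>)) * shift_laplace l s"
proof -
  define g where "g r = ennreal (r powr (\<alpha> - 1) * exp (- (l * r))) * indicator {0..} r" for r
  define h where "h x = ennreal (exp (- (l * x)) * (x + s) powr (- \<alpha>)) * indicator {0..} x" for x
  have [measurable]: "g \<in> borel_measurable borel" "h \<in> borel_measurable borel"
    unfolding g_def h_def by measurable
  have "(\<integral>\<^sup>+t. ennreal (exp (- (l * t))) * arcsine_conv s t \<partial>lborel)
     = (\<integral>\<^sup>+t. \<integral>\<^sup>+r. g r * h (t - r) \<partial>lborel \<partial>lborel)"
    unfolding arcsine_conv_def
  proof (subst nn_integral_cmult[symmetric], simp, intro nn_integral_cong)
    fix t r :: real
    have "exp (- (l * t)) = exp (- (l * r)) * exp (- (l * (t - r)))"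
      by (simp add: exp_add[symmetric] algebra_simps)
    then show "ennreal (exp (- (l * t))) * (ennreal (r powr (\<alpha> - 1) * (t - r + s) powr (- \<alpha>)) * indicator {0..t} r)
        = g r * h (t - r)"
      by (auto simp: g_def h_def indicator_def ennreal_mult'[symmetric] mult_ac)
  qed
  also have "\<dots> = (\<integral>\<^sup>+r. \<integral>\<^sup>+t. g r * h (t - r) \<partial>lborel \<partial>lborel)"
    by (rule lborel_pair.Fubini'[symmetric]) measurable
  also have "\<dots> = (\<integral>\<^sup>+r. g r * shift_laplace l s \<partial>lborel)"
  proof (rule nn_integral_cong)
    fix r :: real
    have "(\<integral>\<^sup>+t. h (t - r) \<partial>lborel) = (\<integral>\<^sup>+x. h x \<partial>lborel)"
      by (subst nn_integral_real_affine[where c = 1 and t = r]) auto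
    then show "(\<integral>\<^sup>+t. g r * h (t - r) \<partial>lborel) = g r * shift_laplace l s"
      by (subst nn_integral_cmult) (auto simp: shift_laplace_def h_def)
  qed
  also have "\<dots> = ennreal (Gamma \<alpha> * l powr (- \<alpha>)) * shift_laplace l s"
    using nn_integral_powr_exp[OF \<alpha>(1) assms(1)] by (simp add: nn_integral_multc g_def)
  finally show ?thesis .
qed

section \<open>The generalised arcsine function and its transform\<close>

lemma arcsine_has_integral:
  "((\<lambda>x. x powr (\<alpha> - 1) * (1 - x) powr (- \<alpha>)) has_integral Beta \<alpha> (1 - \<alpha>)) {0..1}"
  using has_integral_Beta_real[of \<alpha> "1 - \<alpha>"] \<alpha> by simp

lemma arcsine_integrable:
  "0 \<le> v \<Longrightarrow> u \<le> 1 \<Longrightarrow> (\<lambda>x. x powr (\<alpha> - 1) * (1 - x) powr (- \<alpha>)) integrable_on {v..u}"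
  by (rule integrable_on_subinterval[OF has_integral_integrable[OF arcsine_has_integral]]) auto

lemma sin_alpha_pos: "sin (\<alpha> * pi) > 0"
  using \<alpha> by (intro sin_gt_zero) auto

lemma Asl_mono:
  assumes "u \<le> u'" "u' \<le> 1"
  shows "Asl \<alpha> u \<le> Asl \<alpha> u'"
  unfolding Asl_def using sin_alpha_pos assms
  by (intro mult_left_mono integral_subset_le arcsine_integrable) auto

lemma Asl_nonneg: "u \<le> 1 \<Longrightarrow> Asl \<alpha> u \<ge> 0"
  unfolding Asl_def using sin_alpha_pos
  by (intro mult_nonneg_nonneg integral_nonneg arcsine_integrable) auto

lemma continuous_on_Asl: "continuous_on {0..1} (Asl \<alpha>)"
  unfolding Asl_def[abs_def]
  by (intro continuous_intros indefinite_integral_continuous_1 arcsine_integrable) auto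

text \<open>Under r = T x with T = t + s the powers of T cancel, since 1 + (a - 1) - a = 0 for a =
  \<open>\<alpha>\<close>.\<close>

lemma Asl_eq_conv:
  assumes "s > 0" "t > 0"
  shows "ennreal (Asl \<alpha> (t / (t + s))) = ennreal (sin (\<alpha> * pi) / pi) * arcsine_conv s t"
proof -
  define u where "u = t / (t + s)"
  define T where "T = t + s"
  have T: "T > 0" using assms by (simp add: T_def)
  define f where "f x = x powr (\<alpha> - 1) * (1 - x) powr (- \<alpha>)" for x
  have u: "0 < u" "u < 1" using assms by (auto simp: u_def)
  have f0: "f x \<ge> 0" for x by (simp add: f_def)
  have [measurable]: "f \<in> borel_measurable borel" unfolding f_def by measurable
  have "ennreal (integral {0..u} f) = (\<integral>\<^sup>+x. ennreal (f x) * indicator {0..u} x \<partial>lborel)"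
    using u f0 arcsine_integrable[of 0 u]
    by (intro nn_integral_has_integral_lebesgue'[symmetric] integrable_integral) (auto simp: f_def[abs_def])
  also have "\<dots> = ennreal (1 / T) * (\<integral>\<^sup>+r. ennreal (f (r / T)) * indicator {0..u} (r / T) \<partial>lborel)"
    using T by (subst nn_integral_real_affine[where c = "1 / T" and t = 0]) auto
  also have "\<dots> = (\<integral>\<^sup>+r. ennreal (1 / T) * (ennreal (f (r / T)) * indicator {0..u} (r / T)) \<partial>lborel)"
    by (subst nn_integral_cmult) auto
  also have "\<dots> = arcsine_conv s t"
    unfolding arcsine_conv_def
  proof (rule nn_integral_cong)
    fix r :: real
    have ind: "r / T \<in> {0..u} \<longleftrightarrow> r \<in> {0..t}"
      using T by (auto simp: u_def T_def[symmetric] zero_le_divide_iff divide_le_cancel)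
    show "ennreal (1 / T) * (ennreal (f (r / T)) * indicator {0..u} (r / T))
        = ennreal (r powr (\<alpha> - 1) * (t - r + s) powr (- \<alpha>)) * indicator {0..t} r"
    proof (cases "r \<in> {0..t}")
      case True
      have *: "1 - r / T = (t - r + s) / T"
        using T by (simp add: field_simps T_def)
      have "1 / T * f (r / T) = 1 / T * ((r powr (\<alpha> - 1) / T powr (\<alpha> - 1)) * ((t - r + s) powr (- \<alpha>) / T powr (- \<alpha>)))"
        unfolding f_def * using True T assms by (simp add: powr_divide)
      also have "\<dots> = r powr (\<alpha> - 1) * (t - r + s) powr (- \<alpha>) / (T powr 1 * T powr (\<alpha> - 1) * T powr (- \<alpha>))"
        using T by simp
      also have "T powr 1 * T powr (\<alpha> - 1) * T powr (- \<alpha>) = 1"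
        using T by (simp only: powr_add[symmetric]) simp
      finally have "1 / T * f (r / T) = r powr (\<alpha> - 1) * (t - r + s) powr (- \<alpha>)"
        by simp
      then show ?thesis
        using True ind T f0 by (simp add: indicator_def ennreal_mult'[symmetric])
    next
      case False
      with ind have "r / T \<notin> {0..u}" by simp
      then have "indicator {0..u} (r / T) = (0::ennreal)" by (rule indicator_simps(2))
      moreover have "indicator {0..t} r = (0::ennreal)" using False by (rule indicator_simps(2))
      ultimately show ?thesis by (simp only: mult_zero_right)
    qed
  qed
  finally have "ennreal (sin (\<alpha> * pi) / pi) * ennreal (integral {0..u} f)
      = ennreal (sin (\<alpha> * pi) / pi) * arcsine_conv s t"
    by simp
  moreover have "Asl \<alpha> (t / (t + s)) = sin (\<alpha> * pi) / pi * integral {0..u} f"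
    by (simp add: Asl_def u_def f_def[abs_def])
  moreover have "sin (\<alpha> * pi) / pi \<ge> 0"
    using sin_alpha_pos by simp
  ultimately show ?thesis
    by (simp only: ennreal_mult')
qed

lemma Gamma_reflection_alpha: "Gamma \<alpha> * Gamma (1 - \<alpha>) = pi / sin (\<alpha> * pi)"
proof -
  have 1: "1 - complex_of_real \<alpha> = complex_of_real (1 - \<alpha>)"
    by simp
  have "complex_of_real (Gamma \<alpha> * Gamma (1 - \<alpha>)) = Gamma (complex_of_real \<alpha>) * Gamma (1 - complex_of_real \<alpha>)"
    unfolding 1 by (simp only: Gamma_complex_of_real of_real_mult)
  also have "\<dots> = complex_of_real pi / sin (complex_of_real (pi * \<alpha>))"
    by (simp only: Gamma_reflection_complex of_real_mult)
  also have "\<dots> = complex_of_real (pi / sin (pi * \<alpha>))"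
    by (simp only: sin_of_real of_real_divide)
  finally have "Gamma \<alpha> * Gamma (1 - \<alpha>) = pi / sin (pi * \<alpha>)"
    by (simp only: of_real_eq_iff)
  then show ?thesis by (simp add: mult.commute)
qed

text \<open>By the convolution formula the transform is \<open>shift_laplace l s\<close> times an
  explicit constant. The reflection formula for Gamma shows that this constant is 1 over
  \<open>shift_laplace l 0\<close>.\<close>

lemma laplace_Asl:
  assumes "l > 0" "s > 0"
  shows "(\<integral>\<^sup>+t. ennreal (l * exp (- (l * t)) * Asl \<alpha> (t / (t + s))) * indicator {0<..} t \<partial>lborel)
       = ennreal (arcsine_laplace l s)"
proof -
  define c where "c = l * (sin (\<alpha> * pi) / pi)"
  have c0: "c \<ge> 0" using assms sin_alpha_pos by (simp add: c_def)
  have "arcsine_conv s = (\<lambda>t. \<integral>\<^sup>+r. ennreal (r powr (\<alpha> - 1) * (t - r + s) powr (- \<alpha>))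
      * (if 0 \<le> r \<and> r \<le> t then 1 else 0) \<partial>lborel)"
    by (auto simp: arcsine_conv_def indicator_def fun_eq_iff intro!: nn_integral_cong)
  then have [measurable]: "arcsine_conv s \<in> borel_measurable borel"
    by simp
  have "(\<integral>\<^sup>+t. ennreal (l * exp (- (l * t)) * Asl \<alpha> (t / (t + s))) * indicator {0<..} t \<partial>lborel)
     = (\<integral>\<^sup>+t. ennreal c * (ennreal (exp (- (l * t))) * arcsine_conv s t) \<partial>lborel)"
  proof (rule nn_integral_cong_AE)
    have "AE t in lborel. t \<noteq> (0::real)"
      by (rule AE_lborel_singleton)
    then show "AE t in lborel. ennreal (l * exp (- (l * t)) * Asl \<alpha> (t / (t + s))) * indicator {0<..} t
        = ennreal c * (ennreal (exp (- (l * t))) * arcsine_conv s t)"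
    proof eventually_elim
      case (elim t)
      show ?case
      proof (cases "t > 0")
        case True
        have "ennreal (l * exp (- (l * t)) * Asl \<alpha> (t / (t + s)))
            = ennreal (l * exp (- (l * t))) * (ennreal (sin (\<alpha> * pi) / pi) * arcsine_conv s t)"
          using True assms Asl_eq_conv[OF assms(2) True] by (subst ennreal_mult') auto
        also have "\<dots> = ennreal (l * exp (- (l * t)) * (sin (\<alpha> * pi) / pi)) * arcsine_conv s t"
          using assms by (subst ennreal_mult'[of "l * exp (- (l * t))"]) (simp, simp only: mult.assoc)
        also have "l * exp (- (l * t)) * (sin (\<alpha> * pi) / pi) = c * exp (- (l * t))"
          by (simp add: c_def)
        finally show ?thesis
          using True c0 by (simp add: ennreal_mult' mult.assoc)
      next
        case False
        with elim have "arcsine_conv s t = 0"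
          by (simp add: arcsine_conv_def)
        then show ?thesis using False by simp
      qed
    qed
  qed
  also have "\<dots> = ennreal c * (ennreal (Gamma \<alpha> * l powr (- \<alpha>)) * shift_laplace l s)"
    using assms by (subst nn_integral_cmult) (auto simp: laplace_arcsine_conv)
  also have "shift_laplace l s = ennreal (enn2real (shift_laplace l s))"
    using shift_laplace_finite[of l s] assms by simp
  also have "ennreal c * (ennreal (Gamma \<alpha> * l powr (- \<alpha>)) * \<dots>)
      = ennreal (c * (Gamma \<alpha> * l powr (- \<alpha>) * enn2real (shift_laplace l s)))"
    using c0 Gamma_real_pos[OF \<alpha>(1)] by (simp add: ennreal_mult')
  also have "c * (Gamma \<alpha> * l powr (- \<alpha>) * enn2real (shift_laplace l s))
      = arcsine_laplace l s"
  proof -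
    have G: "Gamma (1 - \<alpha>) > 0" using \<alpha> by (intro Gamma_real_pos) simp
    have "sin (\<alpha> * pi) / pi * Gamma \<alpha> = 1 / Gamma (1 - \<alpha>)"
      using Gamma_reflection_alpha sin_alpha_pos G by (simp add: field_simps)
    then have "c * (Gamma \<alpha> * l powr (- \<alpha>)) = l powr (1 - \<alpha>) / Gamma (1 - \<alpha>)"
      using assms by (simp add: c_def powr_diff powr_minus field_simps)
    moreover have "enn2real (shift_laplace l 0) = Gamma (1 - \<alpha>) * l powr (\<alpha> - 1)"
      using shift_laplace_0[OF assms(1)] G by simp
    moreover have "l powr (1 - \<alpha>) = inverse (l powr (\<alpha> - 1))"
      by (simp add: powr_minus[symmetric])
    ultimately have "c * (Gamma \<alpha> * l powr (- \<alpha>)) = 1 / enn2real (shift_laplace l 0)"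
      using G by (simp add: field_simps)
    then have "c * (Gamma \<alpha> * l powr (- \<alpha>)) * enn2real (shift_laplace l s)
        = 1 / enn2real (shift_laplace l 0) * enn2real (shift_laplace l s)"
      by (rule arg_cong)
    then show ?thesis by (simp add: arcsine_laplace_def mult.assoc)
  qed
  finally show ?thesis .
qed

end

subsection \<open>The law of the rescaled rates\<close>

abbreviation exp_weight :: "real \<Rightarrow> real \<Rightarrow> ennreal" where
  "exp_weight p w \<equiv> ennreal (p * exp (- (p * w))) * indicator {0..} w"

lemma exp_neg_at_top: "c > 0 \<Longrightarrow> ((\<lambda>x. exp (- (c * x))) \<longlongrightarrow> (0::real)) at_top"
  by (intro filterlim_compose[OF exp_at_bot] filterlim_compose[OF filterlim_uminus_at_bot_at_top]
      filterlim_tendsto_pos_mult_at_top[OF tendsto_const _ filterlim_ident])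

text \<open>Since e^(-pX) is the integral of p e^(-pw) over w >= X, Tonelli's theorem leaves the
  distribution function of X in the integrand.\<close>

lemma (in prob_space) nn_integral_exp_neg_cdf:
  assumes [measurable]: "X \<in> borel_measurable M" "G \<in> borel_measurable borel"
    and X: "\<And>\<omega>. X \<omega> > 0" and p: "p > 0"
    and G: "\<And>w. w > 0 \<Longrightarrow> emeasure M {\<omega> \<in> space M. X \<omega> \<le> w} = G w"
  shows "(\<integral>\<^sup>+\<omega>. ennreal (exp (- (p * X \<omega>))) \<partial>M)
       = (\<integral>\<^sup>+w. exp_weight p w * G w \<partial>lborel)"
proof -
  interpret pair_sigma_finite M lborel ..
  have "(\<integral>\<^sup>+\<omega>. ennreal (exp (- (p * X \<omega>))) \<partial>M)
      = (\<integral>\<^sup>+\<omega>. \<integral>\<^sup>+w. ennreal (p * exp (- (p * w))) * (if X \<omega> \<le> w then 1 else 0) \<partial>lborel \<partial>M)"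
  proof (rule nn_integral_cong)
    fix \<omega>
    have "(\<integral>\<^sup>+w. ennreal (p * exp (- (p * w))) * indicator {X \<omega>..} w \<partial>lborel) = 0 - (- exp (- (p * X \<omega>)))"
    proof (rule nn_integral_FTC_atLeast)
      show "((\<lambda>w. - exp (- (p * w))) \<longlongrightarrow> 0) at_top"
        using tendsto_minus[OF exp_neg_at_top[OF p]] by simp
    qed (use p in \<open>auto intro!: derivative_eq_intros\<close>)
    moreover have "(\<integral>\<^sup>+w. ennreal (p * exp (- (p * w))) * indicator {X \<omega>..} w \<partial>lborel)
       = (\<integral>\<^sup>+w. ennreal (p * exp (- (p * w))) * (if X \<omega> \<le> w then 1 else 0) \<partial>lborel)"
      by (intro nn_integral_cong) (auto simp: indicator_def)
    ultimately show "ennreal (exp (- (p * X \<omega>)))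
      = (\<integral>\<^sup>+w. ennreal (p * exp (- (p * w))) * (if X \<omega> \<le> w then 1 else 0) \<partial>lborel)"
      by simp
  qed
  also have "\<dots> = (\<integral>\<^sup>+w. \<integral>\<^sup>+\<omega>. ennreal (p * exp (- (p * w))) * (if X \<omega> \<le> w then 1 else 0) \<partial>M \<partial>lborel)"
    by (rule Fubini'[symmetric]) measurable
  also have "\<dots> = (\<integral>\<^sup>+w. exp_weight p w * G w \<partial>lborel)"
  proof (rule nn_integral_cong_AE)
    show "AE w in lborel. (\<integral>\<^sup>+\<omega>. ennreal (p * exp (- (p * w))) * (if X \<omega> \<le> w then 1 else 0) \<partial>M)
        = exp_weight p w * G w"
      using AE_lborel_singleton[of "0::real"]
    proof eventually_elim
      case (elim w)
      have "(\<integral>\<^sup>+\<omega>. ennreal (p * exp (- (p * w))) * (if X \<omega> \<le> w then 1 else 0) \<partial>M)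
         = (\<integral>\<^sup>+\<omega>. ennreal (p * exp (- (p * w))) * indicator {\<omega> \<in> space M. X \<omega> \<le> w} \<omega> \<partial>M)"
        by (intro nn_integral_cong) (auto simp: indicator_def)
      also have "\<dots> = ennreal (p * exp (- (p * w))) * emeasure M {\<omega> \<in> space M. X \<omega> \<le> w}"
        by (rule nn_integral_cmult_indicator) measurable
      also have "\<dots> = exp_weight p w * G w"
      proof (cases "w > 0")
        case False
        then have e: "{\<omega> \<in> space M. X \<omega> \<le> w} = {}"
          using X by (auto simp: not_less) (metis not_less order_trans)
        show ?thesis unfolding e using False elim by simp
      qed (simp add: G)
      finally show ?case .
    qed
  qed
  finally show ?thesis .
qed

text \<open>The factor l/(l+X) is itself a Laplace transform. Hence the mean of the left side under
  a random X reduces to means of pure exponentials in X.\<close>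

lemma kill_laplace:
  fixes l s X :: real
  assumes "l > 0" "X > 0"
  shows "ennreal (l / (l + X) * exp (- X * s))
       = (\<integral>\<^sup>+x. exp_weight l x * ennreal (exp (- ((x + s) * X))) \<partial>lborel)"
proof -
  have "(\<integral>\<^sup>+x. ennreal (l * exp (- X * s) * exp (- ((l + X) * x))) * indicator {0..} x \<partial>lborel)
     = 0 - (- (l / (l + X) * exp (- X * s) * exp (- ((l + X) * 0))))"
  proof (rule nn_integral_FTC_atLeast)
    show "((\<lambda>x. - (l / (l + X) * exp (- X * s) * exp (- ((l + X) * x)))) has_real_derivative
        l * exp (- X * s) * exp (- ((l + X) * x))) (at x)" for x
    proof -
      define c where "c = l / (l + X) * exp (- X * s)"
      have "c * (l + X) = l * exp (- X * s)"
        using assms by (simp add: c_def)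
      moreover have "((\<lambda>x. - (c * exp (- ((l + X) * x)))) has_real_derivative
          c * (l + X) * exp (- ((l + X) * x))) (at x)"
        by (auto intro!: derivative_eq_intros simp: algebra_simps)
      ultimately show ?thesis by (simp only: c_def)
    qed
    have "((\<lambda>x. - (l / (l + X) * exp (- X * s) * exp (- ((l + X) * x)))) \<longlongrightarrow>
        - (l / (l + X) * exp (- X * s) * 0)) at_top"
      using assms by (intro tendsto_intros exp_neg_at_top) auto
    then show "((\<lambda>x. - (l / (l + X) * exp (- X * s) * exp (- ((l + X) * x)))) \<longlongrightarrow> 0) at_top"
      by simp
  qed (use assms in auto)
  moreover have "(\<integral>\<^sup>+x. ennreal (l * exp (- X * s) * exp (- ((l + X) * x))) * indicator {0..} x \<partial>lborel)
     = (\<integral>\<^sup>+x. exp_weight l x * ennreal (exp (- ((x + s) * X))) \<partial>lborel)"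
  proof (rule nn_integral_cong)
    fix x :: real
    have "l * exp (- X * s) * exp (- ((l + X) * x)) = l * exp (- (l * x)) * exp (- ((x + s) * X))"
      by (simp add: mult_exp_exp algebra_simps)
    then show "ennreal (l * exp (- X * s) * exp (- ((l + X) * x))) * indicator {0..} x
        = exp_weight l x * ennreal (exp (- ((x + s) * X)))"
      using assms by (simp add: indicator_def ennreal_mult'[symmetric])
  qed
  ultimately show ?thesis by simp
qed

text \<open>For w > 0 this is e^(bn) times the distribution function of a rescaled rate. The
  prescribed tail covers nonnegative thresholds only, that is ln w up to
  \<open>\<alpha> * \<beta>\<^sup>2 * real n\<close>; beyond, the probability is 1, whence the
  constant e^(bn).\<close>

definition rate_cdf :: "real \<Rightarrow> real \<Rightarrow> nat \<Rightarrow> real \<Rightarrow> real" where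
  "rate_cdf \<alpha> \<beta> n w = (if ln w \<le> \<alpha> * \<beta>\<^sup>2 * real n
     then exp (\<alpha> * ln w - (ln w)\<^sup>2 / (2 * \<beta>\<^sup>2 * real n)) else exp (\<alpha>\<^sup>2 * \<beta>\<^sup>2 / 2 * real n))"

abbreviation cdf_transform :: "real \<Rightarrow> real \<Rightarrow> nat \<Rightarrow> real \<Rightarrow> ennreal" where
  "cdf_transform \<alpha> \<beta> n p \<equiv> \<integral>\<^sup>+w. exp_weight p w * ennreal (rate_cdf \<alpha> \<beta> n w) \<partial>lborel"

text \<open>The mean of k f at one site, times e^(bn), with both exponential mixtures written
  out.\<close>

definition kill_mean :: "real \<Rightarrow> real \<Rightarrow> nat \<Rightarrow> real \<Rightarrow> real \<Rightarrow> ennreal" where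
  "kill_mean \<alpha> \<beta> n l s = (\<integral>\<^sup>+x. exp_weight l x * cdf_transform \<alpha> \<beta> n (x + s) \<partial>lborel)"

lemma rate_cdf_measurable [measurable]: "rate_cdf \<alpha> \<beta> n \<in> borel_measurable borel"
  unfolding rate_cdf_def by measurable

context
  fixes \<alpha> \<beta> :: real
  assumes \<alpha>: "0 < \<alpha>" "\<alpha> < 1" and \<beta>: "0 < \<beta>"
begin

text \<open>In the first case a nonnegative square is dropped; in the second the constant is smaller
  because ln w is large. The bound is free of n and serves as the majorant in both dominated
  convergences.\<close>

lemma rate_cdf_le:
  assumes "w > 0"
  shows "rate_cdf \<alpha> \<beta> n w \<le> w powr \<alpha>"
proof (cases "ln w \<le> \<alpha> * \<beta>\<^sup>2 * real n")
  case True
  then show ?thesis using assms by (simp add: rate_cdf_def powr_def)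
next
  case False
  have "\<alpha>\<^sup>2 * \<beta>\<^sup>2 / 2 * real n \<le> \<alpha> * (\<alpha> * \<beta>\<^sup>2 * real n)"
    using \<alpha> \<beta> by (simp add: power2_eq_square)
  also have "\<dots> \<le> \<alpha> * ln w"
    using False \<alpha> by (intro mult_left_mono) auto
  finally show ?thesis using False assms by (simp add: rate_cdf_def powr_def)
qed

lemma rate_cdf_tendsto:
  assumes "w > 0"
  shows "(\<lambda>n. rate_cdf \<alpha> \<beta> n w) \<longlonglongrightarrow> w powr \<alpha>"
proof -
  have c: "\<alpha> * \<beta>\<^sup>2 > 0" using \<alpha> \<beta> by simp
  have "(\<lambda>n. exp (\<alpha> * ln w - (ln w)\<^sup>2 / (2 * \<beta>\<^sup>2) * (1 / real n)))
      \<longlonglongrightarrow> exp (\<alpha> * ln w - (ln w)\<^sup>2 / (2 * \<beta>\<^sup>2) * 0)"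
    by (intro tendsto_intros lim_1_over_n)
  moreover have "\<forall>\<^sub>F n in sequentially. exp (\<alpha> * ln w - (ln w)\<^sup>2 / (2 * \<beta>\<^sup>2) * (1 / real n)) = rate_cdf \<alpha> \<beta> n w"
    using eventually_ge_at_top[of "nat \<lceil>ln w / (\<alpha> * \<beta>\<^sup>2)\<rceil>"]
  proof eventually_elim
    case (elim n)
    then have "ln w / (\<alpha> * \<beta>\<^sup>2) \<le> real n"
      by (simp add: nat_le_iff ceiling_le_iff)
    then have "ln w \<le> \<alpha> * \<beta>\<^sup>2 * real n"
      using c by (simp add: field_simps)
    then show ?case by (simp add: rate_cdf_def)
  qed
  ultimately show ?thesis
    using assms by (simp add: filterlim_cong[OF refl refl] tendsto_cong powr_def)
qed

lemma inner_integral_powr: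
  assumes "p > 0"
  shows "(\<integral>\<^sup>+w. exp_weight p w * ennreal (w powr \<alpha>) \<partial>lborel)
     = ennreal (Gamma (1 + \<alpha>) * p powr (- \<alpha>))"
proof -
  have "(\<integral>\<^sup>+w. exp_weight p w * ennreal (w powr \<alpha>) \<partial>lborel)
     = (\<integral>\<^sup>+w. ennreal p * (ennreal (w powr ((1 + \<alpha>) - 1) * exp (- (p * w))) * indicator {0..} w) \<partial>lborel)"
    using assms by (intro nn_integral_cong) (auto simp: indicator_def ennreal_mult'[symmetric] mult_ac)
  also have "\<dots> = ennreal p * ennreal (Gamma (1 + \<alpha>) * p powr (- (1 + \<alpha>)))"
    using nn_integral_powr_exp[of "1 + \<alpha>" p] assms \<alpha> by (subst nn_integral_cmult) auto
  also have "\<dots> = ennreal (p * (Gamma (1 + \<alpha>) * p powr (- (1 + \<alpha>))))"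
    using assms by (subst ennreal_mult') auto
  also have "p * (Gamma (1 + \<alpha>) * p powr (- (1 + \<alpha>))) = Gamma (1 + \<alpha>) * (p powr 1 * p powr (- (1 + \<alpha>)))"
    using assms by simp
  also have "p powr 1 * p powr (- (1 + \<alpha>)) = p powr (- \<alpha>)"
    by (simp only: powr_add[symmetric]) simp
  finally show ?thesis .
qed

lemma outer_integral:
  assumes "l > 0" "s \<ge> 0"
  shows "(\<integral>\<^sup>+x. exp_weight l x
            * ennreal (Gamma (1 + \<alpha>) * (x + s) powr (- \<alpha>)) \<partial>lborel)
       = ennreal (l * Gamma (1 + \<alpha>)) * shift_laplace \<alpha> l s"
proof -
  have G: "Gamma (1 + \<alpha>) > 0" using \<alpha> by (intro Gamma_real_pos) simp
  have "(\<integral>\<^sup>+x. exp_weight l x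
            * ennreal (Gamma (1 + \<alpha>) * (x + s) powr (- \<alpha>)) \<partial>lborel)
     = (\<integral>\<^sup>+x. ennreal (l * Gamma (1 + \<alpha>)) *
          (ennreal (exp (- (l * x)) * (x + s) powr (- \<alpha>)) * indicator {0..} x) \<partial>lborel)"
    using assms G by (intro nn_integral_cong) (auto simp: indicator_def ennreal_mult'[symmetric] mult_ac)
  then show ?thesis
    using \<alpha> by (simp add: nn_integral_cmult shift_laplace_def)
qed

lemma AE_inner_le:
  "AE w in lborel. exp_weight p w * ennreal (rate_cdf \<alpha> \<beta> n w)
     \<le> exp_weight p w * ennreal (w powr \<alpha>)"
  using AE_lborel_singleton[of "0::real"]
proof eventually_elim
  case (elim w)
  then show ?case
    using rate_cdf_le[of w n] by (cases "w > 0") (auto simp: indicator_def intro!: mult_left_mono ennreal_leI)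
qed

lemma AE_outer_le:
  assumes "s \<ge> 0"
  shows "AE x in lborel. exp_weight l x * cdf_transform \<alpha> \<beta> n (x + s)
    \<le> exp_weight l x * ennreal (Gamma (1 + \<alpha>) * (x + s) powr (- \<alpha>))"
  using AE_lborel_singleton[of "0::real"]
proof eventually_elim
  case (elim x)
  show ?case
  proof (cases "x > 0")
    case True
    then have p: "x + s > 0" using assms by simp
    show ?thesis
      unfolding inner_integral_powr[OF p, symmetric] by (intro mult_left_mono nn_integral_mono_AE AE_inner_le) auto
  qed (use elim in simp)
qed

lemma kill_mean_le:
  assumes "l > 0" "s \<ge> 0"
  shows "kill_mean \<alpha> \<beta> n l s \<le> ennreal (l * Gamma (1 + \<alpha>)) * shift_laplace \<alpha> l s"
  unfolding outer_integral[OF assms, symmetric] kill_mean_def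
  using assms(2) by (intro nn_integral_mono_AE AE_outer_le)

lemma kill_mean_tendsto:
  assumes l: "l > 0" and s: "s \<ge> 0"
  shows "(\<lambda>n. kill_mean \<alpha> \<beta> n l s) \<longlonglongrightarrow> ennreal (l * Gamma (1 + \<alpha>)) * shift_laplace \<alpha> l s"
  unfolding outer_integral[OF assms, symmetric] kill_mean_def
proof (rule nn_integral_dominated_convergence[OF _ _ _ AE_outer_le[OF s]])
  have inner: "(\<lambda>n. cdf_transform \<alpha> \<beta> n p) \<longlonglongrightarrow> ennreal (Gamma (1 + \<alpha>) * p powr (- \<alpha>))"
    if p: "p > 0" for p
    unfolding inner_integral_powr[OF p, symmetric]
  proof (rule nn_integral_dominated_convergence[OF _ _ _ AE_inner_le])
    show "(\<integral>\<^sup>+w. exp_weight p w * ennreal (w powr \<alpha>) \<partial>lborel) < \<infinity>"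
      using inner_integral_powr[OF p] by simp
    show "AE w in lborel. (\<lambda>n. exp_weight p w * ennreal (rate_cdf \<alpha> \<beta> n w))
       \<longlonglongrightarrow> exp_weight p w * ennreal (w powr \<alpha>)"
      using AE_lborel_singleton[of "0::real"]
    proof eventually_elim
      case (elim w)
      then show ?case
        using rate_cdf_tendsto[of w]
        by (cases "w > 0") (auto simp: indicator_def intro!: tendsto_mult_ennreal tendsto_ennrealI)
    qed
  qed measurable
  show "AE x in lborel. (\<lambda>n. exp_weight l x * cdf_transform \<alpha> \<beta> n (x + s))
    \<longlonglongrightarrow> exp_weight l x * ennreal (Gamma (1 + \<alpha>) * (x + s) powr (- \<alpha>))"
    using AE_lborel_singleton[of "0::real"]
  proof eventually_elim
    case (elim x)
    then show ?case
      using inner[of "x + s"] s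
      by (cases "x > 0") (auto simp: indicator_def intro!: tendsto_mult_ennreal)
  qed
  show "(\<integral>\<^sup>+x. exp_weight l x
      * ennreal (Gamma (1 + \<alpha>) * (x + s) powr (- \<alpha>)) \<partial>lborel) < \<infinity>"
    unfolding outer_integral[OF assms] using shift_laplace_finite[OF \<alpha> assms]
    by (simp add: ennreal_mult_less_top)
qed measurable

end

subsection \<open>Concentration and Borel--Cantelli\<close>

lemma exp_le_quadratic:
  fixes u :: real
  assumes "\<bar>u\<bar> \<le> 1"
  shows "exp u \<le> 1 + u + u\<^sup>2"
proof (cases "u \<ge> 0")
  case True
  then show ?thesis using assms by (intro exp_bound) auto
next
  case False
  define v where "v = - u"
  have v: "0 \<le> v" "v \<le> 1" using False assms by (auto simp: v_def)
  have "exp (- v) \<le> 1 / (1 + v)"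
    using exp_ge_add_one_self[of v] v by (simp add: exp_minus divide_simps)
  also have "\<dots> \<le> 1 - v + v\<^sup>2"
  proof -
    have "(1 - v + v\<^sup>2) * (1 + v) = 1 + v ^ 3"
      by (simp add: algebra_simps power2_eq_square power3_eq_cube)
    then show ?thesis using v by (simp add: divide_le_eq)
  qed
  finally show ?thesis by (simp add: v_def)
qed

lemma exp_le_chord:
  fixes c x :: real
  assumes "0 \<le> x" "x \<le> 1"
  shows "exp (c * x) \<le> 1 + x * (exp c - 1)"
  using convex_onD[OF exp_convex assms(1,2), of 0 c] by (simp add: algebra_simps)

lemma (in prob_space) chernoff_bound:
  fixes X :: "'i \<Rightarrow> 'a \<Rightarrow> real"
  assumes I: "finite I" and ind: "indep_vars (\<lambda>_. borel) X I"
    and bdd: "\<And>i. i \<in> I \<Longrightarrow> \<exists>B. \<forall>\<omega>\<in>space M. \<bar>X i \<omega>\<bar> \<le> B"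
    and c: "\<And>i. i \<in> I \<Longrightarrow> expectation (\<lambda>\<omega>. exp (X i \<omega>)) \<le> exp (c i)"
  shows "prob {\<omega> \<in> space M. (\<Sum>i\<in>I. X i \<omega>) \<ge> e} \<le> exp ((\<Sum>i\<in>I. c i) - e)"
proof -
  have rv: "X i \<in> borel_measurable M" if "i \<in> I" for i
    using ind that by (auto simp: indep_vars_def)
  have int: "integrable M (\<lambda>\<omega>. exp (X i \<omega>))" if i: "i \<in> I" for i
  proof -
    obtain B where B: "\<forall>\<omega>\<in>space M. \<bar>X i \<omega>\<bar> \<le> B" using bdd[OF i] by blast
    show ?thesis
    proof (rule integrable_const_bound)
      show "AE \<omega> in M. norm (exp (X i \<omega>)) \<le> exp B"
        using B by (intro AE_I2) (auto simp: abs_le_iff)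
    qed (use rv[OF i] in measurable)
  qed
  have indE: "indep_vars (\<lambda>_. borel) (\<lambda>i \<omega>. exp (X i \<omega>)) I"
    by (rule indep_vars_compose2[OF ind]) measurable
  have "prob {\<omega> \<in> space M. (\<Sum>i\<in>I. X i \<omega>) \<ge> e} = prob {\<omega> \<in> space M. (\<Prod>i\<in>I. exp (X i \<omega>)) \<ge> exp e}"
    using I by (simp add: exp_sum[symmetric])
  also have "\<dots> \<le> expectation (\<lambda>\<omega>. \<Prod>i\<in>I. exp (X i \<omega>)) / exp e"
    using indep_vars_integrable[OF I indE int]
    by (intro integral_Markov_inequality_measure[where A = "{}"]) (auto intro!: prod_nonneg)
  also have "expectation (\<lambda>\<omega>. \<Prod>i\<in>I. exp (X i \<omega>)) = (\<Prod>i\<in>I. expectation (\<lambda>\<omega>. exp (X i \<omega>)))"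
    by (rule indep_vars_lebesgue_integral[OF I indE int])
  also have "\<dots> / exp e \<le> (\<Prod>i\<in>I. exp (c i)) / exp e"
    using c by (intro divide_right_mono prod_mono) (auto intro!: integral_nonneg_AE)
  also have "\<dots> = exp ((\<Sum>i\<in>I. c i) - e)"
    using I by (simp add: exp_sum exp_diff)
  finally show ?thesis .
qed

text \<open>The application has \<theta> a of order n, too large for a quadratic expansion. The
  chord of the exponential over [0,1] at N X / a makes the moment linear in the mean, at the price
  of the factor e^(\<theta> a)/a, which exponentially small means can afford.\<close>

lemma (in prob_space) weighted_sum_tail:
  fixes X :: "'i \<Rightarrow> 'a \<Rightarrow> real"
  assumes I: "finite I" and ind: "indep_vars (\<lambda>_. borel) X I"
    and X: "\<And>i \<omega>. i \<in> I \<Longrightarrow> 0 \<le> X i \<omega> \<and> X i \<omega> \<le> 1"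
    and m: "\<And>i. i \<in> I \<Longrightarrow> expectation (X i) \<le> m"
    and N: "\<And>i. i \<in> I \<Longrightarrow> 0 \<le> N i \<and> N i \<le> a" and a: "a > 0" and "\<theta> > 0"
  shows "prob {\<omega> \<in> space M. (\<Sum>i\<in>I. N i * X i \<omega>) \<ge> e} \<le> exp (m * exp (\<theta> * a) / a * (\<Sum>i\<in>I. N i) - \<theta> * e)"
proof -
  have rv: "X i \<in> borel_measurable M" if "i \<in> I" for i
    using ind that by (auto simp: indep_vars_def)
  have intX: "integrable M (X i)" if "i \<in> I" for i
    using X[OF that] rv[OF that] by (intro integrable_const_bound[of _ 1]) auto
  have "prob {\<omega> \<in> space M. (\<Sum>i\<in>I. N i * X i \<omega>) \<ge> e} = prob {\<omega> \<in> space M. (\<Sum>i\<in>I. \<theta> * N i * X i \<omega>) \<ge> \<theta> * e}"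
    using \<open>\<theta> > 0\<close> by (simp add: mult.assoc sum_distrib_left[symmetric])
  also have "\<dots> \<le> exp ((\<Sum>i\<in>I. m * exp (\<theta> * a) / a * N i) - \<theta> * e)"
  proof (rule chernoff_bound[OF I])
    show "indep_vars (\<lambda>_. borel) (\<lambda>i \<omega>. \<theta> * N i * X i \<omega>) I"
      by (rule indep_vars_compose2[OF ind]) measurable
    fix i assume i: "i \<in> I"
    show "\<exists>B. \<forall>\<omega>\<in>space M. \<bar>\<theta> * N i * X i \<omega>\<bar> \<le> B"
    proof (intro exI ballI)
      fix \<omega>
      have "\<theta> * N i * X i \<omega> \<le> \<theta> * N i * 1"
        using X[OF i] N[OF i] \<open>\<theta> > 0\<close> by (intro mult_left_mono) auto
      moreover have "\<theta> * N i * X i \<omega> \<ge> 0"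
        using X[OF i] N[OF i] \<open>\<theta> > 0\<close> by simp
      ultimately show "\<bar>\<theta> * N i * X i \<omega>\<bar> \<le> \<theta> * N i" by simp
    qed
    have pt: "exp (\<theta> * N i * X i \<omega>) \<le> 1 + N i * exp (\<theta> * a) / a * X i \<omega>" for \<omega>
    proof -
      define x where "x = N i * X i \<omega> / a"
      have "N i * X i \<omega> \<le> a * 1"
        using X[OF i, of \<omega>] N[OF i] a by (intro mult_mono) auto
      then have x: "0 \<le> x" "x \<le> 1"
        using X[OF i, of \<omega>] N[OF i] a by (auto simp: x_def)
      have "exp (\<theta> * a * x) \<le> 1 + x * (exp (\<theta> * a) - 1)"
        by (rule exp_le_chord[OF x])
      also have "\<dots> \<le> 1 + x * exp (\<theta> * a)"
        using x by (intro add_left_mono mult_left_mono) auto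
      finally show ?thesis
        using a by (simp add: x_def mult_ac)
    qed
    have "expectation (\<lambda>\<omega>. exp (\<theta> * N i * X i \<omega>)) \<le> expectation (\<lambda>\<omega>. 1 + N i * exp (\<theta> * a) / a * X i \<omega>)"
    proof (rule integral_mono)
      show "integrable M (\<lambda>\<omega>. exp (\<theta> * N i * X i \<omega>))"
      proof (rule integrable_const_bound)
        show "AE \<omega> in M. norm (exp (\<theta> * N i * X i \<omega>)) \<le> exp (\<theta> * N i * 1)"
          using X[OF i] N[OF i] \<open>\<theta> > 0\<close> by (intro AE_I2) (auto intro!: mult_left_le)
      qed (use rv[OF i] in measurable)
    qed (use intX[OF i] pt in auto)
    also have "\<dots> = 1 + N i * exp (\<theta> * a) / a * expectation (X i)"
      using intX[OF i] by (simp add: prob_space)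
    also have "\<dots> \<le> 1 + N i * exp (\<theta> * a) / a * m"
      using m[OF i] N[OF i] a by (intro add_left_mono mult_left_mono) auto
    also have "\<dots> \<le> exp (m * exp (\<theta> * a) / a * N i)"
      using exp_ge_add_one_self[of "m * exp (\<theta> * a) / a * N i"] by (simp add: mult_ac)
    finally show "expectation (\<lambda>\<omega>. exp (\<theta> * N i * X i \<omega>)) \<le> exp (m * exp (\<theta> * a) / a * N i)" .
  qed
  finally show ?thesis by (simp only: sum_distrib_left)
qed

text \<open>As X^2 <= X, the quadratic term is governed by the mean \<mu> and not merely by 1. This
  matters because the means in question are exponentially small.\<close>

lemma (in prob_space) sum_deviation:
  fixes X :: "'i \<Rightarrow> 'a \<Rightarrow> real"
  assumes I: "finite I" and ind: "indep_vars (\<lambda>_. borel) X I"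
    and X: "\<And>i \<omega>. i \<in> I \<Longrightarrow> 0 \<le> X i \<omega> \<and> X i \<omega> \<le> 1"
    and \<mu>: "\<And>i. i \<in> I \<Longrightarrow> expectation (X i) = \<mu>" and t: "0 < t" "t \<le> 1"
  shows "prob {\<omega> \<in> space M. \<bar>(\<Sum>i\<in>I. X i \<omega>) - real (card I) * \<mu>\<bar> \<ge> e}
      \<le> 2 * exp (real (card I) * \<mu> * t\<^sup>2 - t * e)"
proof -
  have rv[measurable]: "X i \<in> borel_measurable M" if "i \<in> I" for i
    using ind that by (auto simp: indep_vars_def)
  have intX: "integrable M (X i)" if "i \<in> I" for i
    using X[OF that] rv[OF that] by (intro integrable_const_bound[of _ 1]) auto
  have one_sided: "prob {\<omega> \<in> space M. (\<Sum>i\<in>I. u * X i \<omega>) \<ge> e'} \<le> exp ((\<Sum>i\<in>I. u * \<mu> + u\<^sup>2 * \<mu>) - e')"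
    if u: "\<bar>u\<bar> \<le> 1" for u e' :: real
  proof (rule chernoff_bound[OF I])
    show "indep_vars (\<lambda>_. borel) (\<lambda>i \<omega>. u * X i \<omega>) I"
      by (rule indep_vars_compose2[OF ind]) measurable
    fix i assume i: "i \<in> I"
    have bd: "\<bar>u * X i \<omega>\<bar> \<le> 1" for \<omega>
      using mult_mono[of "\<bar>u\<bar>" 1 "\<bar>X i \<omega>\<bar>" 1] X[OF i, of \<omega>] u by (simp add: abs_mult)
    then show "\<exists>B. \<forall>\<omega>\<in>space M. \<bar>u * X i \<omega>\<bar> \<le> B" by blast
    have pt: "exp (u * X i \<omega>) \<le> 1 + (u + u\<^sup>2) * X i \<omega>" for \<omega>
    proof -
      have "X i \<omega> * X i \<omega> \<le> X i \<omega> * 1"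
        using X[OF i, of \<omega>] by (intro mult_left_mono) auto
      then have "u\<^sup>2 * (X i \<omega> * X i \<omega>) \<le> u\<^sup>2 * X i \<omega>"
        by (intro mult_left_mono) auto
      then show ?thesis
        using exp_le_quadratic[OF bd[of \<omega>]] by (simp add: algebra_simps power2_eq_square)
    qed
    have "expectation (\<lambda>\<omega>. exp (u * X i \<omega>)) \<le> expectation (\<lambda>\<omega>. 1 + (u + u\<^sup>2) * X i \<omega>)"
    proof (rule integral_mono)
      show "integrable M (\<lambda>\<omega>. exp (u * X i \<omega>))"
      proof (rule integrable_const_bound)
        show "AE \<omega> in M. norm (exp (u * X i \<omega>)) \<le> exp 1"
          using bd by (intro AE_I2) (auto simp: abs_le_iff)
      qed (use rv[OF i] in measurable)
    qed (use intX[OF i] pt in auto)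
    also have "\<dots> = 1 + (u + u\<^sup>2) * \<mu>"
      using intX[OF i] \<mu>[OF i] by (simp add: prob_space)
    also have "\<dots> \<le> exp (u * \<mu> + u\<^sup>2 * \<mu>)"
      using exp_ge_add_one_self[of "(u + u\<^sup>2) * \<mu>"] by (simp add: algebra_simps)
    finally show "expectation (\<lambda>\<omega>. exp (u * X i \<omega>)) \<le> exp (u * \<mu> + u\<^sup>2 * \<mu>)" .
  qed
  let ?A = "{\<omega> \<in> space M. (\<Sum>i\<in>I. t * X i \<omega>) \<ge> t * (real (card I) * \<mu> + e)}"
  let ?B = "{\<omega> \<in> space M. (\<Sum>i\<in>I. - t * X i \<omega>) \<ge> - t * (real (card I) * \<mu> - e)}"
  have sub: "{\<omega> \<in> space M. \<bar>(\<Sum>i\<in>I. X i \<omega>) - real (card I) * \<mu>\<bar> \<ge> e} \<subseteq> ?A \<union> ?B"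
    using t unfolding sum_distrib_left[symmetric] by (auto simp: abs_if split: if_splits)
  have "prob {\<omega> \<in> space M. \<bar>(\<Sum>i\<in>I. X i \<omega>) - real (card I) * \<mu>\<bar> \<ge> e} \<le> prob (?A \<union> ?B)"
    by (rule finite_measure_mono[OF sub]) measurable
  also have "\<dots> \<le> prob ?A + prob ?B"
    by (rule measure_Un_le) measurable
  also have "prob ?A \<le> exp (real (card I) * \<mu> * t\<^sup>2 - t * e)"
    using one_sided[of t "t * (real (card I) * \<mu> + e)"] t by (simp add: algebra_simps)
  also have "prob ?B \<le> exp (real (card I) * \<mu> * t\<^sup>2 - t * e)"
    using one_sided[of "- t" "- t * (real (card I) * \<mu> - e)"] t by (simp add: algebra_simps)
  finally show ?thesis by simp
qed

lemma (in prob_space) borel_cantelli_tendsto_0: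
  fixes X :: "nat \<Rightarrow> 'a \<Rightarrow> real"
  assumes meas: "\<And>n. n \<ge> 1 \<Longrightarrow> X n \<in> borel_measurable M"
    and g: "\<And>e. e > 0 \<Longrightarrow> \<exists>g. summable g \<and> (\<forall>\<^sub>F n in sequentially. prob {\<omega> \<in> space M. \<bar>X n \<omega>\<bar> \<ge> e} \<le> g n)"
  shows "AE \<omega> in M. (\<lambda>n. X n \<omega>) \<longlonglongrightarrow> 0"
proof -
  have ev: "AE \<omega> in M. \<forall>\<^sub>F n in sequentially. \<bar>X n \<omega>\<bar> < e" if e: "e > 0" for e
  proof -
    \<comment> \<open>Index 0 gets the empty event, since measurability is given from n = 1
      on.\<close>
    define A where "A n = (if n = 0 then {} else {\<omega> \<in> space M. \<bar>X n \<omega>\<bar> \<ge> e})" for n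
    have A: "A n \<in> sets M" for n
    proof (cases "n = 0")
      case False
      then have [measurable]: "X n \<in> borel_measurable M" by (intro meas) simp
      show ?thesis using False by (simp add: A_def)
    qed (simp add: A_def)
    obtain g where g: "summable g" "\<forall>\<^sub>F n in sequentially. prob {\<omega> \<in> space M. \<bar>X n \<omega>\<bar> \<ge> e} \<le> g n"
      using g[OF e] by blast
    have "summable (\<lambda>n. prob (A n))"
    proof (rule summable_comparison_test_ev[OF _ g(1)])
      show "\<forall>\<^sub>F n in sequentially. norm (prob (A n)) \<le> g n"
        using g(2) eventually_gt_at_top[of 0] by eventually_elim (simp add: A_def)
    qed
    then have "AE \<omega> in M. \<forall>\<^sub>F n in sequentially. \<omega> \<in> space M - A n"
      by (intro borel_cantelli_AE1 A) (auto simp: emeasure_eq_measure)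
    then show ?thesis
    proof eventually_elim
      case (elim \<omega>)
      then show ?case
        using eventually_gt_at_top[of 0] by eventually_elim (auto simp: A_def)
    qed
  qed
  have "AE \<omega> in M. \<forall>j::nat. \<forall>\<^sub>F n in sequentially. \<bar>X n \<omega>\<bar> < 1 / real (Suc j)"
    by (subst AE_all_countable) (auto intro!: ev)
  then show ?thesis
  proof eventually_elim
    case (elim \<omega>)
    show ?case
    proof (rule tendstoI)
      fix e :: real assume "e > 0"
      then obtain j where j: "1 / real (Suc j) < e" using nat_approx_posE by blast
      have "\<forall>\<^sub>F n in sequentially. \<bar>X n \<omega>\<bar> < 1 / real (Suc j)" using elim by blast
      then show "\<forall>\<^sub>F n in sequentially. dist (X n \<omega>) 0 < e"
        by eventually_elim (use j in auto)
    qed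
  qed
qed

subsection \<open>The random environment\<close>

locale random_energy = prob_space M for M :: "'w measure" +
  fixes E :: "nat \<Rightarrow> (nat \<Rightarrow> int) \<Rightarrow> 'w \<Rightarrow> real" and \<alpha> \<beta> :: real
  assumes \<alpha>: "0 < \<alpha>" "\<alpha> < 1" and \<beta>: "0 < \<beta>"
    and subcritical: "\<alpha>\<^sup>2 * \<beta>\<^sup>2 / (2 * ln 2) < 1"
    and E_meas: "\<And>n x. n \<ge> 1 \<Longrightarrow> x \<in> hcube n \<Longrightarrow> E n x \<in> borel_measurable M"
    and E_indep: "\<And>n. n \<ge> 1 \<Longrightarrow> indep_vars (\<lambda>_. borel) (E n) (hcube n)"
    and E_law: "\<And>n x u. n \<ge> 1 \<Longrightarrow> x \<in> hcube n \<Longrightarrow> u \<ge> 0 \<Longrightarrow>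
           prob {\<omega> \<in> space M. - E n x \<omega> / sqrt (real n) \<ge> u} = exp (- (u\<^sup>2) / 2)"
begin

definition b :: real where "b = \<alpha>\<^sup>2 * \<beta>\<^sup>2 / 2"

lemma b_pos: "b > 0"
  using \<alpha> \<beta> by (simp add: b_def)

lemma b_less: "b < ln 2"
  using subcritical by (simp add: b_def field_simps)

definition rate :: "nat \<Rightarrow> 'w \<Rightarrow> (nat \<Rightarrow> int) \<Rightarrow> real" where
  "rate n \<omega> x = exp (\<alpha> * \<beta>\<^sup>2 * real n) / trap \<beta> (\<lambda>x. E n x \<omega>) x"

lemma rate_eq: "rate n \<omega> x = exp (\<alpha> * \<beta>\<^sup>2 * real n + \<beta> * E n x \<omega>)"
  by (simp add: rate_def trap_def exp_add exp_minus field_simps)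

lemma rate_pos: "rate n \<omega> x > 0"
  by (simp add: rate_eq)

lemma rate_measurable: "n \<ge> 1 \<Longrightarrow> x \<in> hcube n \<Longrightarrow> (\<lambda>\<omega>. rate n \<omega> x) \<in> borel_measurable M"
  unfolding rate_eq using E_meas[of n x] by measurable

text \<open>Taking logarithms turns the event into \<open>- E / sqrt n \<ge> u\<close>. For
  nonnegative \<open>u\<close>, expanding u^2/2 gives bn - a L + L^2/(2 \<beta>^2 n) with a =
  \<open>\<alpha>\<close> and L = ln w. For negative \<open>u\<close> the event contains the one at
  threshold 0, which already has probability 1.\<close>

lemma rate_law:
  assumes n: "n \<ge> 1" and x: "x \<in> hcube n" and w: "w > 0"
  shows "emeasure M {\<omega> \<in> space M. rate n \<omega> x \<le> w} = ennreal (exp (- (b * real n)) * rate_cdf \<alpha> \<beta> n w)"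
proof -
  define L where "L = ln w"
  define u where "u = (\<alpha> * \<beta>\<^sup>2 * real n - L) / (\<beta> * sqrt (real n))"
  have rn: "sqrt (real n) > 0" using n by simp
  have [measurable]: "E n x \<in> borel_measurable M" using E_meas[OF n x] .
  have iff: "rate n \<omega> x \<le> w \<longleftrightarrow> - E n x \<omega> / sqrt (real n) \<ge> u" for \<omega>
  proof -
    have "rate n \<omega> x \<le> w \<longleftrightarrow> \<alpha> * \<beta>\<^sup>2 * real n + \<beta> * E n x \<omega> \<le> L"
      unfolding rate_eq L_def using w by (metis exp_le_cancel_iff exp_ln)
    also have "\<dots> \<longleftrightarrow> - E n x \<omega> / sqrt (real n) \<ge> u"
    proof -
      have "u = ((\<alpha> * \<beta>\<^sup>2 * real n - L) / \<beta>) / sqrt (real n)"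
        by (simp add: u_def)
      then have "u \<le> - E n x \<omega> / sqrt (real n) \<longleftrightarrow> (\<alpha> * \<beta>\<^sup>2 * real n - L) / \<beta> \<le> - E n x \<omega>"
        using rn by (simp only: divide_le_cancel) auto
      also have "\<dots> \<longleftrightarrow> \<alpha> * \<beta>\<^sup>2 * real n - L \<le> - E n x \<omega> * \<beta>"
        using \<beta> by (simp only: pos_divide_le_eq)
      finally show ?thesis by (simp add: algebra_simps)
    qed
    finally show ?thesis .
  qed
  have "prob {\<omega> \<in> space M. rate n \<omega> x \<le> w} = exp (- (b * real n)) * rate_cdf \<alpha> \<beta> n w"
  proof (cases "L \<le> \<alpha> * \<beta>\<^sup>2 * real n")
    case True
    then have u0: "u \<ge> 0" using \<beta> rn by (simp add: u_def)
    have "u = \<alpha> * \<beta> * sqrt (real n) - L / (\<beta> * sqrt (real n))"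
      using \<beta> rn by (simp add: u_def field_simps power2_eq_square)
    then have "u\<^sup>2 = \<alpha>\<^sup>2 * \<beta>\<^sup>2 * real n - 2 * \<alpha> * L + L\<^sup>2 / (\<beta>\<^sup>2 * real n)"
      using \<beta> n by (simp add: power2_diff power_mult_distrib power_divide)
    then have "- (u\<^sup>2) / 2 = - (b * real n) + (\<alpha> * L - L\<^sup>2 / (2 * \<beta>\<^sup>2 * real n))"
      by (simp add: b_def field_simps)
    then have "exp (- (u\<^sup>2) / 2) = exp (- (b * real n)) * exp (\<alpha> * L - L\<^sup>2 / (2 * \<beta>\<^sup>2 * real n))"
      by (simp only: exp_add)
    then have "exp (- (u\<^sup>2) / 2) = exp (- (b * real n)) * rate_cdf \<alpha> \<beta> n w"
      using True by (simp add: rate_cdf_def L_def)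
    then show ?thesis
      using E_law[OF n x u0] by (simp add: iff)
  next
    case False
    then have u0: "u \<le> 0" using \<beta> rn by (simp add: u_def divide_nonpos_pos)
    have "1 = prob {\<omega> \<in> space M. - E n x \<omega> / sqrt (real n) \<ge> 0}"
      using E_law[OF n x, of 0] by simp
    also have "\<dots> \<le> prob {\<omega> \<in> space M. rate n \<omega> x \<le> w}"
      unfolding iff using u0 by (intro finite_measure_mono) (auto, measurable)
    finally have "prob {\<omega> \<in> space M. rate n \<omega> x \<le> w} = 1"
      by (simp add: antisym)
    then show ?thesis
      using False by (simp add: rate_cdf_def L_def b_def exp_minus)
  qed
  then show ?thesis by (simp add: emeasure_eq_measure)
qed

definition killing :: "nat \<Rightarrow> real \<Rightarrow> 'w \<Rightarrow> (nat \<Rightarrow> int) \<Rightarrow> real" where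
  "killing n l \<omega> x = l / (l + rate n \<omega> x)"

definition reward :: "nat \<Rightarrow> real \<Rightarrow> real \<Rightarrow> 'w \<Rightarrow> (nat \<Rightarrow> int) \<Rightarrow> real" where
  "reward n l s \<omega> x = killing n l \<omega> x * exp (- rate n \<omega> x * s)"

lemma reward_0: "reward n l 0 = killing n l"
  by (simp add: reward_def fun_eq_iff)

lemma killing_bounds: "l > 0 \<Longrightarrow> 0 < killing n l \<omega> x \<and> killing n l \<omega> x \<le> 1"
  using rate_pos[of n \<omega> x] by (auto simp: killing_def intro!: divide_pos_pos add_pos_pos)

lemma reward_bounds:
  assumes "l > 0" "s \<ge> 0"
  shows "0 \<le> reward n l s \<omega> x \<and> reward n l s \<omega> x \<le> 1"
  using killing_bounds[OF assms(1), of n \<omega> x] rate_pos[of n \<omega> x] assms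
  by (auto simp: reward_def intro!: mult_le_one)

lemma reward_measurable:
  "n \<ge> 1 \<Longrightarrow> x \<in> hcube n \<Longrightarrow> (\<lambda>\<omega>. reward n l s \<omega> x) \<in> borel_measurable M"
  unfolding reward_def killing_def using rate_measurable[of n x] by measurable

lemma reward_indep:
  "n \<ge> 1 \<Longrightarrow> indep_vars (\<lambda>_. borel) (\<lambda>x \<omega>. reward n l s \<omega> x) (hcube n)"
  unfolding reward_def killing_def rate_eq
  by (rule indep_vars_compose2[OF E_indep, where Y = "\<lambda>_ e. l / (l + exp (\<alpha> * \<beta>\<^sup>2 * real n + \<beta> * e))
        * exp (- exp (\<alpha> * \<beta>\<^sup>2 * real n + \<beta> * e) * s)"]) measurable

definition mean_reward :: "nat \<Rightarrow> real \<Rightarrow> real \<Rightarrow> real" where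
  "mean_reward n l s = exp (- (b * real n)) * enn2real (kill_mean \<alpha> \<beta> n l s)"

definition reward_limit :: "real \<Rightarrow> real \<Rightarrow> real" where
  "reward_limit l s = l * Gamma (1 + \<alpha>) * enn2real (shift_laplace \<alpha> l s)"

text \<open>First \<open>kill_laplace\<close> writes the reward as a mixture of exponentials of the
  rate, then \<open>nn_integral_exp_neg_cdf\<close> evaluates the mean of each.\<close>

lemma nn_integral_reward:
  assumes n: "n \<ge> 1" and x: "x \<in> hcube n" and l: "l > 0" and s: "s \<ge> 0"
  shows "(\<integral>\<^sup>+\<omega>. ennreal (reward n l s \<omega> x) \<partial>M) = ennreal (exp (- (b * real n))) * kill_mean \<alpha> \<beta> n l s"
proof -
  interpret pair_sigma_finite M lborel ..
  have [measurable]: "(\<lambda>\<omega>. rate n \<omega> x) \<in> borel_measurable M"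
    using rate_measurable[OF n x] .
  have "(\<integral>\<^sup>+\<omega>. ennreal (reward n l s \<omega> x) \<partial>M) = (\<integral>\<^sup>+\<omega>. \<integral>\<^sup>+y. exp_weight l y
      * ennreal (exp (- ((y + s) * rate n \<omega> x))) \<partial>lborel \<partial>M)"
    unfolding reward_def killing_def using l rate_pos by (intro nn_integral_cong kill_laplace)
  also have "\<dots> = (\<integral>\<^sup>+y. \<integral>\<^sup>+\<omega>. exp_weight l y
      * ennreal (exp (- ((y + s) * rate n \<omega> x))) \<partial>M \<partial>lborel)"
    by (rule Fubini'[symmetric]) measurable
  also have "\<dots> = (\<integral>\<^sup>+y. ennreal (exp (- (b * real n))) * (exp_weight l y * cdf_transform \<alpha> \<beta> n (y + s)) \<partial>lborel)"
  proof (rule nn_integral_cong_AE)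
    show "AE y in lborel. (\<integral>\<^sup>+\<omega>. exp_weight l y
      * ennreal (exp (- ((y + s) * rate n \<omega> x))) \<partial>M) = ennreal (exp (- (b * real n))) *
        (exp_weight l y * cdf_transform \<alpha> \<beta> n (y + s))"
      using AE_lborel_singleton[of "0::real"]
    proof eventually_elim
      case (elim y)
      show ?case
      proof (cases "y > 0")
        case True
        have "(\<integral>\<^sup>+\<omega>. ennreal (exp (- ((y + s) * rate n \<omega> x))) \<partial>M)
          = (\<integral>\<^sup>+w. exp_weight (y + s) w
               * ennreal (exp (- (b * real n)) * rate_cdf \<alpha> \<beta> n w) \<partial>lborel)"
          using True s rate_pos rate_law[OF n x] by (intro nn_integral_exp_neg_cdf) auto
        also have "\<dots> = (\<integral>\<^sup>+w. ennreal (exp (- (b * real n))) * (exp_weight (y + s) w * ennreal (rate_cdf \<alpha> \<beta> n w)) \<partial>lborel)"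
          by (intro nn_integral_cong, subst ennreal_mult'[of "exp (- (b * real n))"]) (auto simp: mult_ac)
        also have "\<dots> = ennreal (exp (- (b * real n))) * cdf_transform \<alpha> \<beta> n (y + s)"
          by (rule nn_integral_cmult) measurable
        finally show ?thesis
          by (subst nn_integral_cmult) (auto simp: mult_ac)
      qed (use elim in simp)
    qed
  qed
  also have "\<dots> = ennreal (exp (- (b * real n))) * kill_mean \<alpha> \<beta> n l s"
    unfolding kill_mean_def by (rule nn_integral_cmult) measurable
  finally show ?thesis .
qed

lemma expectation_reward:
  assumes "n \<ge> 1" "x \<in> hcube n" "l > 0" "s \<ge> 0"
  shows "expectation (\<lambda>\<omega>. reward n l s \<omega> x) = mean_reward n l s"
proof -
  have "expectation (\<lambda>\<omega>. reward n l s \<omega> x) = enn2real (\<integral>\<^sup>+\<omega>. ennreal (reward n l s \<omega> x) \<partial>M)"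
    using reward_bounds[OF assms(3,4)] reward_measurable[OF assms(1,2)]
    by (intro integral_eq_nn_integral) auto
  then show ?thesis
    by (simp add: nn_integral_reward[OF assms] mean_reward_def enn2real_mult)
qed

text \<open>The tail estimates need the order e^(-bn) of the means with an explicit constant for
  every n, which the limit alone does not provide.\<close>

lemma mean_reward_le:
  assumes "l > 0" "s \<ge> 0"
  shows "mean_reward n l s \<le> reward_limit l s * exp (- (b * real n))"
proof -
  have G: "Gamma (1 + \<alpha>) > 0" using \<alpha> by (intro Gamma_real_pos) simp
  have "enn2real (kill_mean \<alpha> \<beta> n l s) \<le> enn2real (ennreal (l * Gamma (1 + \<alpha>)) * shift_laplace \<alpha> l s)"
    using kill_mean_le[OF \<alpha> \<beta> assms] shift_laplace_finite[OF \<alpha> assms]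
    by (intro enn2real_mono) (auto simp: ennreal_mult_less_top)
  also have "\<dots> = reward_limit l s"
    using G assms by (simp add: reward_limit_def enn2real_mult)
  finally show ?thesis by (simp add: mean_reward_def mult.commute)
qed

lemma mean_reward_tendsto:
  assumes "l > 0" "s \<ge> 0"
  shows "(\<lambda>n. exp (b * real n) * mean_reward n l s) \<longlonglongrightarrow> reward_limit l s"
proof -
  have G: "Gamma (1 + \<alpha>) > 0" using \<alpha> by (intro Gamma_real_pos) simp
  have "(\<lambda>n. enn2real (kill_mean \<alpha> \<beta> n l s)) \<longlonglongrightarrow> enn2real (ennreal (l * Gamma (1 + \<alpha>)) * shift_laplace \<alpha> l s)"
    using kill_mean_tendsto[OF \<alpha> \<beta> assms] shift_laplace_finite[OF \<alpha> assms]
    by (intro tendsto_enn2real) (auto simp: ennreal_mult_less_top)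
  moreover have "exp (b * real n) * mean_reward n l s = enn2real (kill_mean \<alpha> \<beta> n l s)" for n
    by (simp add: mean_reward_def exp_minus)
  ultimately show ?thesis
    using G assms by (simp add: reward_limit_def enn2real_mult)
qed

lemma reward_limit_0_pos: "l > 0 \<Longrightarrow> reward_limit l 0 > 0"
  using \<alpha> Gamma_real_pos[of "1 + \<alpha>"] Gamma_real_pos[of "1 - \<alpha>"]
  by (simp add: reward_limit_def shift_laplace_0)

lemma reward_limit_nonneg: "l > 0 \<Longrightarrow> reward_limit l s \<ge> 0"
  using \<alpha> Gamma_real_pos[of "1 + \<alpha>"] by (simp add: reward_limit_def)

section \<open>Almost sure limits in the environment\<close>

lemma summable_exp_neg: "c > 0 \<Longrightarrow> summable (\<lambda>n. exp (- (c * real n)))"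
  using summable_geometric[of "exp (- c)"] by (simp add: exp_of_nat_mult[symmetric] mult.commute)

text \<open>The error in \<open>homogenization\<close> contains \<open>k\<close> at the starting
  point. It is a single site, so Markov's inequality with a mean of order e^(-bn) gives summable
  probabilities.\<close>

lemma killing_at_start:
  assumes l: "l > 0"
  shows "AE \<omega> in M. (\<lambda>n. killing n l \<omega> (hcube_one n)) \<longlonglongrightarrow> 0"
proof (rule borel_cantelli_tendsto_0)
  show "(\<lambda>\<omega>. killing n l \<omega> (hcube_one n)) \<in> borel_measurable M" if "n \<ge> 1" for n
    using reward_measurable[OF that hcube_one_in, of l 0] by (simp add: reward_0)
  fix e :: real assume e: "e > 0"
  define g where "g n = reward_limit l 0 * exp (- (b * real n)) / e" for n
  have "summable g"
    unfolding g_def by (intro summable_divide summable_mult summable_exp_neg b_pos)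
  moreover have "\<forall>\<^sub>F n in sequentially. prob {\<omega> \<in> space M. \<bar>killing n l \<omega> (hcube_one n)\<bar> \<ge> e} \<le> g n"
    using eventually_ge_at_top[of 1]
  proof eventually_elim
    case (elim n)
    have eq: "killing n l \<omega> (hcube_one n) = reward n l 0 \<omega> (hcube_one n)" for \<omega>
      by (simp add: reward_0)
    have abs: "\<bar>killing n l \<omega> (hcube_one n)\<bar> = killing n l \<omega> (hcube_one n)" for \<omega>
      using killing_bounds[OF l, of n \<omega> "hcube_one n"] by simp
    have "prob {\<omega> \<in> space M. killing n l \<omega> (hcube_one n) \<ge> e} \<le> expectation (\<lambda>\<omega>. killing n l \<omega> (hcube_one n)) / e"
    proof (rule integral_Markov_inequality_measure[where A = "{}"])
      show "integrable M (\<lambda>\<omega>. killing n l \<omega> (hcube_one n))"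
        unfolding eq using reward_bounds[OF l, of 0 n] reward_measurable[OF elim hcube_one_in]
        by (intro integrable_const_bound[of _ 1]) auto
    qed (use killing_bounds[OF l] e in \<open>auto simp: less_imp_le\<close>)
    also have "expectation (\<lambda>\<omega>. killing n l \<omega> (hcube_one n)) = mean_reward n l 0"
      unfolding eq using elim hcube_one_in l by (intro expectation_reward) auto
    also have "\<dots> / e \<le> g n"
      unfolding g_def using mean_reward_le[OF l, of 0 n] e by (intro divide_right_mono) auto
    finally show ?case by (simp add: abs)
  qed
  ultimately show "\<exists>g. summable g \<and> (\<forall>\<^sub>F n in sequentially. prob {\<omega> \<in> space M. \<bar>killing n l \<omega> (hcube_one n)\<bar> \<ge> e} \<le> g n)"
    by blast
qed

lemma two_power_exp: "2 ^ n * exp (- (b * real n)) = exp ((ln 2 - b) * real n)"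
proof -
  have "(2::real) ^ n = exp (ln 2 * real n)"
    by (simp add: exp_of_nat2_mult)
  then show ?thesis by (simp add: mult_exp_exp algebra_simps)
qed

text \<open>The sum over the cube has mean of order 2^n e^(-bn) = e^((ln 2 - b) n). A deviation by a
  fixed multiple of this is exponentially unlikely in the same quantity, which diverges as b < ln
  2.\<close>

lemma cube_mean_reward:
  assumes l: "l > 0" and s: "s \<ge> 0"
  shows "AE \<omega> in M. (\<lambda>n. exp (b * real n) * cube_mean n (reward n l s \<omega>)) \<longlonglongrightarrow> reward_limit l s"
proof -
  let ?X = "\<lambda>n \<omega>. exp (b * real n) * (cube_mean n (reward n l s \<omega>) - mean_reward n l s)"
  have "AE \<omega> in M. (\<lambda>n. ?X n \<omega>) \<longlonglongrightarrow> 0"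
  proof (rule borel_cantelli_tendsto_0)
    show "(\<lambda>\<omega>. ?X n \<omega>) \<in> borel_measurable M"
      if "n \<ge> 1" for n
      unfolding cube_mean_def using reward_measurable[OF that, of _ l s] by measurable
    fix e :: real assume e: "e > 0"
    define C where "C = reward_limit l s + 1"
    have C: "C > 0" using reward_limit_nonneg[OF l, of s] by (simp add: C_def)
    \<comment> \<open>Ensures C t <= e/2, so that the quadratic term of the exponent uses up at most
      half of the linear gain.\<close>
    define t where "t = min 1 (e / (2 * C))"
    have t: "0 < t" "t \<le> 1" "t \<le> e / (2 * C)" using e C by (auto simp: t_def)
    define d where "d = t * e / 2 * (ln 2 - b)"
    have d: "d > 0" using t e b_less by (simp add: d_def)
    have "\<forall>\<^sub>F n in sequentially. prob {\<omega> \<in> space M. \<bar>?X n \<omega>\<bar> \<ge> e}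
        \<le> 2 * exp (- (d * real n))"
      using eventually_ge_at_top[of 1]
    proof eventually_elim
      case (elim n)
      define q where "q = exp (- (b * real n))"
      have q: "q > 0" "exp (b * real n) * q = 1" by (auto simp: q_def exp_minus)
      have iff: "e \<le> \<bar>?X n \<omega>\<bar>
          \<longleftrightarrow> 2 ^ n * q * e \<le> \<bar>(\<Sum>x\<in>hcube n. reward n l s \<omega> x) - real (card (hcube n)) * mean_reward n l s\<bar>" for \<omega>
      proof -
        have "(\<Sum>x\<in>hcube n. reward n l s \<omega> x) - real (card (hcube n)) * mean_reward n l s
          = 2 ^ n * q * (?X n \<omega>)"
        proof -
          have "2 ^ n * q * (exp (b * real n) * X) = 2 ^ n * X" for X
            using q(2) by (simp add: mult.assoc mult.left_commute[of q])
          moreover have "(\<Sum>x\<in>hcube n. reward n l s \<omega> x) - real (card (hcube n)) * mean_reward n l s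
              = 2 ^ n * (cube_mean n (reward n l s \<omega>) - mean_reward n l s)"
            by (simp add: cube_mean_def card_hcube right_diff_distrib)
          ultimately show ?thesis by (simp only:)
        qed
        then have "\<bar>(\<Sum>x\<in>hcube n. reward n l s \<omega> x) - real (card (hcube n)) * mean_reward n l s\<bar>
          = 2 ^ n * q * \<bar>?X n \<omega>\<bar>"
          using q by (simp add: abs_mult)
        then show ?thesis using q by simp
      qed
      have "prob {\<omega> \<in> space M. \<bar>?X n \<omega>\<bar> \<ge> e}
         \<le> 2 * exp (real (card (hcube n)) * mean_reward n l s * t\<^sup>2 - t * (2 ^ n * q * e))"
        unfolding iff using elim reward_bounds[OF l s] expectation_reward[OF elim _ l s] t
        by (intro sum_deviation reward_indep) auto
      also have "\<dots> \<le> 2 * exp (- (d * real n))"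
      proof -
        have "mean_reward n l s \<le> C * q"
          using mean_reward_le[OF l s, of n] q(1) unfolding C_def distrib_right q_def[symmetric] by linarith
        then have "2 ^ n * mean_reward n l s * t\<^sup>2 \<le> 2 ^ n * (C * q) * t\<^sup>2"
          by (intro mult_right_mono mult_left_mono) auto
        also have "\<dots> = 2 ^ n * q * t * (C * t)"
          by (simp add: power2_eq_square)
        also have "\<dots> \<le> 2 ^ n * q * t * (e / 2)"
          using t C q by (intro mult_left_mono) (auto simp: field_simps)
        finally have "2 ^ n * mean_reward n l s * t\<^sup>2 - t * (2 ^ n * q * e) \<le> - (t * e / 2 * (2 ^ n * q))"
          by (simp add: algebra_simps)
        \<comment> \<open>A linear lower bound on the exponential growth is enough for
          summability.\<close>
        also have "(ln 2 - b) * real n \<le> 2 ^ n * q"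
          unfolding q_def two_power_exp using exp_ge_add_one_self[of "(ln 2 - b) * real n"] by linarith
        then have "- (t * e / 2 * (2 ^ n * q)) \<le> - (t * e / 2 * ((ln 2 - b) * real n))"
          using t e by (intro le_imp_neg_le mult_left_mono) auto
        finally show ?thesis
          by (simp add: d_def card_hcube mult.assoc)
      qed
      finally show ?case .
    qed
    moreover have "summable (\<lambda>n. 2 * exp (- (d * real n)))"
      by (intro summable_mult summable_exp_neg d)
    ultimately show "\<exists>g. summable g \<and> (\<forall>\<^sub>F n in sequentially. prob {\<omega> \<in> space M.
        \<bar>?X n \<omega>\<bar> \<ge> e} \<le> g n)"
      by blast
  qed
  then show ?thesis
  proof eventually_elim
    case (elim \<omega>)
    from tendsto_add[OF this mean_reward_tendsto[OF assms]] show ?case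
      by (simp add: algebra_simps)
  qed
qed

definition max_excess :: "nat \<Rightarrow> real \<Rightarrow> 'w \<Rightarrow> real" where
  "max_excess n l \<omega> = Max ((\<lambda>y. green_excess n (killing n l \<omega>) y) ` hcube n)"

lemma green_excess_le_max: "y \<in> hcube n \<Longrightarrow> green_excess n (killing n l \<omega>) y \<le> max_excess n l \<omega>"
  by (simp add: max_excess_def)

text \<open>A union bound over 2^n sites. At each site the weights are at most 10/n and sum to
  O(n^2), while the killing probabilities have mean O(e^(-bn)); the resulting exponent is of order
  -n^2.\<close>

lemma max_excess_tendsto:
  assumes l: "l > 0"
  shows "AE \<omega> in M. (\<lambda>n. max_excess n l \<omega>) \<longlonglongrightarrow> 0"
proof (rule borel_cantelli_tendsto_0)
  let ?g = "\<lambda>n \<omega>. green_excess n (killing n l \<omega>)"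
  have ge_meas: "(\<lambda>\<omega>. ?g n \<omega> y) \<in> borel_measurable M" if "n \<ge> 1" for n y
    unfolding green_excess_def using reward_measurable[OF that, of _ l 0] by (simp add: reward_0)
  show "max_excess n l \<in> borel_measurable M" if "n \<ge> 1" for n
    unfolding max_excess_def[abs_def] using ge_meas[OF that] by (intro borel_measurable_Max) auto
  fix e :: real assume e: "e > 0"
  define C where "C = reward_limit l 0"
  have C: "C > 0" using reward_limit_0_pos[OF l] by (simp add: C_def)
  \<comment> \<open>The exponent for one site: mean bound C e^(-bn), moment factor e^(bn/2), inverse
    weight bound n/10 and total weight 2n^2 + 1, minus \<open>\<theta> * e\<close>.\<close>
  define h where "h n = C * exp (- (b * real n / 2)) * (real n / 10) * (2 * real n ^ 2 + 1) - b * e / 20 * real n ^ 2" for n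
  have "\<forall>\<^sub>F n in sequentially. ln 2 * real n + h n \<le> - (1 * real n)"
    unfolding h_def using C b_pos e by real_asymp
  then have "\<forall>\<^sub>F n in sequentially. prob {\<omega> \<in> space M. \<bar>max_excess n l \<omega>\<bar> \<ge> e} \<le> exp (- (1 * real n))"
    using eventually_ge_at_top[of 1]
  proof eventually_elim
    case (elim n)
    then have n: "n \<ge> 1" by simp
    define N where "N y x = \<bar>cube_green n y x - (if y = x then 1 else 0)\<bar>" for y x
    define a where "a = 10 / real n"
    \<comment> \<open>Chosen so that \<open>\<theta> * a\<close> is half of b n: the means stay
      exponentially small after the moment factor, and \<open>\<theta> * e\<close> is still
      quadratic in n.\<close>
    define \<theta> where "\<theta> = b * real n ^ 2 / 20"
    have a: "a > 0" and \<theta>: "\<theta> > 0" using n b_pos by (auto simp: a_def \<theta>_def)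
    have \<theta>a: "\<theta> * a = b * real n / 2"
      using n by (simp add: \<theta>_def a_def power2_eq_square)
    have one: "prob {\<omega> \<in> space M. ?g n \<omega> y \<ge> e} \<le> exp (h n)" if y: "y \<in> hcube n" for y
    proof -
      have "prob {\<omega> \<in> space M. ?g n \<omega> y \<ge> e}
          = prob {\<omega> \<in> space M. (\<Sum>x\<in>hcube n. N y x * reward n l 0 \<omega> x) \<ge> e}"
        by (simp add: green_excess_def N_def reward_0)
      also have "\<dots> \<le> exp (C * exp (- (b * real n)) * exp (\<theta> * a) / a * (\<Sum>x\<in>hcube n. N y x) - \<theta> * e)"
      proof (rule weighted_sum_tail)
        show "expectation (\<lambda>\<omega>. reward n l 0 \<omega> x) \<le> C * exp (- (b * real n))" if "x \<in> hcube n" for x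
          using expectation_reward[OF n that l, of 0] mean_reward_le[OF l, of 0 n] by (simp add: C_def)
        show "0 \<le> N y x \<and> N y x \<le> a" if "x \<in> hcube n" for x
          using cube_green_near_identity[OF y that n] by (simp add: N_def a_def)
      qed (use reward_bounds[OF l, of 0 n] reward_indep[OF n] a \<theta> in auto)
      also have "\<dots> \<le> exp (h n)"
      proof -
        have le: "C * exp (- (b * real n)) * exp (\<theta> * a) / a * (\<Sum>x\<in>hcube n. N y x)
            \<le> C * exp (- (b * real n)) * exp (\<theta> * a) / a * (2 * real n ^ 2 + 1)"
          using sum_abs_cube_green[OF y n] C a unfolding N_def by (intro mult_left_mono) auto
        have "exp (- (b * real n)) * exp (\<theta> * a) = exp (- (b * real n / 2))"
          unfolding \<theta>a by (simp add: mult_exp_exp)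
        then have eq: "C * exp (- (b * real n)) * exp (\<theta> * a) / a = C * exp (- (b * real n / 2)) * (real n / 10)"
          by (simp add: a_def mult.assoc)
        have "\<theta> * e = b * e / 20 * real n ^ 2" by (simp add: \<theta>_def)
        then show ?thesis
          using le unfolding eq h_def exp_le_cancel_iff by linarith
      qed
      finally show ?thesis .
    qed
    have abs: "\<bar>max_excess n l \<omega>\<bar> = max_excess n l \<omega>" for \<omega>
    proof -
      have "0 \<le> ?g n \<omega> (hcube_one n)"
        unfolding green_excess_def using killing_bounds[OF l]
        by (intro sum_nonneg mult_nonneg_nonneg) (auto simp: less_imp_le)
      then show ?thesis
        using green_excess_le_max[OF hcube_one_in, of n l \<omega>] by simp
    qed
    have "max_excess n l \<omega> \<ge> e \<longleftrightarrow> (\<exists>y\<in>hcube n. ?g n \<omega> y \<ge> e)" for \<omega>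
      unfolding max_excess_def using hcube_one_in[of n] by (subst Max_ge_iff) auto
    then have "{\<omega> \<in> space M. \<bar>max_excess n l \<omega>\<bar> \<ge> e}
        = (\<Union>y\<in>hcube n. {\<omega> \<in> space M. ?g n \<omega> y \<ge> e})"
      unfolding abs by auto
    then have "prob {\<omega> \<in> space M. \<bar>max_excess n l \<omega>\<bar> \<ge> e}
        \<le> (\<Sum>y\<in>hcube n. prob {\<omega> \<in> space M. ?g n \<omega> y \<ge> e})"
      using ge_meas[OF n] by (auto intro!: finite_measure_subadditive_finite)
    also have "\<dots> \<le> (\<Sum>y\<in>hcube n. exp (h n))"
      using one by (intro sum_mono)
    also have "\<dots> = exp (ln 2 * real n + h n)"
      by (simp add: card_hcube exp_add exp_of_nat2_mult)
    also have "\<dots> \<le> exp (- (1 * real n))"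
      using elim by simp
    finally show ?case .
  qed
  then show "\<exists>g. summable g \<and> (\<forall>\<^sub>F n in sequentially. prob {\<omega> \<in> space M. \<bar>max_excess n l \<omega>\<bar> \<ge> e} \<le> g n)"
    by (intro exI[of _ "\<lambda>n. exp (- (1 * real n))"] conjI summable_exp_neg) auto
qed

end

subsection \<open>Inverting the Laplace transform\<close>

lemma (in prob_space) integrable_continuous_unit:
  fixes X :: "'a \<Rightarrow> real"
  assumes [measurable]: "X \<in> borel_measurable M" "\<rho> \<in> borel_measurable M"
    and X: "AE \<omega> in M. 0 \<le> X \<omega> \<and> X \<omega> \<le> 1"
    and \<rho>: "\<And>\<omega>. 0 \<le> \<rho> \<omega> \<and> \<rho> \<omega> \<le> (1::real)"
    and g: "continuous_on UNIV g"
  shows "integrable M (\<lambda>\<omega>. g (X \<omega>) * \<rho> \<omega>)"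
proof -
  have [measurable]: "g \<in> borel_measurable borel"
    using g by (rule borel_measurable_continuous_onI)
  have "compact (g ` {0..1})"
    using g by (intro compact_continuous_image continuous_on_subset[OF g]) auto
  then have "\<exists>B. \<forall>x\<in>{0..1}. \<bar>g x\<bar> \<le> B"
    by (auto dest!: compact_imp_bounded simp: bounded_real)
  then obtain B where B: "\<And>x. x \<in> {0..1} \<Longrightarrow> \<bar>g x\<bar> \<le> B"
    by blast
  show ?thesis
  proof (rule integrable_const_bound)
    show "AE \<omega> in M. norm (g (X \<omega>) * \<rho> \<omega>) \<le> B * 1"
      using X
    proof eventually_elim
      case (elim \<omega>)
      then show ?case
        using B[of "X \<omega>"] \<rho>[of \<omega>] unfolding real_norm_def abs_mult by (intro mult_mono) auto
    qed
  qed measurable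
qed

text \<open>Weierstrass approximation of \<open>h\<close> on [0,1] by a polynomial. As all
  \<open>r n\<close> and \<open>r'\<close> lie in [0,1], the error is uniform in n, and the
  polynomial case is a finite combination of moments.\<close>

lemma (in prob_space) moment_convergence:
  fixes X :: "'a \<Rightarrow> real" and r :: "nat \<Rightarrow> 'a \<Rightarrow> real"
  assumes [measurable]: "X \<in> borel_measurable M" "\<And>n. r n \<in> borel_measurable M" "r' \<in> borel_measurable M"
    and X: "AE \<omega> in M. 0 \<le> X \<omega> \<and> X \<omega> \<le> 1"
    and r: "\<And>n \<omega>. 0 \<le> r n \<omega> \<and> r n \<omega> \<le> 1" and r': "\<And>\<omega>. 0 \<le> r' \<omega> \<and> r' \<omega> \<le> 1"
    and mom: "\<And>j. (\<lambda>n. expectation (\<lambda>\<omega>. X \<omega> ^ j * r n \<omega>)) \<longlonglongrightarrow> expectation (\<lambda>\<omega>. X \<omega> ^ j * r' \<omega>)"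
    and h: "continuous_on UNIV h"
  shows "(\<lambda>n. expectation (\<lambda>\<omega>. h (X \<omega>) * r n \<omega>)) \<longlonglongrightarrow> expectation (\<lambda>\<omega>. h (X \<omega>) * r' \<omega>)"
proof -
  let ?I = "\<lambda>g \<rho>. expectation (\<lambda>\<omega>. g (X \<omega>) * \<rho> \<omega>)"
  have [measurable]: "h \<in> borel_measurable borel"
    using h by (rule borel_measurable_continuous_onI)
  have int: "integrable M (\<lambda>\<omega>. g (X \<omega>) * \<rho> \<omega>)"
    if "\<rho> \<in> borel_measurable M" "\<And>\<omega>. 0 \<le> \<rho> \<omega> \<and> \<rho> \<omega> \<le> 1" "continuous_on UNIV g" for g :: "real \<Rightarrow> real" and \<rho>
    using that X by (intro integrable_continuous_unit) auto
  show ?thesis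
  proof (rule tendstoI)
    fix e :: real assume e: "e > 0"
    obtain p where p: "real_polynomial_function p" "\<And>x. x \<in> {0..1} \<Longrightarrow> \<bar>h x - p x\<bar> < e / 4"
      using Stone_Weierstrass_real_polynomial_function[of "{0..1}" h "e / 4"] e continuous_on_subset[OF h]
      by auto
    obtain a m where pa: "p = (\<lambda>x. \<Sum>i\<le>m. a i * x ^ i)"
      using p(1) by (auto simp: real_polynomial_function_iff_sum)
    have contp: "continuous_on UNIV p"
      unfolding pa by (intro continuous_intros)
    have exp_p: "?I p \<rho> = (\<Sum>i\<le>m. a i * expectation (\<lambda>\<omega>. X \<omega> ^ i * \<rho> \<omega>))"
      if [measurable]: "\<rho> \<in> borel_measurable M" and \<rho>: "\<And>\<omega>. 0 \<le> \<rho> \<omega> \<and> \<rho> \<omega> \<le> 1" for \<rho>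
    proof -
      have "?I p \<rho> = expectation (\<lambda>\<omega>. \<Sum>i\<le>m. a i * (X \<omega> ^ i * \<rho> \<omega>))"
        by (simp add: pa sum_distrib_right mult.assoc)
      also have "\<dots> = (\<Sum>i\<le>m. a i * expectation (\<lambda>\<omega>. X \<omega> ^ i * \<rho> \<omega>))"
      proof (subst Bochner_Integration.integral_sum)
        show "integrable M (\<lambda>\<omega>. a i * (X \<omega> ^ i * \<rho> \<omega>))" for i
          by (intro integrable_mult_right int[OF that, of "\<lambda>x. x ^ i"] continuous_intros)
      qed simp
      finally show ?thesis .
    qed
    have close: "\<bar>?I h \<rho> - ?I p \<rho>\<bar> \<le> e / 4"
      if \<rho>m[measurable]: "\<rho> \<in> borel_measurable M" and \<rho>: "\<And>\<omega>. 0 \<le> \<rho> \<omega> \<and> \<rho> \<omega> \<le> 1" for \<rho>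
    proof -
      have "\<bar>expectation (\<lambda>\<omega>. h (X \<omega>) * \<rho> \<omega> - p (X \<omega>) * \<rho> \<omega>)\<bar>
          \<le> expectation (\<lambda>\<omega>. \<bar>h (X \<omega>) * \<rho> \<omega> - p (X \<omega>) * \<rho> \<omega>\<bar>)"
        by (rule integral_abs_bound)
      also have "\<dots> \<le> expectation (\<lambda>\<omega>. e / 4)"
      proof (rule integral_mono_AE)
        show "AE \<omega> in M. \<bar>h (X \<omega>) * \<rho> \<omega> - p (X \<omega>) * \<rho> \<omega>\<bar> \<le> e / 4"
          using X
        proof eventually_elim
          case (elim \<omega>)
          then have "\<bar>h (X \<omega>) - p (X \<omega>)\<bar> * \<bar>\<rho> \<omega>\<bar> \<le> e / 4 * 1"
            using p(2)[of "X \<omega>"] \<rho>[of \<omega>] e by (intro mult_mono) auto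
          then show ?case by (simp add: left_diff_distrib[symmetric] abs_mult)
        qed
      qed (use int[OF that h] int[OF that contp] in auto)
      finally show ?thesis
        using int[OF that h] int[OF that contp] by (simp add: prob_space)
    qed
    have "(\<lambda>n. ?I p (r n)) \<longlonglongrightarrow> ?I p r'"
      using r r' by (simp add: exp_p) (intro tendsto_intros mom)
    then have "\<forall>\<^sub>F n in sequentially. dist (?I p (r n)) (?I p r') < e / 4"
      by (rule tendstoD) (use e in simp)
    then show "\<forall>\<^sub>F n in sequentially. dist (?I h (r n)) (?I h r') < e"
    proof eventually_elim
      case (elim n)
      then show ?case
        using close[OF assms(2) r, of n] close[OF assms(3) r'] e unfolding dist_real_def by linarith
    qed
  qed
qed

text \<open>The exponential law of rate 1. Under it e^(-t) takes values in the unit interval almost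
  surely, so Laplace transforms at integer parameters become moments of a bounded variable.\<close>

definition expo :: "real measure" where
  "expo = density lborel (exponential_density 1)"

lemma prob_space_expo: "prob_space expo"
  unfolding expo_def by (rule prob_space_exponential_density) simp

lemma sets_expo [measurable_cong]: "sets expo = sets borel"
  by (simp add: expo_def)

lemma AE_expo: "(AE t in expo. P t) \<longleftrightarrow> (AE t in lborel. t \<ge> 0 \<longrightarrow> P t)"
proof -
  have "(AE t in expo. P t) \<longleftrightarrow> (AE t in lborel. exponential_density 1 t > 0 \<longrightarrow> P t)"
    unfolding expo_def by (subst AE_density) auto
  then show ?thesis by (simp add: exponential_density_def not_less)
qed

lemma AE_expo_pos: "AE t in expo. t > 0"
  unfolding AE_expo using AE_lborel_singleton[of "0::real"] by eventually_elim auto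

text \<open>The density contributes one more factor e^(-t), so the moment of order \<open>j\<close>
  is the transform at \<open>j + 1\<close>.\<close>

lemma integral_expo_power:
  assumes [measurable]: "g \<in> borel_measurable borel"
  shows "(\<integral>t. exp (- t) ^ j * (indicator {0<..} t * g t) \<partial>expo)
       = (LBINT t:{0<..}. exp (- real (Suc j) * t) * g t)"
proof -
  have "(\<integral>t. exp (- t) ^ j * (indicator {0<..} t * g t) \<partial>expo)
      = (\<integral>t. exponential_density 1 t *\<^sub>R (exp (- t) ^ j * (indicator {0<..} t * g t)) \<partial>lborel)"
    unfolding expo_def by (rule integral_density) (auto simp: exponential_density_nonneg)
  also have "\<dots> = (LBINT t:{0<..}. exp (- real (Suc j) * t) * g t)"
    unfolding set_lebesgue_integral_def
    by (intro Bochner_Integration.integral_cong)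
       (auto simp: exponential_density_def indicator_def exp_of_nat_mult[symmetric] mult_exp_exp algebra_simps)
  finally show ?thesis .
qed

lemma AE_expo_unit: "AE t in expo. 0 \<le> exp (- t) \<and> exp (- t) \<le> (1::real)"
  using AE_expo_pos by eventually_elim auto

text \<open>A continuous test function, for a < c positive exactly on the interval between
  \<open>a\<close> and \<open>c\<close>. Composed with e^(-t), which reverses order, it localises on
  a time window.\<close>

definition bump :: "real \<Rightarrow> real \<Rightarrow> real \<Rightarrow> real" where
  "bump a c x = max 0 ((x - a) * (c - x))"

lemma bump_nonneg: "bump a c x \<ge> 0"
  by (simp add: bump_def)

lemma continuous_bump: "continuous_on UNIV (bump a c)"
  unfolding bump_def[abs_def] by (intro continuous_intros)

lemma bump_measurable [measurable]: "bump a c \<in> borel_measurable borel"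
  by (intro borel_measurable_continuous_onI continuous_bump)

lemma bump_pos_iff: "a < c \<Longrightarrow> bump a c x > 0 \<longleftrightarrow> a < x \<and> x < c"
  by (auto simp: bump_def less_max_iff_disj zero_less_mult_iff)

lemma bump_exp_pos_iff: "p < q \<Longrightarrow> bump (exp (- q)) (exp (- p)) (exp (- t)) > 0 \<longleftrightarrow> p < t \<and> t < q"
  by (subst bump_pos_iff) auto

lemma integrable_bump:
  assumes "\<rho> \<in> borel_measurable borel" "\<And>t. 0 \<le> \<rho> t \<and> \<rho> t \<le> 1"
  shows "integrable expo (\<lambda>t. bump a c (exp (- t)) * \<rho> t)"
proof -
  interpret prob_space expo by (rule prob_space_expo)
  show ?thesis
    using assms AE_expo_unit by (intro integrable_continuous_unit continuous_bump) auto
qed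

lemma expectation_bump_pos:
  assumes "0 \<le> p" "p < q"
  shows "(\<integral>t. bump (exp (- q)) (exp (- p)) (exp (- t)) \<partial>expo) > 0"
proof -
  define f where "f t = bump (exp (- q)) (exp (- p)) (exp (- t))" for t
  have [measurable]: "f \<in> borel_measurable borel" unfolding f_def by measurable
  have int: "integrable expo f"
    using integrable_bump[of "\<lambda>_. 1"] by (simp add: f_def[abs_def])
  have "\<not> (AE t in expo. f t = 0)"
  proof
    assume "AE t in expo. f t = 0"
    then have "AE t in lborel. \<not> (t \<in> {p<..<q})"
      unfolding AE_expo
    proof eventually_elim
      case (elim t)
      show ?case
      proof
        assume "t \<in> {p<..<q}"
        then have "f t > 0" "t \<ge> 0"
          using assms bump_exp_pos_iff[OF assms(2), of t] by (auto simp: f_def)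
        with elim show False by simp
      qed
    qed
    then have "emeasure lborel {p<..<q} = 0"
      by (subst (asm) AE_iff_measurable[of "{p<..<q}"]) auto
    then show False using assms by simp
  qed
  then have "(\<integral>t. f t \<partial>expo) \<noteq> 0"
    by (subst integral_nonneg_eq_0_iff_AE[OF int]) (auto simp: f_def bump_nonneg)
  moreover have "(\<integral>t. f t \<partial>expo) \<ge> 0"
    by (intro integral_nonneg_AE) (auto simp: f_def bump_nonneg)
  ultimately show ?thesis unfolding f_def by linarith
qed

lemma Asl_le_1:
  assumes "0 < \<alpha>" "\<alpha> < 1" "u \<le> 1"
  shows "Asl \<alpha> u \<le> 1"
proof -
  have "Asl \<alpha> u \<le> Asl \<alpha> 1"
    using assms by (intro Asl_mono) auto
  also have "Asl \<alpha> 1 = sin (\<alpha> * pi) / pi * (Gamma \<alpha> * Gamma (1 - \<alpha>))"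
    using integral_unique[OF arcsine_has_integral[OF assms(1,2)]] by (simp add: Asl_def Beta_def)
  also have "\<dots> = 1"
    using sin_alpha_pos[OF assms(1,2)] by (simp add: Gamma_reflection_alpha[OF assms(1,2)])
  finally show ?thesis .
qed

lemma laplace_Asl_integral:
  assumes \<alpha>: "0 < \<alpha>" "\<alpha> < 1" and l: "l > 0" and s: "s > 0"
  shows "l * (LBINT t:{0<..}. exp (- l * t) * Asl \<alpha> (t / (t + s)))
       = arcsine_laplace \<alpha> l s"
proof -
  let ?f = "\<lambda>t. l * exp (- (l * t)) * Asl \<alpha> (t / (t + s))"
  have "continuous_on {0<..} ?f"
    using s by (intro continuous_intros continuous_on_compose2[OF continuous_on_Asl[OF \<alpha>]]) auto
  then have m: "(\<lambda>t. indicator {0<..} t *\<^sub>R ?f t) \<in> borel_measurable borel"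
    by (intro borel_measurable_continuous_on_indicator) auto
  have "l * (LBINT t:{0<..}. exp (- l * t) * Asl \<alpha> (t / (t + s)))
      = (LBINT t:{0<..}. ?f t)"
    by (subst set_integral_mult_right[symmetric]) (simp add: mult.assoc)
  also have "\<dots> = enn2real (\<integral>\<^sup>+t. ennreal (indicator {0<..} t *\<^sub>R ?f t) \<partial>lborel)"
    unfolding set_lebesgue_integral_def
  proof (rule integral_eq_nn_integral)
    show "AE t in lborel. 0 \<le> indicator {0<..} t *\<^sub>R ?f t"
      using l s Asl_nonneg[OF \<alpha>] by (intro AE_I2) (auto simp: indicator_def intro!: mult_nonneg_nonneg)
  qed (use m in simp)
  also have "(\<integral>\<^sup>+t. ennreal (indicator {0<..} t *\<^sub>R ?f t) \<partial>lborel)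
      = (\<integral>\<^sup>+t. ennreal (?f t) * indicator {0<..} t \<partial>lborel)"
    by (intro nn_integral_cong) (auto simp: indicator_def)
  also have "enn2real \<dots> = arcsine_laplace \<alpha> l s"
    unfolding laplace_Asl[OF \<alpha> l s] by (simp add: arcsine_laplace_def[OF \<alpha>])
  finally show ?thesis .
qed

text \<open>Monotonicity of the two-time function in both endpoints of the window turns convergence of
  averages over small time windows into pointwise convergence.\<close>

lemma laplace_inversion:
  fixes f :: "nat \<Rightarrow> real \<Rightarrow> real \<Rightarrow> real"
  assumes \<alpha>: "0 < \<alpha>" "\<alpha> < 1" and \<theta>: "\<theta> > 0"
    and cont: "\<And>n s. continuous_on UNIV (\<lambda>t. f n t s)"
    and bnd: "\<And>n t s. t \<ge> 0 \<Longrightarrow> s \<ge> 0 \<Longrightarrow> 0 \<le> f n t s \<and> f n t s \<le> 1"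
    and mono: "\<And>n t t' s s'. 0 \<le> t \<Longrightarrow> t \<le> t' \<Longrightarrow> t' + s' \<le> t + s \<Longrightarrow> f n t s \<le> f n t' s'"
    and lap: "\<And>i j s. s \<in> {\<theta> - min 1 \<theta> / real (i + 2), \<theta> + min 1 \<theta> / real (i + 2)} \<Longrightarrow>
       (\<lambda>n. real (Suc j) * (LBINT t:{0<..}. exp (- real (Suc j) * t) * f n t s)) \<longlonglongrightarrow>
       arcsine_laplace \<alpha> (real (Suc j)) s"
  shows "(\<lambda>n. f n 1 \<theta>) \<longlonglongrightarrow> Asl \<alpha> (1 / (1 + \<theta>))"
proof -
  interpret prob_space expo by (rule prob_space_expo)
  define rho where "rho s t = indicator {0<..} t * Asl \<alpha> (t / (t + s))" for s t :: real
  define rn where "rn n s t = indicator {0<..} t * f n t s" for n and s t :: real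
  have fm[measurable]: "(\<lambda>t. f n t s) \<in> borel_measurable borel" for n s
    using cont by (rule borel_measurable_continuous_onI)
  have rn_m[measurable]: "rn n s \<in> borel_measurable borel" for n s
    unfolding rn_def by measurable
  have rn_b: "0 \<le> rn n s t \<and> rn n s t \<le> 1" if "s \<ge> 0" for n s t
    using bnd[of t s n] that by (auto simp: rn_def indicator_def)
  have rho_m: "rho s \<in> borel_measurable borel" if s: "s > 0" for s
  proof -
    have "continuous_on {0<..} (\<lambda>t. Asl \<alpha> (t / (t + s)))"
      using s by (intro continuous_on_compose2[OF continuous_on_Asl[OF \<alpha>]] continuous_intros) auto
    then have "(\<lambda>t. indicator {0<..} t *\<^sub>R Asl \<alpha> (t / (t + s))) \<in> borel_measurable borel"
      by (intro borel_measurable_continuous_on_indicator) auto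
    then show ?thesis by (simp add: rho_def[abs_def])
  qed
  have rho_b: "0 \<le> rho s t \<and> rho s t \<le> 1" if "s > 0" for s t
    using Asl_nonneg[OF \<alpha>, of "t / (t + s)"] Asl_le_1[OF \<alpha>, of "t / (t + s)"] that
    by (auto simp: rho_def indicator_def)
  \<comment> \<open>Only countably many lengths \<open>s\<close> are available, because each
    transform converges outside a null set of its own; this is why the window length is perturbed by
    fixed steps.\<close>
  have conv: "(\<lambda>n. \<integral>t. h (exp (- t)) * rn n s t \<partial>expo) \<longlonglongrightarrow> (\<integral>t. h (exp (- t)) * rho s t \<partial>expo)"
    if s: "s \<in> {\<theta> - min 1 \<theta> / real (i + 2), \<theta> + min 1 \<theta> / real (i + 2)}" "s > 0"
      and h: "continuous_on UNIV h" for s i h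
  proof (rule moment_convergence[OF _ _ _ _ _ _ _ h])
    show "AE t in expo. 0 \<le> exp (- t) \<and> exp (- t) \<le> 1"
      by (rule AE_expo_unit)
    fix j
    define L where "L = arcsine_laplace \<alpha> (real (Suc j)) s"
    have "(\<lambda>n. real (Suc j) * (\<integral>t. exp (- t) ^ j * rn n s t \<partial>expo)) \<longlonglongrightarrow> L"
      using lap[OF s(1), of j] unfolding rn_def L_def by (subst integral_expo_power) auto
    moreover have "real (Suc j) * (\<integral>t. exp (- t) ^ j * rho s t \<partial>expo) = L"
    proof -
      have "rho s = (\<lambda>t. indicator {0<..} t * rho s t)"
        by (auto simp: rho_def indicator_def)
      then have "(\<integral>t. exp (- t) ^ j * rho s t \<partial>expo) = (\<integral>t. exp (- t) ^ j * (indicator {0<..} t * rho s t) \<partial>expo)"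
        by metis
      also have "\<dots> = (LBINT t:{0<..}. exp (- real (Suc j) * t) * rho s t)"
        by (rule integral_expo_power[OF rho_m[OF s(2)]])
      also have "\<dots> = (LBINT t:{0<..}. exp (- real (Suc j) * t) * Asl \<alpha> (t / (t + s)))"
        unfolding set_lebesgue_integral_def
        by (intro Bochner_Integration.integral_cong) (auto simp: rho_def indicator_def)
      finally show ?thesis
        using laplace_Asl_integral[OF \<alpha>, of "real (Suc j)" s] s(2) by (simp add: L_def)
    qed
    ultimately have "(\<lambda>n. real (Suc j) * (\<integral>t. exp (- t) ^ j * rn n s t \<partial>expo) / real (Suc j))
        \<longlonglongrightarrow> real (Suc j) * (\<integral>t. exp (- t) ^ j * rho s t \<partial>expo) / real (Suc j)"
      by (intro tendsto_divide tendsto_const) auto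
    then show "(\<lambda>n. \<integral>t. exp (- t) ^ j * rn n s t \<partial>expo) \<longlonglongrightarrow> (\<integral>t. exp (- t) ^ j * rho s t \<partial>expo)"
      by (simp del: of_nat_Suc)
  qed (use rn_b rho_b rho_m s in \<open>auto simp: sets_expo\<close>)
  \<comment> \<open>Dividing by at least 2 keeps \<open>1 - e i\<close> and
    \<open>\<theta> - e i\<close> positive.\<close>
  define e where "e i = min 1 \<theta> / real (i + 2)" for i
  have e: "0 < e i" "e i < 1" "e i < \<theta>" for i
  proof -
    have "min 1 \<theta> > 0" using \<theta> by simp
    then have "min 1 \<theta> / real (i + 2) < min 1 \<theta>"
      by (subst pos_divide_less_eq) auto
    then show "e i < 1" "e i < \<theta>" by (auto simp: e_def)
    show "0 < e i" using \<theta> by (simp add: e_def)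
  qed
  \<comment> \<open>The sign \<open>\<sigma>\<close> is 1 for the upper and -1 for the lower bound.\<close>
  have window: "\<forall>\<^sub>F n in sequentially. \<sigma> * f n 1 \<theta> < a"
    if s: "s \<in> {\<theta> - e i, \<theta> + e i}" "s > 0"
      and pq: "0 \<le> p" "p < q"
      and f_le: "\<And>n t. p < t \<Longrightarrow> t < q \<Longrightarrow> \<sigma> * f n 1 \<theta> \<le> \<sigma> * f n t s"
      and Asl_le: "\<And>t. p < t \<Longrightarrow> t < q \<Longrightarrow> \<sigma> * Asl \<alpha> (t / (t + s)) \<le> A"
      and a: "A < a" for i s p q \<sigma> A a
  proof -
    define h where "h = bump (exp (- q)) (exp (- p))"
    have pos: "h (exp (- t)) > 0 \<longleftrightarrow> p < t \<and> t < q" for t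
      unfolding h_def using pq by (intro bump_exp_pos_iff)
    have h0: "h x \<ge> 0" for x by (simp add: h_def bump_nonneg)
    have h_mono: "h (exp (- t)) * v \<le> h (exp (- t)) * v'" if "p < t \<Longrightarrow> t < q \<Longrightarrow> v \<le> v'" for t v v'
      using that pos[of t] h0[of "exp (- t)"] by (cases "h (exp (- t)) = 0") (auto intro!: mult_left_mono)
    let ?I = "\<lambda>\<rho>. \<integral>t. h (exp (- t)) * \<rho> t \<partial>expo"
    define c where "c = (\<integral>t. h (exp (- t)) \<partial>expo)"
    have c: "c > 0"
      unfolding c_def h_def using pq by (intro expectation_bump_pos)
    have int: "integrable expo (\<lambda>t. h (exp (- t)) * (\<sigma> * \<rho> t))"
      if "\<rho> \<in> borel_measurable borel" "\<And>t. 0 \<le> \<rho> t \<and> \<rho> t \<le> 1" for \<rho>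
      using integrable_mult_right[OF integrable_bump[OF that], of \<sigma>] by (simp add: h_def mult_ac)
    have inth: "integrable expo (\<lambda>t. h (exp (- t)))"
      using integrable_bump[of "\<lambda>_. 1"] by (simp add: h_def)
    have le: "c * (\<sigma> * f n 1 \<theta>) \<le> \<sigma> * ?I (rn n s)" for n
    proof -
      have "c * (\<sigma> * f n 1 \<theta>) = (\<integral>t. h (exp (- t)) * (\<sigma> * f n 1 \<theta>) \<partial>expo)"
        by (simp add: c_def)
      also have "\<dots> \<le> (\<integral>t. h (exp (- t)) * (\<sigma> * rn n s t) \<partial>expo)"
        using inth int[OF rn_m rn_b] s f_le pq by (intro integral_mono h_mono) (auto simp: rn_def)
      finally show ?thesis by (simp add: mult.left_commute)
    qed
    have "\<sigma> * ?I (rho s) = (\<integral>t. h (exp (- t)) * (\<sigma> * rho s t) \<partial>expo)"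
      by (simp add: mult.left_commute)
    also have "\<dots> \<le> (\<integral>t. h (exp (- t)) * A \<partial>expo)"
      using inth int[OF rho_m rho_b] s Asl_le pq by (intro integral_mono h_mono) (auto simp: rho_def)
    also have "\<dots> < c * a"
      using a c by (simp add: c_def)
    finally have "\<sigma> * ?I (rho s) < c * a" .
    moreover have "(\<lambda>n. \<sigma> * ?I (rn n s)) \<longlonglongrightarrow> \<sigma> * ?I (rho s)"
      unfolding h_def by (intro tendsto_mult_left conv[OF s(1)[unfolded e_def] s(2)] continuous_bump)
    ultimately have "\<forall>\<^sub>F n in sequentially. \<sigma> * ?I (rn n s) < c * a"
      by (intro order_tendstoD(2))
    then show ?thesis
    proof eventually_elim
      case (elim n)
      then have "c * (\<sigma> * f n 1 \<theta>) < c * a" using le[of n] by simp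
      then show ?case using c by simp
    qed
  qed
  \<comment> \<open>For t between 1 and 1 + e the window of length \<theta> - e from t lies inside
    the one of length \<theta> from 1. The arcsine argument increases in t and reaches (1 + e)/(1 +
    \<theta>) at the right end.\<close>
  have upper: "\<forall>\<^sub>F n in sequentially. f n 1 \<theta> < a" if a: "Asl \<alpha> ((1 + e i) / (1 + \<theta>)) < a" for a i
  proof -
    have "Asl \<alpha> (t / (t + (\<theta> - e i))) \<le> Asl \<alpha> ((1 + e i) / (1 + \<theta>))" if t: "1 < t" "t < 1 + e i" for t
    proof (rule Asl_mono[OF \<alpha>])
      have "(1 + e i) * (t + (\<theta> - e i)) - t * (1 + \<theta>) = (1 + e i - t) * (\<theta> - e i)"
        by (simp add: algebra_simps)
      also have "\<dots> \<ge> 0" using t e[of i] by simp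
      finally show "t / (t + (\<theta> - e i)) \<le> (1 + e i) / (1 + \<theta>)"
        using t e[of i] \<theta> by (subst frac_le_eq) (auto simp: divide_le_0_iff mult.commute)
      show "(1 + e i) / (1 + \<theta>) \<le> 1" using e[of i] by simp
    qed
    then show ?thesis
      using window[of "\<theta> - e i" i 1 "1 + e i" 1 "Asl \<alpha> ((1 + e i) / (1 + \<theta>))" a] a e[of i] mono
      by simp
  qed
  \<comment> \<open>Symmetrically, for t between 1 - e and 1 the window of length \<theta> + e from
    t contains the target window.\<close>
  have lower: "\<forall>\<^sub>F n in sequentially. f n 1 \<theta> > a" if a: "Asl \<alpha> ((1 - e i) / (1 + \<theta>)) > a" for a i
  proof -
    have "Asl \<alpha> ((1 - e i) / (1 + \<theta>)) \<le> Asl \<alpha> (t / (t + (\<theta> + e i)))" if t: "1 - e i < t" "t < 1" for t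
    proof (rule Asl_mono[OF \<alpha>])
      have "t * (1 + \<theta>) - (1 - e i) * (t + (\<theta> + e i)) = (t - (1 - e i)) * (\<theta> + e i)"
        by (simp add: algebra_simps)
      also have "\<dots> \<ge> 0" using t e[of i] \<theta> by simp
      finally show "(1 - e i) / (1 + \<theta>) \<le> t / (t + (\<theta> + e i))"
        using t e[of i] \<theta> by (subst frac_le_eq) (auto simp: divide_le_0_iff mult.commute)
      show "t / (t + (\<theta> + e i)) \<le> 1" using t e[of i] \<theta> by simp
    qed
    moreover have "f n t (\<theta> + e i) \<le> f n 1 \<theta>" if "1 - e i < t" "t < 1" for n t
      using that e[of i] by (intro mono) auto
    ultimately have "\<forall>\<^sub>F n in sequentially. - 1 * f n 1 \<theta> < - a"
      using a e[of i] \<theta> by (intro window[of "\<theta> + e i" i "1 - e i" 1 "- 1" "- Asl \<alpha> ((1 - e i) / (1 + \<theta>))"]) auto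
    then show ?thesis by simp
  qed
  have e_lim: "e \<longlonglongrightarrow> 0"
  proof -
    have "(\<lambda>i. min 1 \<theta> * (1 / real (i + 2))) \<longlonglongrightarrow> min 1 \<theta> * 0"
      by (intro tendsto_intros LIMSEQ_ignore_initial_segment[OF lim_1_over_n])
    then show ?thesis by (simp add: e_def[abs_def])
  qed
  have Asl_lim: "(\<lambda>i. Asl \<alpha> (u i)) \<longlonglongrightarrow> Asl \<alpha> (1 / (1 + \<theta>))"
    if u: "u \<longlonglongrightarrow> 1 / (1 + \<theta>)" "\<And>i. u i \<in> {0..1}" for u
    using continuous_on_tendsto_compose[OF continuous_on_Asl[OF \<alpha>] u(1)] u(2) \<theta> by (simp add: field_simps)
  show ?thesis
  proof (rule order_tendstoI)
    fix a assume a: "Asl \<alpha> (1 / (1 + \<theta>)) < a"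
    have "(\<lambda>i. Asl \<alpha> ((1 + e i) / (1 + \<theta>))) \<longlonglongrightarrow> Asl \<alpha> (1 / (1 + \<theta>))"
    proof (rule Asl_lim)
      have "(\<lambda>i. (1 + e i) / (1 + \<theta>)) \<longlonglongrightarrow> (1 + 0) / (1 + \<theta>)"
        using \<theta> by (intro tendsto_intros e_lim) auto
      then show "(\<lambda>i. (1 + e i) / (1 + \<theta>)) \<longlonglongrightarrow> 1 / (1 + \<theta>)" by simp
      show "(1 + e i) / (1 + \<theta>) \<in> {0..1}" for i
        using e[of i] \<theta> by auto
    qed
    then have "\<forall>\<^sub>F i in sequentially. Asl \<alpha> ((1 + e i) / (1 + \<theta>)) < a"
      using a by (rule order_tendstoD)
    then obtain i where "Asl \<alpha> ((1 + e i) / (1 + \<theta>)) < a"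
      by (auto simp: eventually_sequentially)
    then show "\<forall>\<^sub>F n in sequentially. f n 1 \<theta> < a" by (rule upper)
  next
    fix a assume a: "a < Asl \<alpha> (1 / (1 + \<theta>))"
    have "(\<lambda>i. Asl \<alpha> ((1 - e i) / (1 + \<theta>))) \<longlonglongrightarrow> Asl \<alpha> (1 / (1 + \<theta>))"
    proof (rule Asl_lim)
      have "(\<lambda>i. (1 - e i) / (1 + \<theta>)) \<longlonglongrightarrow> (1 - 0) / (1 + \<theta>)"
        using \<theta> by (intro tendsto_intros e_lim) auto
      then show "(\<lambda>i. (1 - e i) / (1 + \<theta>)) \<longlonglongrightarrow> 1 / (1 + \<theta>)" by simp
      show "(1 - e i) / (1 + \<theta>) \<in> {0..1}" for i
        using e[of i] \<theta> by auto
    qed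
    then have "\<forall>\<^sub>F i in sequentially. Asl \<alpha> ((1 - e i) / (1 + \<theta>)) > a"
      using a by (rule order_tendstoD)
    then obtain i where "Asl \<alpha> ((1 - e i) / (1 + \<theta>)) > a"
      by (auto simp: eventually_sequentially)
    then show "\<forall>\<^sub>F n in sequentially. f n 1 \<theta> > a" by (rule lower)
  qed
qed

subsection \<open>Aging\<close>

context random_energy
begin

abbreviation gen :: "nat \<Rightarrow> 'w \<Rightarrow> (nat \<Rightarrow> int) \<Rightarrow> (nat \<Rightarrow> int) \<Rightarrow> real" where
  "gen n \<omega> \<equiv> trap_gen n (rate n \<omega>)"

abbreviation trans :: "nat \<Rightarrow> 'w \<Rightarrow> real \<Rightarrow> (nat \<Rightarrow> int) \<Rightarrow> (nat \<Rightarrow> int) \<Rightarrow> real" where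
  "trans n \<omega> \<equiv> mexp (hcube n) (gen n \<omega>)"

lemma trap_cube_rate: "n \<ge> 1 \<Longrightarrow> trap_cube n (rate n \<omega>)"
  by standard (auto simp: rate_pos)

lemma generator_rate: "n \<ge> 1 \<Longrightarrow> finite_generator (hcube n) (gen n \<omega>)"
proof -
  assume "n \<ge> 1"
  then interpret trap_cube n "rate n \<omega>" by (rule trap_cube_rate)
  show ?thesis by unfold_locales
qed

definition no_jump :: "nat \<Rightarrow> 'w \<Rightarrow> real \<Rightarrow> real \<Rightarrow> real" where
  "no_jump n \<omega> t s = finite_generator.stay (hcube n) (gen n \<omega>) (hcube_one n) t s"

text \<open>Both means in the ratio have order e^(-bn). After normalisation their limits share the
  constant \<open>l * Gamma (1 + \<alpha>)\<close>, which cancels and leaves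
  \<open>arcsine_laplace\<close>.\<close>

lemma laplace_no_jump_tendsto:
  assumes l: "l > 0" and s: "s \<ge> 0"
  shows "AE \<omega> in M. (\<lambda>n. l * (LBINT t:{0<..}. exp (- l * t) * no_jump n \<omega> t s)) \<longlonglongrightarrow>
     arcsine_laplace \<alpha> l s"
  using max_excess_tendsto[OF l] killing_at_start[OF l] cube_mean_reward[OF l s] cube_mean_reward[OF l order_refl]
proof eventually_elim
  case (elim \<omega>)
  define c where "c n = cube_mean n (reward n l s \<omega>) / cube_mean n (killing n l \<omega>)" for n
  define u where "u n = l * (LBINT t:{0<..}. exp (- l * t) * no_jump n \<omega> t s)" for n
  have "(\<lambda>n. (exp (b * real n) * cube_mean n (reward n l s \<omega>)) / (exp (b * real n) * cube_mean n (reward n l 0 \<omega>)))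
      \<longlonglongrightarrow> reward_limit l s / reward_limit l 0"
    using elim(3,4) reward_limit_0_pos[OF l] by (intro tendsto_divide) auto
  then have "c \<longlonglongrightarrow> reward_limit l s / reward_limit l 0"
    by (simp add: c_def[abs_def] reward_0)
  moreover have "reward_limit l s / reward_limit l 0
      = arcsine_laplace \<alpha> l s"
  proof -
    have "Gamma (1 + \<alpha>) > 0" using \<alpha> by (intro Gamma_real_pos) simp
    then show ?thesis using l by (simp add: reward_limit_def arcsine_laplace_def[OF \<alpha>])
  qed
  moreover have "(\<lambda>n. u n - c n) \<longlonglongrightarrow> 0"
  proof (rule Lim_null_comparison)
    show "\<forall>\<^sub>F n in sequentially. norm (u n - c n) \<le> 2 * max_excess n l \<omega> + killing n l \<omega> (hcube_one n)"
      using eventually_ge_at_top[of 1]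
    proof eventually_elim
      case (elim n)
      interpret trap_cube n "rate n \<omega>" by (rule trap_cube_rate[OF elim])
      have k: "kill l = killing n l \<omega>"
        by (simp add: fun_eq_iff kill_def killing_def)
      have "u n = laplace_stay l (hcube_one n) s"
        by (simp add: u_def laplace_stay_def no_jump_def)
      moreover have "c n = cube_mean n (\<lambda>x. kill l x * exp (- rate n \<omega> x * s)) / cube_mean n (kill l)"
        by (simp add: c_def k reward_def[abs_def])
      ultimately show ?case
        using laplace_stay_approx[OF l s hcube_one_in, of "max_excess n l \<omega>"] green_excess_le_max
        by (simp add: k)
    qed
    have "(\<lambda>n. 2 * max_excess n l \<omega> + killing n l \<omega> (hcube_one n)) \<longlonglongrightarrow> 2 * 0 + 0"
      using elim(1,2) by (intro tendsto_intros)
    then show "(\<lambda>n. 2 * max_excess n l \<omega> + killing n l \<omega> (hcube_one n)) \<longlonglongrightarrow> 0"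
      by simp
  qed
  ultimately have "(\<lambda>n. (u n - c n) + c n) \<longlonglongrightarrow> 0 + arcsine_laplace \<alpha> l s"
    by (intro tendsto_add) auto
  then show ?case by (simp add: u_def)
qed

lemma return_minus_no_jump_tendsto:
  assumes t: "t \<ge> 0" and s: "s \<ge> 0"
  shows "AE \<omega> in M. (\<lambda>n. (\<Sum>y\<in>hcube n. trans n \<omega> t (hcube_one n) y * trans n \<omega> s y y)
      - no_jump n \<omega> t s) \<longlonglongrightarrow> 0"
  using max_excess_tendsto[OF zero_less_one] cube_mean_reward[OF zero_less_one order_refl]
proof eventually_elim
  case (elim \<omega>)
  define m where "m n = exp (b * real n) * cube_mean n (reward n 1 0 \<omega>)" for n
  \<comment> \<open>This is \<open>hit_bound\<close> with 2^n times the mean killing probability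
    written as m_n e^((ln 2 - b) n), where m_n has a positive limit; the last term therefore
    vanishes as b < ln 2.\<close>
  define H where "H n = 2 * (7 / real n + real n ^ 2 / 2 ^ n + 5 * (exp (- ((ln 2 - b) * real n)) / m n))" for n
  have "(\<lambda>n. 7 / real n) \<longlonglongrightarrow> 0" "(\<lambda>n. real n ^ 2 / 2 ^ n) \<longlonglongrightarrow> 0"
    by real_asymp+
  moreover have "(\<lambda>n. exp (- ((ln 2 - b) * real n))) \<longlonglongrightarrow> 0"
    using summable_LIMSEQ_zero[OF summable_exp_neg[of "ln 2 - b"]] b_less by simp
  moreover have "m \<longlonglongrightarrow> reward_limit 1 0"
    using elim(2) by (simp add: m_def[abs_def])
  moreover have "reward_limit 1 0 \<noteq> 0"
    using reward_limit_0_pos[of 1] by simp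
  ultimately have H: "H \<longlonglongrightarrow> 2 * (0 + 0 + 5 * (0 / reward_limit 1 0))"
    unfolding H_def by (intro tendsto_add tendsto_mult tendsto_const tendsto_divide[of _ 0])
  have "\<forall>\<^sub>F n in sequentially. max_excess n 1 \<omega> < 1"
    using elim(1) by (rule order_tendstoD) simp
  then have "\<forall>\<^sub>F n in sequentially. norm ((\<Sum>y\<in>hcube n. trans n \<omega> t (hcube_one n) y
      * trans n \<omega> s y y) - no_jump n \<omega> t s) \<le> exp s * H n"
    using eventually_ge_at_top[of 1]
  proof eventually_elim
    case (elim n)
    interpret trap_cube n "rate n \<omega>" by (rule trap_cube_rate[OF elim(2)])
    have k: "kill 1 = killing n 1 \<omega>"
      by (simp add: fun_eq_iff kill_def killing_def)
    have "2 ^ n * cube_mean n (kill 1) = m n * (2 ^ n * exp (- (b * real n)))"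
      by (simp add: m_def k reward_0 exp_minus)
    also have "\<dots> = m n * exp ((ln 2 - b) * real n)"
      by (simp only: two_power_exp)
    finally have "hit_bound = H n"
      by (simp add: hit_bound_def H_def exp_minus divide_inverse)
    moreover have "green_excess n (kill 1) x \<le> 1" if "x \<in> hcube n" for x
      using green_excess_le_max[OF that, of 1 \<omega>] elim(1) by (simp add: k)
    ultimately show ?case
      using return_prob_approx[OF _ t s hcube_one_in] by (simp add: no_jump_def)
  qed
  moreover have "(\<lambda>n. exp s * H n) \<longlonglongrightarrow> 0"
    using tendsto_mult_left[OF H, of "exp s"] by simp
  ultimately show ?case by (rule Lim_null_comparison)
qed

lemma ctmc_same_prob_eq:
  assumes "n \<ge> 1"
  shows "ctmc_same_prob (hcube n) (btm_rate n \<beta> (\<lambda>x. E n x \<omega>)) (hcube_one n)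
           (exp (\<alpha> * \<beta>\<^sup>2 * real n)) ((1 + \<theta>) * exp (\<alpha> * \<beta>\<^sup>2 * real n))
       = (\<Sum>y\<in>hcube n. trans n \<omega> 1 (hcube_one n) y * trans n \<omega> \<theta> y y)"
proof -
  define c where "c = exp (\<alpha> * \<beta>\<^sup>2 * real n)"
  have d: "rate n \<omega> = (\<lambda>x. c / trap \<beta> (\<lambda>x. E n x \<omega>) x)"
    by (simp add: fun_eq_iff rate_def c_def)
  have "(1 + \<theta>) * c - c = c * \<theta>"
    by (simp add: algebra_simps)
  then have "ctmc_same_prob (hcube n) (btm_rate n \<beta> (\<lambda>x. E n x \<omega>)) (hcube_one n) c ((1 + \<theta>) * c)
     = (\<Sum>y\<in>hcube n. ctmc_trans (hcube n) (btm_rate n \<beta> (\<lambda>x. E n x \<omega>)) (c * 1) (hcube_one n) y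
          * ctmc_trans (hcube n) (btm_rate n \<beta> (\<lambda>x. E n x \<omega>)) (c * \<theta>) y y)"
    by (simp add: ctmc_same_prob_def)
  also have "\<dots> = (\<Sum>y\<in>hcube n. trans n \<omega> 1 (hcube_one n) y * trans n \<omega> \<theta> y y)"
    unfolding d using assms by (intro sum.cong refl arg_cong2[of _ _ _ _ "(*)"] ctmc_trans_btm) auto
  finally show ?thesis by (simp only: c_def)
qed

lemma aging:
  assumes \<theta>: "\<theta> > 0"
  shows "AE \<omega> in M. (\<lambda>n. ctmc_same_prob (hcube n) (btm_rate n \<beta> (\<lambda>x. E n x \<omega>)) (hcube_one n)
           (exp (\<alpha> * \<beta>\<^sup>2 * real n)) ((1 + \<theta>) * exp (\<alpha> * \<beta>\<^sup>2 * real n))) \<longlonglongrightarrow> Asl \<alpha> (1 / (1 + \<theta>))"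
    (is "AE \<omega> in M. (\<lambda>n. ?p n \<omega>) \<longlonglongrightarrow> _")
proof -
  define S where "S i = {\<theta> - min 1 \<theta> / real (i + 2), \<theta> + min 1 \<theta> / real (i + 2)}" for i :: nat
  have S: "s \<ge> 0" if "s \<in> S i" for i s
  proof -
    have "min 1 \<theta> / real (i + 2) \<le> min 1 \<theta> / 1"
      using \<theta> by (intro divide_left_mono) auto
    moreover have "min 1 \<theta> / real (i + 2) \<ge> 0"
      using \<theta> by simp
    ultimately show ?thesis using that by (auto simp: S_def)
  qed
  have "AE \<omega> in M. \<forall>i j. \<forall>s\<in>S i. (\<lambda>n. real (Suc j) * (LBINT t:{0<..}. exp (- real (Suc j) * t) * no_jump n \<omega> t s)) \<longlonglongrightarrow>
       arcsine_laplace \<alpha> (real (Suc j)) s"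
    unfolding AE_all_countable
  proof (intro allI AE_ball_countable')
    show "countable (S i)" for i by (simp add: S_def)
    show "AE \<omega> in M. (\<lambda>n. real (Suc j) * (LBINT t:{0<..}. exp (- real (Suc j) * t) * no_jump n \<omega> t s)) \<longlonglongrightarrow>
       arcsine_laplace \<alpha> (real (Suc j)) s"
      if "s \<in> S i" for i j s
      using S[OF that] by (intro laplace_no_jump_tendsto) auto
  qed
  moreover have "AE \<omega> in M. (\<lambda>n. (\<Sum>y\<in>hcube n. trans n \<omega> 1 (hcube_one n) y
      * trans n \<omega> \<theta> y y) - no_jump n \<omega> 1 \<theta>) \<longlonglongrightarrow> 0"
    using \<theta> by (intro return_minus_no_jump_tendsto) auto
  ultimately show ?thesis
  proof eventually_elim
    case (elim \<omega>)
    \<comment> \<open>The inversion lemma asks for its bounds at every index, while the generator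
      properties are established from n = 1 on; hence the shift by one.\<close>
    have "(\<lambda>n. no_jump (Suc n) \<omega> 1 \<theta>) \<longlonglongrightarrow> Asl \<alpha> (1 / (1 + \<theta>))"
    proof (rule laplace_inversion[OF \<alpha> \<theta>])
      have gen: "finite_generator (hcube (Suc n)) (gen (Suc n) \<omega>)" for n
        by (rule generator_rate) simp
      show "continuous_on UNIV (\<lambda>t. no_jump (Suc n) \<omega> t s)" for n s
        unfolding no_jump_def by (rule finite_generator.continuous_on_stay[OF gen])
      show "0 \<le> no_jump (Suc n) \<omega> t s \<and> no_jump (Suc n) \<omega> t s \<le> 1" if "t \<ge> 0" "s \<ge> 0" for n t s
        unfolding no_jump_def using that hcube_one_in
        by (auto intro!: finite_generator.stay_nonneg[OF gen] finite_generator.stay_le_1[OF gen])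
      show "no_jump (Suc n) \<omega> t s \<le> no_jump (Suc n) \<omega> t' s'"
        if "0 \<le> t" "t \<le> t'" "t' + s' \<le> t + s" for n t t' s s'
        unfolding no_jump_def using that hcube_one_in by (intro finite_generator.stay_mono[OF gen])
      show "(\<lambda>n. real (Suc j) * (LBINT t:{0<..}. exp (- real (Suc j) * t) * no_jump (Suc n) \<omega> t s)) \<longlonglongrightarrow>
         arcsine_laplace \<alpha> (real (Suc j)) s"
        if "s \<in> {\<theta> - min 1 \<theta> / real (i + 2), \<theta> + min 1 \<theta> / real (i + 2)}" for i j s
        using elim(1) that unfolding S_def by (intro LIMSEQ_Suc) blast
    qed
    then have "(\<lambda>n. no_jump n \<omega> 1 \<theta>) \<longlonglongrightarrow> Asl \<alpha> (1 / (1 + \<theta>))"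
      by (rule LIMSEQ_imp_Suc)
    from tendsto_add[OF elim(2) this]
    have "(\<lambda>n. \<Sum>y\<in>hcube n. trans n \<omega> 1 (hcube_one n) y * trans n \<omega> \<theta> y y)
        \<longlonglongrightarrow> Asl \<alpha> (1 / (1 + \<theta>))"
      by simp
    moreover have "\<forall>\<^sub>F n in sequentially. (\<Sum>y\<in>hcube n. trans n \<omega> 1 (hcube_one n) y
         * trans n \<omega> \<theta> y y) = ?p n \<omega>"
      using eventually_ge_at_top[of 1] by eventually_elim (simp only: ctmc_same_prob_eq)
    ultimately show ?case
      by (rule Lim_transform_eventually)
  qed
qed

end

theorem theoremt:
  fixes M :: "'w measure" and E :: "nat \<Rightarrow> (nat \<Rightarrow> int) \<Rightarrow> 'w \<Rightarrow> real"
    and \<alpha> \<beta> \<theta> :: real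
  assumes "prob_space M"
    and "0 < \<alpha>" "\<alpha> < 1" "0 < \<beta>"
    and "3/4 < \<alpha>^2 * \<beta>^2 / (2 * ln 2)" "\<alpha>^2 * \<beta>^2 / (2 * ln 2) < 1"
    and "\<And>n x. n \<ge> 1 \<Longrightarrow> x \<in> hcube n \<Longrightarrow> E n x \<in> borel_measurable M"
    and "\<And>n. n \<ge> 1 \<Longrightarrow> prob_space.indep_vars M (\<lambda>_. borel) (E n) (hcube n)"
    and "\<And>n x u. n \<ge> 1 \<Longrightarrow> x \<in> hcube n \<Longrightarrow> u \<ge> 0 \<Longrightarrow>
           measure M {\<omega> \<in> space M. - E n x \<omega> / sqrt (real n) \<ge> u} = exp (- (u^2) / 2)"
    and "0 < \<theta>"
  shows "AE \<omega> in M.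
           ((\<lambda>n. ctmc_same_prob (hcube n) (btm_rate n \<beta> (\<lambda>x. E n x \<omega>)) (hcube_one n)
                    (exp (\<alpha> * \<beta>^2 * real n)) ((1 + \<theta>) * exp (\<alpha> * \<beta>^2 * real n)))
            \<longlongrightarrow> Asl \<alpha> (1 / (1 + \<theta>))) sequentially"
proof -
  interpret prob_space M by fact
  interpret random_energy M E \<alpha> \<beta>
    using assms by unfold_locales auto
  show ?thesis using \<open>0 < \<theta>\<close> by (rule aging)
qed

end
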